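(* Let $K$ be a compact Hausdorff space and let $\mathcal{S}\subset\mathcal{L}(C(K))$ be a right amenable semigroup of Markov operators. If $\mathcal{S}$ is radical free, then the fixed space $\mathrm{fix}(\mathcal{S})$ is a Banach sublattice of $C(K)$ and the mapping $$\hat{\ }\colon \mathrm{fix}(\mathcal{S})\to C(\mathrm{Prim}(\mathcal{S})),\quad f\mapsto\hat f,$$ where $\hat f(I_\mu)=\int_K f\,d\mu$ for every ergodic $\mu\in P_{\mathcal{S}}(K)$, is an isometric Markov lattice isomorphism.
   Context: $C(K)$ is the Banach lattice of continuous complex-valued functions on $K$; its dual $C(K)'$ is identified with the complex regular Borel measures on $K$, with $\langle f,\mu\rangle=\int_K f\,d\mu$. $\mathcal{L}(C(K))$ denotes the bounded linear operators on $C(K)$; $T\in\mathcal{L}(C(K))$ is Markov if it is positive and $T\mathbf{1}=\mathbf{1}$. A semigroup $\mathcal{S}\subset\mathcal{L}(C(K))$ (under composition, with the strong operator topology) is right amenable if there is a positive $m\in C_b(\mathcal{S})'$ with $m(\mathbf{1})=1$ and $m(R_Sf)=m(f)$ for all $f\in C_b(\mathcal{S})$, $S\in\mathcal{S}$, where $(R_Sf)(T)=f(TS)$. $\mathrm{fix}(\mathcal{S})=\{f\in C(K): Sf=f\ \forall S\in\mathcal{S}\}$. $P_{\mathcal{S}}(K)$ is the set of probability measures $\mu\in C(K)'$ with $S'\mu=\mu$ for all $S\in\mathcal{S}$. For $\mu\in P_{\mathcal{S}}(K)$, let $I_\mu=\{f\in C(K): \langle |f|,\mu\rangle=0\}$;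 every $S\in\mathcal{S}$ induces (uniquely, by continuous extension) a bounded operator $S_\mu$ on $L^1(K,\mu)$, and $\mu$ is ergodic if the common fixed space of all $S_\mu$ ($S\in\mathcal{S}$) in $L^1(K,\mu)$ is one-dimensional. $\mathrm{Prim}(\mathcal{S})=\{I_\mu: \mu\in P_{\mathcal{S}}(K)\text{ ergodic}\}$ is the primitive spectrum, equipped with the hull-kernel topology: the closure of $A\subset\mathrm{Prim}(\mathcal{S})$ is $\{q\in\mathrm{Prim}(\mathcal{S}):\bigcap_{p\in A}p\subset q\}$ (the empty intersection being $C(K)$). This space is quasi-compact, and $C(\mathrm{Prim}(\mathcal{S}))$ denotes the Banach lattice of continuous complex-valued functions on it with the sup norm. $\mathcal{S}$ is radical free if $\bigcap_{p\in\mathrm{Prim}(\mathcal{S})}p=\{0\}$ (i.e. the zero ideal is a radical $\mathcal{S}$-ideal). For $f\in\mathrm{fix}(\mathcal{S})$ the value $\int_K f\,d\mu$ ($\mu$ ergodic) depends only on $I_\mu$, so $\hat f$ is well defined, and $\hat f$ is continuous. "Markov lattice isomorphism" means a bijective linear lattice homomorphism mapping $\mathbf{1}$ to $\mathbf{1}$. *)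

theory Defs
  imports "HOL-Probability.Probability"
begin

text \<open>
  For a compact Hausdorff space \<open>K\<close>, given as a type \<open>'k::t2_space\<close> with \<open>compact (UNIV :: 'k set)\<close>,
  every continuous function is bounded, so \<open>C(K)\<close> is the type of bounded continuous complex-valued
  functions with its sup norm.
\<close>

type_synonym 'k CK = "'k \<Rightarrow>\<^sub>C complex"

context
  includes bcontfun.lifting
begin

lift_definition cscale :: "complex \<Rightarrow> 'k::topological_space CK \<Rightarrow> 'k CK"
  is "\<lambda>c f x. c * f x"
proof -
  fix c :: complex and f :: "'k \<Rightarrow> complex"
  assume f: "f \<in> bcontfun"
  then obtain B where "\<And>x. cmod (f x) \<le> B"
    by (auto simp: bcontfun_def bounded_iff)
  then have "\<And>x. cmod (c * f x) \<le> cmod c * B"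
    by (simp add: norm_mult mult_left_mono)
  with f show "(\<lambda>x. c * f x) \<in> bcontfun"
    unfolding bcontfun_def bounded_iff by (auto intro!: continuous_intros)
qed

lift_definition modulus :: "'k::topological_space CK \<Rightarrow> 'k CK"
  is "\<lambda>f x. complex_of_real (cmod (f x))"
  by (auto simp: bcontfun_def bounded_iff intro!: continuous_intros)

lift_definition conjugate :: "'k::topological_space CK \<Rightarrow> 'k CK"
  is "\<lambda>f x. cnj (f x)"
  by (auto simp: bcontfun_def bounded_iff intro!: continuous_intros)

end

abbreviation one_CK :: "'k::topological_space CK" where
  "one_CK \<equiv> const_bcontfun 1"

definition banach_sublattice :: "'k::topological_space CK set \<Rightarrow> bool" where
  "banach_sublattice F \<longleftrightarrow>
     0 \<in> F \<and> (\<forall>f\<in>F. \<forall>g\<in>F. f + g \<in> F) \<and> (\<forall>c. \<forall>f\<in>F. cscale c f \<in> F) \<and>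
     (\<forall>f\<in>F. conjugate f \<in> F) \<and> (\<forall>f\<in>F. modulus f \<in> F) \<and> closed F"


subsection \<open>Semigroups of Markov operators\<close>

text \<open>The type \<open>\<Rightarrow>\<^sub>L\<close> only provides real linearity; complex homogeneity is added here.\<close>

type_synonym 'k opCK = "'k CK \<Rightarrow>\<^sub>L 'k CK"

definition complex_linear_op :: "'k::topological_space opCK \<Rightarrow> bool" where
  "complex_linear_op S \<longleftrightarrow> (\<forall>c f. blinfun_apply S (cscale c f) = cscale c (blinfun_apply S f))"

definition positive_op :: "'k::topological_space opCK \<Rightarrow> bool" where
  "positive_op S \<longleftrightarrow> (\<forall>f. (\<forall>x. apply_bcontfun f x \<in> \<real>\<^sub>\<ge>\<^sub>0) \<longrightarrow>
                          (\<forall>x. apply_bcontfun (blinfun_apply S f) x \<in> \<real>\<^sub>\<ge>\<^sub>0))"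

definition markov_op :: "'k::topological_space opCK \<Rightarrow> bool" where
  "markov_op S \<longleftrightarrow> complex_linear_op S \<and> positive_op S \<and> blinfun_apply S one_CK = one_CK"

definition op_semigroup :: "'k::topological_space opCK set \<Rightarrow> bool" where
  "op_semigroup \<S> \<longleftrightarrow> (\<forall>S\<in>\<S>. \<forall>T\<in>\<S>. S o\<^sub>L T \<in> \<S>)"

definition fix_space :: "'k::topological_space opCK set \<Rightarrow> 'k CK set" where
  "fix_space \<S> = {f. \<forall>S\<in>\<S>. blinfun_apply S f = f}"


subsection \<open>Continuous functions on a topology, and right amenability\<close>

text \<open>
  Functions on a topological space \<open>X\<close> are represented by functions on the ambient type that are
  \<open>undefined\<close> outside \<open>topspace X\<close>, so that equality is equality on \<open>topspace X\<close>.
\<close>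

definition continuous_functions :: "'a topology \<Rightarrow> ('a \<Rightarrow> complex) set" where
  "continuous_functions X = {g \<in> extensional (topspace X). continuous_map X euclidean g}"

definition bounded_continuous_functions :: "'a topology \<Rightarrow> ('a \<Rightarrow> complex) set" where
  "bounded_continuous_functions X = {g \<in> continuous_functions X. bounded (g ` topspace X)}"

text \<open>Meaningful for bounded functions on a nonempty space.\<close>

definition sup_norm :: "'a topology \<Rightarrow> ('a \<Rightarrow> complex) \<Rightarrow> real" where
  "sup_norm X g = (SUP x\<in>topspace X. cmod (g x))"

definition positive_normalized_functional ::
    "'a topology \<Rightarrow> (('a \<Rightarrow> complex) \<Rightarrow> complex) \<Rightarrow> bool" where
  "positive_normalized_functional X m \<longleftrightarrow>
     (\<forall>f\<in>bounded_continuous_functions X. \<forall>g\<in>bounded_continuous_functions X.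
        m (\<lambda>x\<in>topspace X. f x + g x) = m f + m g) \<and>
     (\<forall>c. \<forall>f\<in>bounded_continuous_functions X. m (\<lambda>x\<in>topspace X. c * f x) = c * m f) \<and>
     (\<exists>B. \<forall>f\<in>bounded_continuous_functions X. cmod (m f) \<le> B * sup_norm X f) \<and>
     (\<forall>f\<in>bounded_continuous_functions X. (\<forall>x\<in>topspace X. f x \<in> \<real>\<^sub>\<ge>\<^sub>0) \<longrightarrow> m f \<in> \<real>\<^sub>\<ge>\<^sub>0) \<and>
     m (\<lambda>x\<in>topspace X. 1) = 1"

definition right_translate ::
    "'k::topological_space opCK set \<Rightarrow> 'k opCK \<Rightarrow> ('k opCK \<Rightarrow> complex) \<Rightarrow> 'k opCK \<Rightarrow> complex" where
  "right_translate \<S> S f = (\<lambda>T\<in>\<S>. f (T o\<^sub>L S))"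

definition right_amenable :: "'k::topological_space opCK set \<Rightarrow> bool" where
  "right_amenable \<S> \<longleftrightarrow>
     (let X = subtopology strong_operator_topology \<S> in
      \<exists>m. positive_normalized_functional X m \<and>
          (\<forall>S\<in>\<S>. \<forall>f\<in>bounded_continuous_functions X. m (right_translate \<S> S f) = m f))"


subsection \<open>Invariant and ergodic measures\<close>

definition regular_borel_measure :: "'k::topological_space measure \<Rightarrow> bool" where
  "regular_borel_measure \<mu> \<longleftrightarrow> sets \<mu> = sets borel \<and>
     (\<forall>A\<in>sets borel.
        emeasure \<mu> A = (SUP C\<in>{C. compact C \<and> C \<subseteq> A}. emeasure \<mu> C) \<and>
        emeasure \<mu> A = (INF U\<in>{U. open U \<and> A \<subseteq> U}. emeasure \<mu> U))"

text \<open>The equation \<open>S'\<mu> = \<mu>\<close> is an equation between functionals on \<open>C(K)\<close>.\<close>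

definition invariant_measures :: "'k::topological_space opCK set \<Rightarrow> 'k measure set" where
  "invariant_measures \<S> =
     {\<mu>. prob_space \<mu> \<and> regular_borel_measure \<mu> \<and>
         (\<forall>S\<in>\<S>. \<forall>f. (LINT x|\<mu>. apply_bcontfun (blinfun_apply S f) x) = (LINT x|\<mu>. apply_bcontfun f x))}"

text \<open>
  Elements of \<open>L\<^sup>1(K, \<mu>)\<close> are represented by integrable functions, with \<open>\<mu>\<close>-a.e. equality as equality;
  accordingly an operator on \<open>L\<^sup>1(K, \<mu>)\<close> acts on representatives.
\<close>

definition L1_bounded_operator ::
    "'k measure \<Rightarrow> (('k \<Rightarrow> complex) \<Rightarrow> 'k \<Rightarrow> complex) \<Rightarrow> bool" where
  "L1_bounded_operator \<mu> E \<longleftrightarrow>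
     (\<forall>g. integrable \<mu> g \<longrightarrow> integrable \<mu> (E g)) \<and>
     (\<forall>g h. integrable \<mu> g \<longrightarrow> integrable \<mu> h \<longrightarrow> (AE x in \<mu>. g x = h x) \<longrightarrow>
        (AE x in \<mu>. E g x = E h x)) \<and>
     (\<forall>g h. integrable \<mu> g \<longrightarrow> integrable \<mu> h \<longrightarrow>
        (AE x in \<mu>. E (\<lambda>y. g y + h y) x = E g x + E h x)) \<and>
     (\<forall>c g. integrable \<mu> g \<longrightarrow> (AE x in \<mu>. E (\<lambda>y. c * g y) x = c * E g x)) \<and>
     (\<exists>B. \<forall>g. integrable \<mu> g \<longrightarrow> (LINT x|\<mu>. cmod (E g x)) \<le> B * (LINT x|\<mu>. cmod (g x)))"

text \<open>
  \<open>S\<^sub>\<mu>\<close>, the bounded operator on \<open>L\<^sup>1(K, \<mu>)\<close> induced by \<open>S\<close>. For Markov \<open>S\<close> and an invariant \<open>\<mu>\<close> it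
  exists, because \<open>\<parallel>Sf\<parallel>\<^sub>1 \<le> \<parallel>f\<parallel>\<^sub>1\<close> on \<open>C(K)\<close>, and it is unique up to \<open>\<mu>\<close>-null sets, because \<open>C(K)\<close> is
  dense in \<open>L\<^sup>1(K, \<mu>)\<close>; the choice operator therefore only selects representatives.
\<close>

definition induced_L1_operator ::
    "'k::topological_space measure \<Rightarrow> 'k opCK \<Rightarrow> ('k \<Rightarrow> complex) \<Rightarrow> 'k \<Rightarrow> complex" where
  "induced_L1_operator \<mu> S =
     (SOME E. L1_bounded_operator \<mu> E \<and>
        (\<forall>f. AE x in \<mu>. E (apply_bcontfun f) x = apply_bcontfun (blinfun_apply S f) x))"

definition L1_fix_space ::
    "'k::topological_space opCK set \<Rightarrow> 'k measure \<Rightarrow> ('k \<Rightarrow> complex) set" where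
  "L1_fix_space \<S> \<mu> =
     {g. integrable \<mu> g \<and> (\<forall>S\<in>\<S>. AE x in \<mu>. induced_L1_operator \<mu> S g x = g x)}"

text \<open>Ergodicity: \<open>L1_fix_space\<close> modulo a.e. equality has complex dimension one.\<close>

definition ergodic_measures :: "'k::topological_space opCK set \<Rightarrow> 'k measure set" where
  "ergodic_measures \<S> =
     {\<mu> \<in> invariant_measures \<S>.
        \<exists>e\<in>L1_fix_space \<S> \<mu>. \<not> (AE x in \<mu>. e x = 0) \<and>
          (\<forall>g\<in>L1_fix_space \<S> \<mu>. \<exists>c. AE x in \<mu>. g x = c * e x)}"


subsection \<open>The primitive spectrum\<close>

definition null_ideal :: "'k::topological_space measure \<Rightarrow> 'k CK set" where
  "null_ideal \<mu> = {f. (LINT x|\<mu>. cmod (apply_bcontfun f x)) = 0}"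

definition Prim :: "'k::topological_space opCK set \<Rightarrow> 'k CK set set" where
  "Prim \<S> = null_ideal ` ergodic_measures \<S>"

definition hull_kernel_closure ::
    "'k::topological_space opCK set \<Rightarrow> 'k CK set set \<Rightarrow> 'k CK set set" where
  "hull_kernel_closure \<S> A = {q \<in> Prim \<S>. \<Inter>A \<subseteq> q}"

text \<open>The topology on \<open>Prim \<S>\<close> whose closed sets are the sets equal to their hull-kernel closure.\<close>

definition hull_kernel_topology :: "'k::topological_space opCK set \<Rightarrow> 'k CK set topology" where
  "hull_kernel_topology \<S> =
     topology (\<lambda>U. U \<subseteq> Prim \<S> \<and> hull_kernel_closure \<S> (Prim \<S> - U) = Prim \<S> - U)"

definition radical_free :: "'k::topological_space opCK set \<Rightarrow> bool" where
  "radical_free \<S> \<longleftrightarrow> \<Inter>(Prim \<S>) = {0}"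

text \<open>
  The value of \<open>hat \<S> f\<close> at \<open>p\<close> is the common value of the integrals of \<open>f\<close> over all ergodic \<open>\<mu>\<close> with
  \<open>I\<^sub>\<mu> = p\<close>.
\<close>

definition hat :: "'k::topological_space opCK set \<Rightarrow> 'k CK \<Rightarrow> 'k CK set \<Rightarrow> complex" where
  "hat \<S> f = (\<lambda>p\<in>Prim \<S>. THE c. \<forall>\<mu>\<in>ergodic_measures \<S>.
                 null_ideal \<mu> = p \<longrightarrow> (LINT x|\<mu>. apply_bcontfun f x) = c)"

definition isometric_markov_lattice_isomorphism ::
    "'k::topological_space CK set \<Rightarrow> 'a topology \<Rightarrow> ('k CK \<Rightarrow> 'a \<Rightarrow> complex) \<Rightarrow> bool" where
  "isometric_markov_lattice_isomorphism F X \<Phi> \<longleftrightarrow>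
     bij_betw \<Phi> F (continuous_functions X) \<and>
     (\<forall>f\<in>F. \<forall>g\<in>F. \<forall>x\<in>topspace X. \<Phi> (f + g) x = \<Phi> f x + \<Phi> g x) \<and>
     (\<forall>c. \<forall>f\<in>F. \<forall>x\<in>topspace X. \<Phi> (cscale c f) x = c * \<Phi> f x) \<and>
     (\<forall>f\<in>F. \<forall>x\<in>topspace X. \<Phi> (modulus f) x = complex_of_real (cmod (\<Phi> f x))) \<and>
     one_CK \<in> F \<and> (\<forall>x\<in>topspace X. \<Phi> one_CK x = 1) \<and>
     (\<forall>f\<in>F. sup_norm X (\<Phi> f) = norm f)"

end

theory Submission
  imports Defs
begin

text \<open>
  For \<open>f\<close> in the fixed space and \<open>\<mu>\<close> ergodic, \<open>f\<close> is \<open>\<mu>\<close>-a.e. equal to the constant \<open>\<integral>f d\<mu>\<close>, that is,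
  \<open>f - \<integral>f d\<mu>\<close> lies in the invariant ideal \<open>I\<^sub>\<mu>\<close>. Conversely, if the radical vanishes, a function that is
  a.e. constant for each ergodic measure is fixed. This gives the sublattice property, the isometry and
  the continuity of the transform of \<open>f\<close>.

  For surjectivity let \<open>g\<close> be continuous on the primitive spectrum and \<open>x \<in> K\<close>. Right amenability
  produces from the point mass at \<open>x\<close> an invariant state that kills every \<open>h \<ge> 0\<close> with \<open>T h x = 0\<close> for
  all \<open>T\<close>; an extreme such state is represented by an ergodic measure \<open>\<eta>\<close>, and one puts \<open>f x = g I\<^sub>\<eta>\<close>.
  If \<open>B\<close> is a closed set of primitive ideals not containing \<open>I\<^sub>\<eta>\<close>, some \<open>k \<in> \<Inter>B\<close> is not in \<open>I\<^sub>\<eta>\<close>, hence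
  \<open>h = T \<bar>k\<bar> \<in> \<Inter>B\<close> does not vanish at \<open>x\<close> for some \<open>T\<close>, and every ergodic measure charging the
  neighbourhood \<open>{h \<noteq> 0}\<close> of \<open>x\<close> has its ideal outside \<open>B\<close>. Since the supports of the ergodic
  measures have dense union, this shows that \<open>f\<close> is continuous and equals \<open>g I\<^sub>\<mu>\<close> \<open>\<mu>\<close>-a.e.
\<close>

subsection \<open>Positive functionals and their contents\<close>

text \<open>The measure theory is done with real functions: a Markov operator maps real functions to
  real ones, so a \<open>state\<close> acts on these and complex statements are recovered from real
  and imaginary parts. Functionals are total on all functions but constrained only on continuous
  ones.

  Two obstacles shape the rest. First, ergodicity refers to operators on L1 known only up to null
  sets. The extension of \<open>S\<close> is an L1 contraction, so \<open>g\<close> is fixed exactly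
  when \<open>S f\<close> is never farther from \<open>g\<close> than \<open>f\<close> is, for all
  continuous \<open>f\<close>. This condition mentions no operator on L1, and lattice operations on
  fixed functions are carried out on approximants. Extremality gives ergodicity because a
  nonconstant fixed function has a superlevel set with fixed indicator, which splits the measure.

  Second, K need not be metrizable, so the open set where some member of an ideal is nonzero is an
  uncountable union; inner regularity reduces its null-set questions to finite subcovers. These open
  sets obey a zero-one law for ergodic measures, which makes primitive ideals prime; primeness is
  what makes the hull-kernel closure that of a topology.\<close>

definition state :: "(('k::topological_space \<Rightarrow> real) \<Rightarrow> real) \<Rightarrow> bool" where
  "state \<phi> \<longleftrightarrow>
     (\<forall>f g. continuous_on UNIV f \<longrightarrow> continuous_on UNIV g \<longrightarrow> \<phi> (\<lambda>x. f x + g x) = \<phi> f + \<phi> g) \<and>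
     (\<forall>c f. continuous_on UNIV f \<longrightarrow> \<phi> (\<lambda>x. c * f x) = c * \<phi> f) \<and>
     (\<forall>f. continuous_on UNIV f \<longrightarrow> (\<forall>x. 0 \<le> f x) \<longrightarrow> 0 \<le> \<phi> f) \<and>
     \<phi> (\<lambda>_. 1) = 1"

context
  fixes \<phi> :: "('k::topological_space \<Rightarrow> real) \<Rightarrow> real"
  assumes state: "state \<phi>"
begin

lemma state_add: "continuous_on UNIV f \<Longrightarrow> continuous_on UNIV g \<Longrightarrow> \<phi> (\<lambda>x. f x + g x) = \<phi> f + \<phi> g"
  using state unfolding state_def by blast

lemma state_scale: "continuous_on UNIV f \<Longrightarrow> \<phi> (\<lambda>x. c * f x) = c * \<phi> f"
  using state unfolding state_def by blast

lemma state_nonneg: "continuous_on UNIV f \<Longrightarrow> (\<And>x. 0 \<le> f x) \<Longrightarrow> 0 \<le> \<phi> f"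
  using state unfolding state_def by blast

lemma state_const: "\<phi> (\<lambda>_. c) = c"
  using state_scale[of "\<lambda>_. 1" c] state unfolding state_def by simp

lemma state_diff:
  assumes "continuous_on UNIV f" "continuous_on UNIV g"
  shows "\<phi> (\<lambda>x. f x - g x) = \<phi> f - \<phi> g"
proof -
  have "continuous_on UNIV (\<lambda>x. -1 * g x)"
    using assms by (intro continuous_intros)
  then show ?thesis
    using state_add[OF assms(1), of "\<lambda>x. -1 * g x"] state_scale[OF assms(2), of "-1"] by simp
qed

lemma state_mono:
  assumes "continuous_on UNIV f" "continuous_on UNIV g" "\<And>x. f x \<le> g x"
  shows "\<phi> f \<le> \<phi> g"
proof -
  have "0 \<le> \<phi> (\<lambda>x. g x - f x)"
    using assms by (intro state_nonneg continuous_intros) auto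
  then show ?thesis using state_diff[OF assms(2,1)] by simp
qed

lemma state_sum:
  fixes n :: nat
  assumes "\<And>i. continuous_on UNIV (f i)"
  shows "\<phi> (\<lambda>x. \<Sum>i<n. f i x) = (\<Sum>i<n. \<phi> (f i))"
proof (induction n)
  case 0
  then show ?case using state_const[of 0] by simp
next
  case (Suc n)
  have "continuous_on UNIV (\<lambda>x. \<Sum>i<n. f i x)"
    using assms by (intro continuous_intros)
  then show ?case using state_add[of "\<lambda>x. \<Sum>i<n. f i x" "f n"] assms Suc by (simp add: add.commute)
qed

end

section \<open>The inner content of a state and the outer measure it generates\<close>

definition state_content :: "(('k::topological_space \<Rightarrow> real) \<Rightarrow> real) \<Rightarrow> 'k set \<Rightarrow> real" where
  "state_content \<phi> U =
     (SUP f\<in>{f. continuous_on UNIV f \<and> (\<forall>x. 0 \<le> f x \<and> f x \<le> indicator U x)}. \<phi> f)"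

definition content_outer :: "(('k::topological_space \<Rightarrow> real) \<Rightarrow> real) \<Rightarrow> 'k set \<Rightarrow> ennreal" where
  "content_outer \<phi> A = (INF U\<in>{U. open U \<and> A \<subseteq> U}. ennreal (state_content \<phi> U))"

context
  fixes \<phi> :: "('k::topological_space \<Rightarrow> real) \<Rightarrow> real"
  assumes state: "state \<phi>"
begin

lemma state_content_upper:
  assumes "continuous_on UNIV f" "\<And>x. 0 \<le> f x" "\<And>x. f x \<le> indicator U x"
  shows "\<phi> f \<le> state_content \<phi> U"
  unfolding state_content_def
proof (rule cSUP_upper)
  show "bdd_above (\<phi> ` {f. continuous_on UNIV f \<and> (\<forall>x. 0 \<le> f x \<and> f x \<le> indicator U x)})"
  proof (rule bdd_aboveI2)
    fix g :: "'k \<Rightarrow> real"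
    assume g: "g \<in> {f. continuous_on UNIV f \<and> (\<forall>x. 0 \<le> f x \<and> f x \<le> indicator U x)}"
    have "g x \<le> 1" for x
      using g indicator_le_1[of U x] by (auto intro: order_trans)
    then have "\<phi> g \<le> \<phi> (\<lambda>_. 1)"
      using g by (intro state_mono[OF state]) auto
    then show "\<phi> g \<le> 1" using state_const[OF state] by simp
  qed
qed (use assms in auto)

lemma state_content_least:
  assumes "\<And>f. continuous_on UNIV f \<Longrightarrow> (\<And>x. 0 \<le> f x) \<Longrightarrow> (\<And>x. f x \<le> indicator U x) \<Longrightarrow> \<phi> f \<le> c"
  shows "state_content \<phi> U \<le> c"
  unfolding state_content_def
  by (rule cSUP_least) (use assms in \<open>auto intro!: exI[of _ "\<lambda>_. 0"]\<close>)

lemma state_content_nonneg: "0 \<le> state_content \<phi> U"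
  using state_content_upper[of "\<lambda>_. 0" U] state_const[OF state, of 0] by simp

lemma state_content_mono: "U \<subseteq> V \<Longrightarrow> state_content \<phi> U \<le> state_content \<phi> V"
  by (rule state_content_least, rule state_content_upper)
     (auto intro: order_trans[OF _ indicator_leI] simp: subset_iff)

lemma state_content_empty: "state_content \<phi> {} = 0"
proof -
  have "state_content \<phi> {} \<le> 0"
  proof (rule state_content_least)
    fix f :: "'k \<Rightarrow> real"
    assume "continuous_on UNIV f" "\<And>x. 0 \<le> f x" "\<And>x. f x \<le> indicator {} x"
    then have "f = (\<lambda>_. 0)" by (intro ext antisym) auto
    then show "\<phi> f \<le> 0" using state_const[OF state, of 0] by simp
  qed
  then show ?thesis using state_content_nonneg[of "{}"] by simp
qed

lemma state_content_UNIV: "state_content \<phi> UNIV = 1"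
proof (rule antisym)
  show "state_content \<phi> UNIV \<le> 1"
  proof (rule state_content_least)
    fix f :: "'k \<Rightarrow> real"
    assume "continuous_on UNIV f" "\<And>x. 0 \<le> f x" "\<And>x. f x \<le> indicator UNIV x"
    then have "\<phi> f \<le> \<phi> (\<lambda>_. 1)"
      by (intro state_mono[OF state]) auto
    then show "\<phi> f \<le> 1" using state_const[OF state] by simp
  qed
  show "1 \<le> state_content \<phi> UNIV"
    using state_content_upper[of "\<lambda>_. 1" UNIV] state_const[OF state, of 1] by simp
qed

text \<open>
  The support of the positive part of \<open>f - e\<close> is compact in every open set containing \<open>{f > 0}\<close>;
  this replaces the compactly supported functions of the usual construction.
\<close>

lemma state_truncate:
  assumes "continuous_on UNIV f"
  shows "\<phi> f \<le> \<phi> (\<lambda>x. max 0 (f x - e)) + e"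
proof -
  have c: "continuous_on UNIV (\<lambda>x. max 0 (f x - e))"
    using assms by (intro continuous_intros)
  have "\<phi> f \<le> \<phi> (\<lambda>x. max 0 (f x - e) + e)"
    using c assms by (intro state_mono[OF state] continuous_intros) auto
  also have "\<dots> = \<phi> (\<lambda>x. max 0 (f x - e)) + e"
    using state_add[OF state c, of "\<lambda>_. e"] state_const[OF state, of e] by simp
  finally show ?thesis .
qed

lemma content_outer_open: "open U \<Longrightarrow> content_outer \<phi> U = ennreal (state_content \<phi> U)"
  unfolding content_outer_def
  by (intro antisym INF_lower INF_greatest ennreal_leI) (auto intro: state_content_mono)

lemma content_outer_mono: "A \<subseteq> B \<Longrightarrow> content_outer \<phi> A \<le> content_outer \<phi> B"
  unfolding content_outer_def by (rule INF_superset_mono) auto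

end

subsection \<open>The \<open>L\<^sup>1\<close> distance\<close>

text \<open>The integral of a non-integrable function is 0 by convention, so this is a pseudometric
  only on integrable functions; the triangle inequality and its relatives therefore assume
  integrability.\<close>

definition L1_dist :: "'a measure \<Rightarrow> ('a \<Rightarrow> 'b::{banach, second_countable_topology}) \<Rightarrow> ('a \<Rightarrow> 'b) \<Rightarrow> real" where
  "L1_dist M f g = (\<integral>x. norm (f x - g x) \<partial>M)"

lemma L1_dist_nonneg: "0 \<le> L1_dist M f g"
  unfolding L1_dist_def by simp

lemma L1_dist_commute: "L1_dist M f g = L1_dist M g f"
  unfolding L1_dist_def by (simp add: norm_minus_commute)

lemma L1_dist_mono:
  assumes "integrable M (\<lambda>x. f x - g x)" "integrable M (\<lambda>x. h x - k x)"
    and "AE x in M. norm (f x - g x) \<le> norm (h x - k x)"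
  shows "L1_dist M f g \<le> L1_dist M h k"
  unfolding L1_dist_def using assms by (intro integral_mono_AE integrable_norm)

lemma L1_dist_triangle:
  assumes "integrable M f" "integrable M g" "integrable M h"
  shows "L1_dist M f h \<le> L1_dist M f g + L1_dist M g h"
proof -
  have "L1_dist M f h \<le> (\<integral>x. norm (f x - g x) + norm (g x - h x) \<partial>M)"
    unfolding L1_dist_def
  proof (rule integral_mono)
    show "norm (f x - h x) \<le> norm (f x - g x) + norm (g x - h x)" for x
      using norm_triangle_ineq[of "f x - g x" "g x - h x"] by simp
  qed (use assms in auto)
  also have "\<dots> = L1_dist M f g + L1_dist M g h"
    unfolding L1_dist_def using assms by (intro Bochner_Integration.integral_add) auto
  finally show ?thesis .
qed

lemma L1_dist_add:
  assumes "integrable M f" "integrable M g" "integrable M h" "integrable M k"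
  shows "L1_dist M (\<lambda>x. f x + g x) (\<lambda>x. h x + k x) \<le> L1_dist M f h + L1_dist M g k"
proof -
  have "L1_dist M (\<lambda>x. f x + g x) (\<lambda>x. h x + k x) \<le> (\<integral>x. norm (f x - h x) + norm (g x - k x) \<partial>M)"
    unfolding L1_dist_def using assms
    by (intro integral_mono) (auto simp: add_diff_add norm_triangle_ineq)
  also have "\<dots> = L1_dist M f h + L1_dist M g k"
    unfolding L1_dist_def using assms by (intro Bochner_Integration.integral_add) auto
  finally show ?thesis .
qed

lemma L1_dist_eq_0_AE:
  assumes "integrable M f" "integrable M g" "L1_dist M f g \<le> 0"
  shows "AE x in M. f x = g x"
proof -
  have "(\<integral>x. norm (f x - g x) \<partial>M) = 0"
    using assms(3) L1_dist_nonneg[of M f g] unfolding L1_dist_def by simp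
  then have "AE x in M. norm (f x - g x) = 0"
    using assms by (subst (asm) integral_nonneg_eq_0_iff_AE) auto
  then show ?thesis by eventually_elim simp
qed

lemma L1_dist_cong_AE:
  assumes "f \<in> borel_measurable M" "f' \<in> borel_measurable M" "g \<in> borel_measurable M" "AE x in M. f x = f' x"
  shows "L1_dist M f g = L1_dist M f' g"
  unfolding L1_dist_def
  by (rule integral_cong_AE) (use assms in \<open>measurable, auto\<close>)

lemma abs_integral_diff_le_L1_dist:
  assumes "integrable M f" "integrable M g"
  shows "norm (integral\<^sup>L M f - integral\<^sup>L M g) \<le> L1_dist M f g"
proof -
  have "integral\<^sup>L M f - integral\<^sup>L M g = (\<integral>x. f x - g x \<partial>M)" using assms by simp
  then show ?thesis unfolding L1_dist_def by simp
qed

text \<open>Riesz-Fischer for a fast sequence: the summable increments give a telescoping series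
  that converges absolutely almost everywhere. The sum of the norms dominates every remainder, so
  dominated convergence yields convergence in L1.\<close>

lemma L1_complete:
  fixes h :: "nat \<Rightarrow> 'a \<Rightarrow> 'b::{banach, second_countable_topology}"
  assumes h: "\<And>n. integrable M (h n)"
    and s: "summable (\<lambda>n. L1_dist M (h (Suc n)) (h n))"
  obtains H where "integrable M H" "(\<lambda>n. L1_dist M (h n) H) \<longlonglongrightarrow> 0"
proof -
  let ?d = "\<lambda>n x. h (Suc n) x - h n x"
  have d: "integrable M (?d n)" for n using h by auto
  have dn: "integrable M (\<lambda>x. norm (?d n x))" for n using d by auto
  have "(\<integral>\<^sup>+x. (\<Sum>n. ennreal (norm (?d n x))) \<partial>M) = (\<Sum>n. \<integral>\<^sup>+x. ennreal (norm (?d n x)) \<partial>M)"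
    using d by (intro nn_integral_suminf) auto
  also have "\<dots> = (\<Sum>n. ennreal (L1_dist M (h (Suc n)) (h n)))"
    using dn by (subst nn_integral_eq_integral) (auto simp: L1_dist_def)
  also have "\<dots> < top"
    using suminf_ennreal2[OF L1_dist_nonneg s] by simp
  finally have fin: "(\<integral>\<^sup>+x. (\<Sum>n. ennreal (norm (?d n x))) \<partial>M) \<noteq> \<infinity>" by simp
  have "AE x in M. (\<Sum>n. ennreal (norm (?d n x))) \<noteq> \<infinity>"
    using d by (intro nn_integral_PInf_AE fin) auto
  then have AEs: "AE x in M. summable (\<lambda>n. norm (?d n x))"
    by eventually_elim (auto intro: summable_suminf_not_top)
  have dsum: "integrable M (\<lambda>x. \<Sum>n. ?d n x)"
    by (rule integrable_suminf[OF d AEs]) (use s in \<open>simp add: L1_dist_def\<close>)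
  have iw: "integrable M (\<lambda>x. \<Sum>n. norm (?d n x))"
    by (rule integrable_suminf[OF dn]) (use s AEs in \<open>simp_all add: L1_dist_def\<close>)
  let ?H = "\<lambda>x. h 0 x + (\<Sum>n. ?d n x)"
  have H: "integrable M ?H" using h dsum by auto
  have "(\<lambda>n. \<integral>x. norm (h n x - ?H x) \<partial>M) \<longlonglongrightarrow> (\<integral>x. 0 \<partial>M)"
  proof (rule integral_dominated_convergence)
    show "integrable M (\<lambda>x. \<Sum>n. norm (?d n x))" by (rule iw)
    have tele: "h n x = h 0 x + (\<Sum>k<n. ?d k x)" for n x
      by (induction n) auto
    show "AE x in M. (\<lambda>n. norm (h n x - ?H x)) \<longlonglongrightarrow> 0"
      using AEs
    proof eventually_elim
      case (elim x)
      have "(\<lambda>n. \<Sum>k<n. ?d k x) \<longlonglongrightarrow> (\<Sum>n. ?d n x)"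
        using summable_LIMSEQ[OF summable_norm_cancel[OF elim]] .
      then have "(\<lambda>n. h 0 x + (\<Sum>k<n. ?d k x)) \<longlonglongrightarrow> ?H x" by (intro tendsto_intros)
      then have "(\<lambda>n. h n x) \<longlonglongrightarrow> ?H x" unfolding tele[symmetric] .
      then show ?case by (intro tendsto_norm_zero LIM_zero)
    qed
    show "AE x in M. norm (norm (h n x - ?H x)) \<le> (\<Sum>n. norm (?d n x))" for n
      using AEs
    proof eventually_elim
      case (elim x)
      have s: "summable (\<lambda>k. ?d k x)" using summable_norm_cancel[OF elim] .
      have "h n x - ?H x = - (\<Sum>k. ?d (k + n) x)"
        unfolding tele[of n] suminf_split_initial_segment[OF s, of n] by simp
      then have "norm (h n x - ?H x) = norm (\<Sum>k. ?d (k + n) x)" by (simp only: norm_minus_cancel)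
      also have "\<dots> \<le> (\<Sum>k. norm (?d (k + n) x))"
        using summable_ignore_initial_segment[OF elim, of n] by (rule summable_norm)
      also have "\<dots> \<le> (\<Sum>n. norm (?d n x))"
        using suminf_split_initial_segment[OF elim, of n] sum_nonneg[of "{..<n}" "\<lambda>k. norm (?d k x)"]
        by simp
      finally show ?case by simp
    qed
  qed (use h H dsum in auto)
  then show ?thesis using that[OF H] by (simp add: L1_dist_def)
qed

lemma L1_dist_arbitrarily_small_AE:
  assumes "integrable M f" "integrable M g" "\<And>e. 0 < e \<Longrightarrow> L1_dist M f g \<le> e"
  shows "AE x in M. f x = g x"
proof (rule L1_dist_eq_0_AE[OF assms(1,2)])
  show "L1_dist M f g \<le> 0" by (rule field_le_epsilon) (use assms(3) in auto)
qed

subsection \<open>Extreme points of compact sets of functionals\<close>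

lemma Inter_finite_chain:
  assumes "finite B" "B \<noteq> {}" "\<And>X Y. X \<in> B \<Longrightarrow> Y \<in> B \<Longrightarrow> X \<subseteq> Y \<or> Y \<subseteq> X"
  shows "\<Inter>B \<in> B"
  using assms
proof (induction rule: finite_ne_induct)
  case (singleton X)
  show ?case by simp
next
  case (insert X F)
  have F: "\<Inter>F \<in> F" by (rule insert.IH) (rule insert.prems; simp)
  have "X \<subseteq> \<Inter>F \<or> \<Inter>F \<subseteq> X" by (rule insert.prems) (use F in simp_all)
  then show ?case
  proof
    assume "X \<subseteq> \<Inter>F"
    then have "\<Inter>(insert X F) = X" unfolding Inter_insert by (rule Int_absorb2)
    then show ?thesis by (metis insertI1)
  next
    assume "\<Inter>F \<subseteq> X"
    then have "\<Inter>(insert X F) = \<Inter>F" unfolding Inter_insert by (rule Int_absorb1)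
    then show ?thesis using F by (metis insertI2)
  qed
qed

definition convex_face :: "('a \<Rightarrow> real) set \<Rightarrow> ('a \<Rightarrow> real) set \<Rightarrow> bool" where
  "convex_face \<Phi> F \<longleftrightarrow> F \<subseteq> \<Phi> \<and>
     (\<forall>\<phi>\<in>F. \<forall>\<psi>\<in>\<Phi>. \<forall>\<psi>'\<in>\<Phi>. \<forall>t. 0 < t \<longrightarrow> t < 1 \<longrightarrow> \<phi> = (\<lambda>x. t * \<psi> x + (1 - t) * \<psi>' x) \<longrightarrow> \<psi> \<in> F \<and> \<psi>' \<in> F)"

lemma convex_faceD:
  assumes "convex_face \<Phi> F" "\<phi> \<in> F" "\<psi> \<in> \<Phi>" "\<psi>' \<in> \<Phi>" "0 < t" "t < 1"
    "\<phi> = (\<lambda>x. t * \<psi> x + (1 - t) * \<psi>' x)"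
  shows "\<psi> \<in> F" "\<psi>' \<in> F"
proof -
  note assms(1)[unfolded convex_face_def, THEN conjunct2]
  from bspec[OF bspec[OF bspec[OF this assms(2)] assms(3)] assms(4)]
  have "\<psi> \<in> F \<and> \<psi>' \<in> F" by (elim allE[of _ t] impE) (rule assms | assumption)+
  then show "\<psi> \<in> F" "\<psi>' \<in> F" by (rule conjunct1, rule conjunct2)
qed

lemma convex_face_subset: "convex_face \<Phi> F \<Longrightarrow> F \<subseteq> \<Phi>"
  unfolding convex_face_def by (rule conjunct1)

text \<open>A weighted average with positive weights of two values that are at most \<open>M\<close>
  equals \<open>M\<close> only if both values do.\<close>

lemma convex_face_maximizers:
  assumes F: "convex_face \<Phi> F" and le: "\<And>\<xi>. \<xi> \<in> F \<Longrightarrow> \<xi> a \<le> M"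
  shows "convex_face \<Phi> {\<xi> \<in> F. \<xi> a = M}"
  unfolding convex_face_def
proof (intro conjI ballI allI impI)
  show "{\<xi> \<in> F. \<xi> a = M} \<subseteq> \<Phi>" using convex_face_subset[OF F] by auto
  fix \<phi> \<psi> \<psi>' t
  assume \<phi>: "\<phi> \<in> {\<xi> \<in> F. \<xi> a = M}" and \<psi>: "\<psi> \<in> \<Phi>" "\<psi>' \<in> \<Phi>" and t: "0 < t" "t < (1::real)"
    and eq: "\<phi> = (\<lambda>x. t * \<psi> x + (1 - t) * \<psi>' x)"
  have "\<phi> \<in> F" using \<phi> by simp
  note mem = convex_faceD[OF F this \<psi> t eq]
  note le2 = le[OF mem(1)] le[OF mem(2)]
  have M: "M = t * \<psi> a + (1 - t) * \<psi>' a" using \<phi> fun_cong[OF eq, of a] by simp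
  have p: "0 \<le> t * (M - \<psi> a)" "0 \<le> (1 - t) * (M - \<psi>' a)" using t le2 by simp_all
  have "t * (M - \<psi> a) + (1 - t) * (M - \<psi>' a) = M - (t * \<psi> a + (1 - t) * \<psi>' a)"
    by (simp add: algebra_simps)
  then have "t * (M - \<psi> a) = 0" "(1 - t) * (M - \<psi>' a) = 0" using p M by linarith+
  then show "\<psi> \<in> {\<xi> \<in> F. \<xi> a = M}" "\<psi>' \<in> {\<xi> \<in> F. \<xi> a = M}" using t mem by auto
qed

text \<open>The Krein-Milman argument: Zorn's lemma gives a minimal nonempty closed face. Each
  coordinate attains its maximum on it, and the maximizers form a closed face again, hence all of
  it. So every coordinate is constant there and the face is a single point.\<close>

lemma extreme_point_exists:
  fixes \<Phi> :: "('a \<Rightarrow> real) set"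
  assumes comp: "compact \<Phi>" and closed: "closed \<Phi>" and ne: "\<Phi> \<noteq> {}"
  obtains \<phi> where "\<phi> \<in> \<Phi>"
    "\<And>\<psi> \<psi>' t. \<psi> \<in> \<Phi> \<Longrightarrow> \<psi>' \<in> \<Phi> \<Longrightarrow> 0 < t \<Longrightarrow> t < 1 \<Longrightarrow> \<phi> = (\<lambda>x. t * \<psi> x + (1 - t) * \<psi>' x) \<Longrightarrow> \<psi> = \<phi>"
proof -
  define \<F> where "\<F> = {F. convex_face \<Phi> F \<and> closed F \<and> F \<noteq> {}}"
  have "convex_face \<Phi> \<Phi>" unfolding convex_face_def by blast
  then have \<Phi>: "\<Phi> \<in> \<F>" using closed ne by (simp add: \<F>_def)
  \<comment> \<open>\<open>Zorn_Lemma2\<close> yields maximal sets under inclusion, so it is applied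
    to the complements of the faces.\<close>
  have "\<exists>M\<in>uminus ` \<F>. \<forall>X\<in>uminus ` \<F>. M \<subseteq> X \<longrightarrow> X = M"
  proof (rule Zorn_Lemma2, intro ballI)
    fix \<C> assume C: "\<C> \<in> chains (uminus ` \<F>)"
    show "\<exists>U\<in>uminus ` \<F>. \<forall>X\<in>\<C>. X \<subseteq> U"
    proof (cases "\<C> = {}")
      case True
      then show ?thesis using \<Phi> by auto
    next
      case False
      define \<D> where "\<D> = uminus ` \<C>"
      have D: "\<D> \<subseteq> \<F>" "\<D> \<noteq> {}"
        using C False by (auto simp: chains_def \<D>_def)
      have chain: "X \<subseteq> Y \<or> Y \<subseteq> X" if XY: "X \<in> \<D>" "Y \<in> \<D>" for X Y
      proof -
        obtain A B where "A \<in> \<C>" "B \<in> \<C>" "X = - A" "Y = - B" using XY unfolding \<D>_def by blast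
        moreover have "A \<subseteq> B \<or> B \<subseteq> A" if "A \<in> \<C>" "B \<in> \<C>" for A B
          using C that by (auto simp: chains_def chain_subset_def)
        ultimately show ?thesis unfolding \<open>X = - A\<close> \<open>Y = - B\<close> Compl_subset_Compl_iff by blast
      qed
      have DF: "convex_face \<Phi> X" "closed X" "X \<noteq> {}" if "X \<in> \<D>" for X
        using subsetD[OF D(1) that] by (simp_all add: \<F>_def)
      note sub = convex_face_subset[OF DF(1)]
      \<comment> \<open>The intersection of finitely many members of a chain is one of them, hence
        nonempty; compactness extends this to the whole chain.\<close>
      have "\<Phi> \<inter> \<Inter>\<D> \<noteq> {}"
      proof (rule compact_imp_fip[OF comp])
        show "closed T" if "T \<in> \<D>" for T by (rule DF(2)[OF that])
        fix B assume B: "finite B" "B \<subseteq> \<D>"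
        show "\<Phi> \<inter> \<Inter>B \<noteq> {}"
        proof (cases "B = {}")
          case True
          then show ?thesis using ne by simp
        next
          case False
          then have "\<Inter>B \<in> B" using B chain by (intro Inter_finite_chain) auto
          then have "\<Inter>B \<in> \<D>" using B by auto
          then show ?thesis using DF(3) sub[of "\<Inter>B"] by (metis Int_absorb1)
        qed
      qed
      moreover have "convex_face \<Phi> (\<Inter>\<D>)"
        unfolding convex_face_def
      proof (intro conjI ballI allI impI)
        show "\<Inter>\<D> \<subseteq> \<Phi>" using D sub by blast
        fix \<phi> \<psi> \<psi>' t
        assume *: "\<phi> \<in> \<Inter>\<D>" "\<psi> \<in> \<Phi>" "\<psi>' \<in> \<Phi>" "0 < t" "t < (1::real)"
          "\<phi> = (\<lambda>x. t * \<psi> x + (1 - t) * \<psi>' x)"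
        have "\<psi> \<in> X \<and> \<psi>' \<in> X" if "X \<in> \<D>" for X
        proof -
          have "\<phi> \<in> X" using *(1) that by (rule InterD)
          from convex_faceD[OF DF(1)[OF that] this *(2-6)] show ?thesis by (rule conjI)
        qed
        then show "\<psi> \<in> \<Inter>\<D>" "\<psi>' \<in> \<Inter>\<D>" by auto
      qed
      moreover have "closed (\<Inter>\<D>)" by (intro closed_Inter ballI DF(2))
      moreover have "\<Phi> \<inter> \<Inter>\<D> \<noteq> {} \<Longrightarrow> \<Inter>\<D> \<noteq> {}" by (metis Int_empty_right)
      ultimately have "\<Inter>\<D> \<in> \<F>" by (simp add: \<F>_def)
      moreover have "X \<subseteq> - \<Inter>\<D>" if "X \<in> \<C>" for X using that by (auto simp: \<D>_def)
      ultimately show ?thesis by (intro bexI[of _ "- \<Inter>\<D>"]) auto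
    qed
  qed
  then obtain M where M: "M \<in> uminus ` \<F>" "\<forall>X\<in>uminus ` \<F>. M \<subseteq> X \<longrightarrow> X = M" ..
  from M(1) obtain F where F: "M = - F" "F \<in> \<F>" ..
  have minF: "G = F" if "G \<in> \<F>" "G \<subseteq> F" for G
  proof -
    have "M \<subseteq> - G \<longrightarrow> - G = M" by (rule bspec[OF M(2)]) (rule imageI[OF that(1)])
    then show ?thesis using that(2) F(1) by simp
  qed
  have F': "convex_face \<Phi> F" "closed F" "F \<noteq> {}" "F \<subseteq> \<Phi>"
    using F(2) convex_face_subset[of \<Phi> F] by (simp_all add: \<F>_def)
  have single: "\<phi> = \<psi>" if "\<phi> \<in> F" "\<psi> \<in> F" for \<phi> \<psi>
  proof (rule ext)
    fix a
    have cF: "compact F"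
      using compact_Int_closed[OF comp F'(2)] F'(4) by (simp add: Int_absorb1)
    have ca: "continuous_on F (\<lambda>\<xi>. \<xi> a)"
      by (rule continuous_on_subset[OF continuous_on_product_coordinates]) simp
    from continuous_attains_sup[OF cF F'(3) ca]
    obtain \<xi> where \<xi>: "\<xi> \<in> F" "\<forall>\<xi>'\<in>F. \<xi>' a \<le> \<xi> a" ..
    let ?G = "{\<xi>' \<in> F. \<xi>' a = \<xi> a}"
    have "closed {\<xi>' :: 'a \<Rightarrow> real. \<xi>' a = \<xi> a}"
      by (intro closed_Collect_eq continuous_on_const continuous_on_product_coordinates)
    then have "closed (F \<inter> {\<xi>'. \<xi>' a = \<xi> a})" using F'(2) by (rule closed_Int[rotated])
    moreover have "F \<inter> {\<xi>'. \<xi>' a = \<xi> a} = ?G" by blast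
    ultimately have "closed ?G" by (simp only:)
    moreover have "convex_face \<Phi> ?G" by (rule convex_face_maximizers[OF F'(1) bspec[OF \<xi>(2)]])
    moreover have "?G \<noteq> {}" using \<xi>(1) by blast
    ultimately have "?G \<in> \<F>" by (simp only: \<F>_def mem_Collect_eq simp_thms)
    then have G: "?G = F" by (rule minF) (rule Collect_restrict)
    have "\<phi> \<in> ?G" "\<psi> \<in> ?G" unfolding G by (rule that)+
    then show "\<phi> a = \<psi> a" by simp
  qed
  obtain \<phi> where \<phi>: "\<phi> \<in> F" using F'(3) by blast
  show ?thesis
  proof (rule that[of \<phi>])
    show "\<phi> \<in> \<Phi>" using \<phi> F'(4) by auto
    fix \<psi> \<psi>' :: "'a \<Rightarrow> real" and t :: real
    assume "\<psi> \<in> \<Phi>" "\<psi>' \<in> \<Phi>" "0 < t" "t < 1" "\<phi> = (\<lambda>x. t * \<psi> x + (1 - t) * \<psi>' x)"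
    from convex_faceD(1)[OF F'(1) \<phi> this] show "\<psi> = \<phi>" using single \<phi> by auto
  qed
qed

text \<open>For Markov \<open>S\<close> and continuous \<open>f\<close> the image is already real,
  so \<open>Re\<close> loses nothing. For discontinuous \<open>f\<close> the value of
  \<open>Bcontfun\<close> is unspecified, yet the result is still continuous, being a real part of
  an element of \<open>C(K)\<close>.\<close>

definition real_action :: "'k::topological_space opCK \<Rightarrow> ('k \<Rightarrow> real) \<Rightarrow> 'k \<Rightarrow> real" where
  "real_action S f x = Re (apply_bcontfun (blinfun_apply S (Bcontfun (\<lambda>x. complex_of_real (f x)))) x)"

definition invariant_state :: "'k::topological_space opCK set \<Rightarrow> (('k \<Rightarrow> real) \<Rightarrow> real) \<Rightarrow> bool" where
  "invariant_state \<S> \<phi> \<longleftrightarrow> state \<phi> \<and>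
     (\<forall>S\<in>\<S>. \<forall>f. continuous_on UNIV f \<longrightarrow> \<phi> (real_action S f) = \<phi> f)"

context
  assumes compact_K: "compact (UNIV :: 'k::t2_space set)"
begin

subsection \<open>The Riesz representation theorem\<close>

lemma compact_of_closed: "closed (C :: 'k set) \<Longrightarrow> compact C"
  using compact_Int_closed[OF compact_K] by simp

lemma urysohn_compact:
  assumes "closed C" "open U" "C \<subseteq> (U :: 'k set)"
  obtains f :: "'k \<Rightarrow> real" where "continuous_on UNIV f" "\<And>x. 0 \<le> f x" "\<And>x. f x \<le> 1"
    "\<And>x. x \<in> C \<Longrightarrow> f x = 1" "\<And>x. x \<notin> U \<Longrightarrow> f x = 0"
proof -
  have "Hausdorff_space (euclidean :: 'k topology)"
    unfolding Hausdorff_space_def disjnt_def by (simp, meson hausdorff)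
  moreover have "compact_space (euclidean :: 'k topology)"
    using compact_K by (simp add: compact_space_def)
  ultimately have n: "normal_space (euclidean :: 'k topology)"
    using compact_Hausdorff_or_regular_imp_normal_space by blast
  obtain f where f: "continuous_map euclidean (top_of_set {0..1::real}) f"
      "f ` (-U) \<subseteq> {0}" "f ` C \<subseteq> {1}"
    by (rule Urysohn_lemma[OF n, of "-U" C 0 1]) (use assms in \<open>auto simp: disjnt_def\<close>)
  have "continuous_on UNIV f" and r: "f x \<in> {0..1}" for x
    using f(1) by (auto simp: continuous_map_in_subtopology)
  with f show ?thesis by (intro that[of f]) (auto simp: subset_iff)
qed

context
  fixes \<phi> :: "('k \<Rightarrow> real) \<Rightarrow> real"
  assumes state: "state \<phi>"
begin

text \<open>The truncation of \<open>f\<close> is split by a Urysohn function \<open>u\<close> that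
  is 1 on the closed set \<open>{x. e \<le> f x} - V\<close> and 0 off \<open>U\<close>: the part
  with factor \<open>u\<close> lies below the indicator of \<open>U\<close>, the part with factor
  \<open>1 - u\<close> below that of \<open>V\<close>.\<close>

lemma state_content_Un:
  assumes U: "open U" and V: "open V"
  shows "state_content \<phi> (U \<union> V) \<le> state_content \<phi> U + state_content \<phi> V"
proof (rule state_content_least[OF state], rule field_le_epsilon)
  fix f :: "'k \<Rightarrow> real" and e :: real
  assume f: "continuous_on UNIV f" "\<And>x. 0 \<le> f x" "\<And>x. f x \<le> indicator (U \<union> V) x" and e: "0 < e"
  let ?g = "\<lambda>x. max 0 (f x - e)"
  have g: "continuous_on UNIV ?g"
    using f by (intro continuous_intros)
  have f1: "f x \<le> 1" for x
    using order_trans[OF f(3)[of x] indicator_le_1] .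
  let ?C = "{x. e \<le> f x}"
  have "closed ?C"
    using f(1) by (intro closed_Collect_le continuous_intros)
  then have "closed (?C - V)" using V by auto
  moreover have "?C - V \<subseteq> U"
  proof
    fix x assume "x \<in> ?C - V"
    then show "x \<in> U" using f(3)[of x] e by (auto split: split_indicator_asm)
  qed
  ultimately obtain u :: "'k \<Rightarrow> real" where u: "continuous_on UNIV u" "\<And>x. 0 \<le> u x" "\<And>x. u x \<le> 1"
      "\<And>x. x \<in> ?C - V \<Longrightarrow> u x = 1" "\<And>x. x \<notin> U \<Longrightarrow> u x = 0"
    using urysohn_compact[OF _ U] by blast
  have gb: "0 \<le> ?g x \<and> ?g x \<le> 1" for x
    using f1[of x] e by auto
  have 1: "\<phi> (\<lambda>x. ?g x * u x) \<le> state_content \<phi> U"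
  proof (rule state_content_upper[OF state])
    show "continuous_on UNIV (\<lambda>x. ?g x * u x)"
      by (intro continuous_on_mult continuous_on_diff continuous_on_const g u(1))
    show "0 \<le> ?g x * u x" for x using u(2) gb[of x] by (intro mult_nonneg_nonneg) auto
    show "?g x * u x \<le> indicator U x" for x
      using mult_mono[of "?g x" 1 "u x" 1] u(2,3)[of x] u(5)[of x] gb[of x]
      by (cases "x \<in> U") auto
  qed
  have 2: "\<phi> (\<lambda>x. ?g x * (1 - u x)) \<le> state_content \<phi> V"
  proof (rule state_content_upper[OF state])
    show "continuous_on UNIV (\<lambda>x. ?g x * (1 - u x))"
      by (intro continuous_on_mult continuous_on_diff continuous_on_const g u(1))
    show "0 \<le> ?g x * (1 - u x)" for x using u(3)[of x] gb[of x] by (intro mult_nonneg_nonneg) auto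
    show "?g x * (1 - u x) \<le> indicator V x" for x
    proof (cases "x \<in> V")
      case True
      then show ?thesis
        using mult_mono[of "?g x" 1 "1 - u x" 1] u(2,3)[of x] gb[of x] by simp
    next
      case False
      then show ?thesis using u(4)[of x] by (cases "e \<le> f x") auto
    qed
  qed
  have c: "continuous_on UNIV (\<lambda>x. ?g x * u x)" "continuous_on UNIV (\<lambda>x. ?g x * (1 - u x))"
    by (intro continuous_on_mult continuous_on_diff continuous_on_const g u(1))+
  have "\<phi> f \<le> \<phi> ?g + e" by (rule state_truncate[OF state f(1)])
  also have "?g = (\<lambda>x. ?g x * u x + ?g x * (1 - u x))" by (simp add: algebra_simps)
  also have "\<phi> \<dots> = \<phi> (\<lambda>x. ?g x * u x) + \<phi> (\<lambda>x. ?g x * (1 - u x))"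
    by (rule state_add[OF state c])
  finally show "\<phi> f \<le> state_content \<phi> U + state_content \<phi> V + e" using 1 2 by linarith
qed

lemma state_content_UN_lessThan:
  fixes n :: nat
  assumes "\<And>i. open (U i)"
  shows "state_content \<phi> (\<Union>i<n. U i) \<le> (\<Sum>i<n. state_content \<phi> (U i))"
proof (induction n)
  case 0
  then show ?case by (simp add: state_content_empty[OF state])
next
  case (Suc n)
  have "state_content \<phi> (\<Union>i<Suc n. U i) = state_content \<phi> ((\<Union>i<n. U i) \<union> U n)"
    by (simp add: lessThan_Suc Un_commute)
  also have "\<dots> \<le> state_content \<phi> (\<Union>i<n. U i) + state_content \<phi> (U n)"
    using assms by (intro state_content_Un) auto
  finally show ?case using Suc by simp
qed

text \<open>Where the truncation of \<open>f\<close> is positive, \<open>f\<close> is at least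
  \<open>e\<close>. That set is closed, hence compact, so finitely many of the \<open>U i\<close>
  cover it and finite subadditivity applies.\<close>

lemma state_content_UN:
  assumes U: "\<And>i::nat. open (U i)"
  shows "ennreal (state_content \<phi> (\<Union>i. U i)) \<le> (\<Sum>i. ennreal (state_content \<phi> (U i)))"
proof (rule ennreal_le_epsilon)
  fix e :: real
  assume fin: "(\<Sum>i. ennreal (state_content \<phi> (U i))) < top" and e: "0 < e"
  let ?s = "\<Sum>i. ennreal (state_content \<phi> (U i))"
  have s: "ennreal (enn2real ?s) = ?s" using fin by simp
  have "state_content \<phi> (\<Union>i. U i) \<le> enn2real ?s + e"
  proof (rule state_content_least[OF state])
    fix f :: "'k \<Rightarrow> real"
    assume f: "continuous_on UNIV f" "\<And>x. 0 \<le> f x" "\<And>x. f x \<le> indicator (\<Union>i. U i) x"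
    let ?C = "{x. e \<le> f x}"
    have "closed ?C"
      using f(1) by (intro closed_Collect_le continuous_intros)
    then have "compact ?C" by (rule compact_of_closed)
    moreover have "?C \<subseteq> (\<Union>i. U i)"
    proof
      fix x assume "x \<in> ?C"
      then show "x \<in> (\<Union>i. U i)" using f(3)[of x] e by (cases "x \<in> (\<Union>i. U i)") auto
    qed
    ultimately obtain D where D: "finite D" "?C \<subseteq> (\<Union>i\<in>D. U i)"
      using U by (elim compactE_image[of ?C UNIV U]) auto
    then obtain n where "D \<subseteq> {..<n}" using finite_nat_iff_bounded by auto
    then have C: "?C \<subseteq> (\<Union>i<n. U i)" using D(2) by blast
    have "\<phi> (\<lambda>x. max 0 (f x - e)) \<le> state_content \<phi> (\<Union>i<n. U i)"
    proof (rule state_content_upper[OF state])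
      show "continuous_on UNIV (\<lambda>x. max 0 (f x - e))"
        using f by (intro continuous_intros)
      show "max 0 (f x - e) \<le> indicator (\<Union>i<n. U i) x" for x
      proof (cases "e \<le> f x")
        case True
        then have "x \<in> (\<Union>i<n. U i)" using C by blast
        moreover have "f x \<le> 1"
          using order_trans[OF f(3)[of x] indicator_le_1] .
        ultimately show ?thesis using e by simp
      qed auto
    qed auto
    also have "\<dots> \<le> (\<Sum>i<n. state_content \<phi> (U i))"
      by (rule state_content_UN_lessThan[OF U])
    finally have "\<phi> f \<le> (\<Sum>i<n. state_content \<phi> (U i)) + e"
      using state_truncate[OF state f(1), of e] by linarith
    moreover have "(\<Sum>i<n. state_content \<phi> (U i)) \<le> enn2real ?s"
    proof -
      have "ennreal (\<Sum>i<n. state_content \<phi> (U i)) = (\<Sum>i<n. ennreal (state_content \<phi> (U i)))"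
        by (simp add: state_content_nonneg[OF state])
      also have "\<dots> \<le> ?s" by (rule sum_le_suminf) auto
      finally show ?thesis using s by (metis enn2real_nonneg ennreal_le_iff)
    qed
    ultimately show "\<phi> f \<le> enn2real ?s + e" by linarith
  qed
  then have "ennreal (state_content \<phi> (\<Union>i. U i)) \<le> ennreal (enn2real ?s + e)"
    by (rule ennreal_leI)
  also have "\<dots> = ?s + ennreal e" using e s by (simp add: ennreal_plus)
  finally show "ennreal (state_content \<phi> (\<Union>i. U i)) \<le> ?s + ennreal e" .
qed

section \<open>Caratheodory's construction of the representing measure\<close>

lemma content_outer_close:
  assumes "0 < e"
  shows "\<exists>U. open U \<and> A \<subseteq> U \<and> ennreal (state_content \<phi> U) \<le> content_outer \<phi> A + ennreal e"
proof -
  have "content_outer \<phi> A \<le> content_outer \<phi> UNIV"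
    by (rule content_outer_mono[OF state]) simp
  then have "content_outer \<phi> A < top"
    by (simp add: content_outer_open[OF state] state_content_UNIV[OF state] order_le_less_trans)
  then have "content_outer \<phi> A < content_outer \<phi> A + ennreal e"
    using assms by (simp add: less_top)
  then obtain U where "open U" "A \<subseteq> U" "ennreal (state_content \<phi> U) < content_outer \<phi> A + ennreal e"
    unfolding content_outer_def INF_less_iff by auto
  then show ?thesis by (auto intro: less_imp_le)
qed

lemma outer_measure_space_content_outer: "outer_measure_space UNIV (content_outer \<phi>)"
  unfolding outer_measure_space_def
proof (intro conjI)
  show "positive UNIV (content_outer \<phi>)"
    by (simp add: positive_def content_outer_open[OF state] state_content_empty[OF state])
  show "increasing UNIV (content_outer \<phi>)"
    by (auto simp: increasing_def intro: content_outer_mono[OF state])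
  show "countably_subadditive UNIV (content_outer \<phi>)"
    unfolding countably_subadditive_def
  proof (intro allI impI)
    fix A :: "nat \<Rightarrow> 'k set"
    show "content_outer \<phi> (\<Union>i. A i) \<le> (\<Sum>i. content_outer \<phi> (A i))"
    proof (rule ennreal_le_epsilon)
      fix e :: real
      assume e: "0 < e"
      have "\<exists>U. open U \<and> A i \<subseteq> U \<and>
          ennreal (state_content \<phi> U) \<le> content_outer \<phi> (A i) + ennreal (e * (1/2) ^ Suc i)" for i
        using e by (intro content_outer_close) auto
      then obtain U where U: "\<And>i. open (U i)" "\<And>i. A i \<subseteq> U i"
          "\<And>i. ennreal (state_content \<phi> (U i)) \<le> content_outer \<phi> (A i) + ennreal (e * (1/2) ^ Suc i)"
        by metis
      have "content_outer \<phi> (\<Union>i. A i) \<le> content_outer \<phi> (\<Union>i. U i)"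
        using U(2) by (intro content_outer_mono[OF state]) blast
      also have "\<dots> = ennreal (state_content \<phi> (\<Union>i. U i))"
        using U(1) by (intro content_outer_open[OF state]) auto
      also have "\<dots> \<le> (\<Sum>i. ennreal (state_content \<phi> (U i)))"
        using U(1) by (rule state_content_UN)
      also have "\<dots> \<le> (\<Sum>i. content_outer \<phi> (A i) + ennreal (e * (1/2) ^ Suc i))"
        by (intro suminf_le U(3)) auto
      also have "\<dots> = (\<Sum>i. content_outer \<phi> (A i)) + (\<Sum>i. ennreal e * ennreal ((1/2) ^ Suc i))"
        using e by (subst suminf_add[symmetric])
          (auto simp del: ennreal_suminf_cmult simp add: ennreal_mult[symmetric])
      also have "\<dots> = (\<Sum>i. content_outer \<phi> (A i)) + ennreal e"
        unfolding ennreal_suminf_cmult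
        by (subst suminf_ennreal_eq[OF zero_le_power power_half_series]) auto
      finally show "content_outer \<phi> (\<Union>i. A i) \<le> (\<Sum>i. content_outer \<phi> (A i)) + ennreal e" .
    qed
  qed
qed

text \<open>Given \<open>f\<close> below the indicator of \<open>V \<inter> U\<close>, the open set
  \<open>V \<inter> {x. f x < e}\<close> contains \<open>V - U\<close>. A function \<open>g\<close>
  below its indicator never meets the truncation of \<open>f\<close>, so their sum is still
  admissible for \<open>V\<close>; additivity of the state then gives the inequality.\<close>

lemma state_content_split:
  assumes U: "open U" and V: "open V"
  shows "ennreal (state_content \<phi> (V \<inter> U)) + content_outer \<phi> (V - U) \<le> ennreal (state_content \<phi> V)"
proof -
  have le1: "content_outer \<phi> (V - U) \<le> 1"
    using content_outer_mono[OF state, of "V - U" UNIV]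
    by (simp add: content_outer_open[OF state] state_content_UNIV[OF state])
  then have ft: "content_outer \<phi> (V - U) < top"
    by (rule order_le_less_trans) simp
  define c where "c = enn2real (content_outer \<phi> (V - U))"
  have c: "content_outer \<phi> (V - U) = ennreal c" "0 \<le> c" using ft by (auto simp: c_def)
  have "state_content \<phi> (V \<inter> U) \<le> state_content \<phi> V - c"
  proof (rule state_content_least[OF state], rule field_le_epsilon)
    fix f :: "'k \<Rightarrow> real" and e :: real
    assume f: "continuous_on UNIV f" "\<And>x. 0 \<le> f x" "\<And>x. f x \<le> indicator (V \<inter> U) x" and e: "0 < e"
    let ?W = "V \<inter> {x. f x < e}"
    have oW: "open ?W"
      using V f(1) by (intro open_Int open_Collect_less continuous_intros)
    have "V - U \<subseteq> ?W"
    proof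
      fix x assume "x \<in> V - U"
      then show "x \<in> ?W" using f(3)[of x] e by auto
    qed
    then have "ennreal c \<le> ennreal (state_content \<phi> ?W)"
      using content_outer_mono[OF state] content_outer_open[OF state oW] c by metis
    then have cW: "c \<le> state_content \<phi> ?W" using state_content_nonneg[OF state] by (simp add: ennreal_le_iff)
    have cf: "continuous_on UNIV (\<lambda>x. max 0 (f x - e))"
      using f by (intro continuous_intros)
    have "state_content \<phi> ?W \<le> state_content \<phi> V - \<phi> (\<lambda>x. max 0 (f x - e))"
    proof (rule state_content_least[OF state])
      fix g :: "'k \<Rightarrow> real"
      assume g: "continuous_on UNIV g" "\<And>x. 0 \<le> g x" "\<And>x. g x \<le> indicator ?W x"
      have "\<phi> (\<lambda>x. max 0 (f x - e) + g x) \<le> state_content \<phi> V"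
      proof (rule state_content_upper[OF state])
        show "continuous_on UNIV (\<lambda>x. max 0 (f x - e) + g x)"
          using cf g(1) by (rule continuous_on_add)
        show "0 \<le> max 0 (f x - e) + g x" for x using g(2)[of x] by auto
        show "max 0 (f x - e) + g x \<le> indicator V x" for x
        proof (cases "x \<in> ?W")
          case True
          then show ?thesis using g(3)[of x] by auto
        next
          case False
          then have "g x = 0" using g(2,3)[of x] by simp
          then show ?thesis using f(2,3)[of x] e by (cases "x \<in> U") (auto simp: indicator_def)
        qed
      qed
      then show "\<phi> g \<le> state_content \<phi> V - \<phi> (\<lambda>x. max 0 (f x - e))"
        using state_add[OF state cf g(1)] by simp
    qed
    then show "\<phi> f \<le> state_content \<phi> V - c + e"
      using cW state_truncate[OF state f(1), of e] by linarith
  qed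
  then have "ennreal (state_content \<phi> (V \<inter> U) + c) \<le> ennreal (state_content \<phi> V)"
    by (intro ennreal_leI) simp
  then show ?thesis
    using c state_content_nonneg[OF state, of "V \<inter> U"] by (simp add: ennreal_plus)
qed

lemma content_outer_subadd: "content_outer \<phi> (A \<union> B) \<le> content_outer \<phi> A + content_outer \<phi> B"
proof (rule ennreal_le_epsilon)
  fix e :: real assume e: "0 < e"
  obtain U where U: "open U" "A \<subseteq> U" "ennreal (state_content \<phi> U) \<le> content_outer \<phi> A + ennreal (e/2)"
    using content_outer_close[of "e/2" A] e by auto
  obtain V where V: "open V" "B \<subseteq> V" "ennreal (state_content \<phi> V) \<le> content_outer \<phi> B + ennreal (e/2)"
    using content_outer_close[of "e/2" B] e by auto
  have "content_outer \<phi> (A \<union> B) \<le> content_outer \<phi> (U \<union> V)"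
    using U V by (intro content_outer_mono[OF state]) auto
  also have "\<dots> = ennreal (state_content \<phi> (U \<union> V))"
    using U V by (intro content_outer_open[OF state]) auto
  also have "\<dots> \<le> ennreal (state_content \<phi> U + state_content \<phi> V)"
    using U V by (intro ennreal_leI state_content_Un) auto
  also have "\<dots> = ennreal (state_content \<phi> U) + ennreal (state_content \<phi> V)"
    by (simp add: state_content_nonneg[OF state])
  also have "\<dots> \<le> (content_outer \<phi> A + ennreal (e/2)) + (content_outer \<phi> B + ennreal (e/2))"
    using U V by (intro add_mono) auto
  also have "\<dots> = content_outer \<phi> A + content_outer \<phi> B + (ennreal (e/2) + ennreal (e/2))"
    by (simp add: ac_simps)
  also have "ennreal (e/2) + ennreal (e/2) = ennreal e"
    using e by (simp flip: ennreal_plus)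
  finally show "content_outer \<phi> (A \<union> B) \<le> content_outer \<phi> A + content_outer \<phi> B + ennreal e" .
qed

text \<open>For an open \<open>V\<close> in place of \<open>A\<close> the hard inequality is
  \<open>state_content_split\<close>; taking the infimum over the open \<open>V\<close> containing
  \<open>A\<close> carries it to every \<open>A\<close>. The other inequality is
  subadditivity.\<close>

lemma open_in_lambda_system:
  assumes U: "open U"
  shows "U \<in> lambda_system UNIV UNIV (content_outer \<phi>)"
  unfolding lambda_system_def
proof (intro CollectI conjI ballI)
  fix A :: "'k set"
  have "content_outer \<phi> (U \<inter> A) + content_outer \<phi> ((UNIV - U) \<inter> A) \<le> content_outer \<phi> A"
    unfolding content_outer_def[of \<phi> A]
  proof (rule INF_greatest)
    fix V assume "V \<in> {V. open V \<and> A \<subseteq> V}"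
    then have V: "open V" "A \<subseteq> V" by auto
    have "content_outer \<phi> (U \<inter> A) + content_outer \<phi> ((UNIV - U) \<inter> A)
        \<le> content_outer \<phi> (V \<inter> U) + content_outer \<phi> (V - U)"
      using V by (intro add_mono content_outer_mono[OF state]) auto
    also have "\<dots> \<le> ennreal (state_content \<phi> V)"
      using state_content_split[OF U V(1)] content_outer_open[OF state, of "V \<inter> U"] U V by (simp add: open_Int)
    finally show "content_outer \<phi> (U \<inter> A) + content_outer \<phi> ((UNIV - U) \<inter> A) \<le> ennreal (state_content \<phi> V)" .
  qed
  moreover have "content_outer \<phi> A \<le> content_outer \<phi> (U \<inter> A) + content_outer \<phi> ((UNIV - U) \<inter> A)"
    using content_outer_subadd[of "U \<inter> A" "(UNIV - U) \<inter> A"]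
    by (metis Diff_Diff_Int Int_Diff Un_Diff_Int inf_commute inf_top.left_neutral sup_commute)
  ultimately show "content_outer \<phi> (U \<inter> A) + content_outer \<phi> ((UNIV - U) \<inter> A) = content_outer \<phi> A"
    by (rule antisym)
qed auto

lemma measure_space_content_outer: "measure_space UNIV (sets borel) (content_outer \<phi>)"
proof -
  interpret sigma_algebra "UNIV :: 'k set" UNIV
    by (metis Pow_UNIV sigma_algebra_Pow)
  let ?L = "lambda_system UNIV UNIV (content_outer \<phi>)"
  have L: "measure_space UNIV ?L (content_outer \<phi>)"
    by (rule caratheodory_lemma[OF outer_measure_space_content_outer])
  then have saL: "sigma_algebra UNIV ?L" by (simp add: measure_space_def)
  have sub: "sets borel \<subseteq> ?L"
    unfolding sets_borel
    using open_in_lambda_system by (intro sigma_algebra.sigma_sets_subset[OF saL]) auto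
  have "sigma_algebra UNIV (sets (borel :: 'k measure))"
    by (metis sets.sigma_algebra_axioms space_borel)
  then show ?thesis
    using L sub unfolding measure_space_def positive_def countably_additive_def by blast
qed

definition riesz_measure :: "'k measure" where
  "riesz_measure = measure_of UNIV (sets borel) (content_outer \<phi>)"

lemma sets_riesz_measure: "sets riesz_measure = sets borel"
  unfolding riesz_measure_def
  by (metis sets.sigma_sets_eq sets_measure_of space_borel subset_UNIV Pow_UNIV)

lemma space_riesz_measure: "space riesz_measure = UNIV"
  unfolding riesz_measure_def by simp

lemma emeasure_riesz_measure: "A \<in> sets borel \<Longrightarrow> emeasure riesz_measure A = content_outer \<phi> A"
  using measure_space_content_outer unfolding riesz_measure_def measure_space_def
  by (intro emeasure_measure_of_sigma) auto

lemma prob_space_riesz_measure: "prob_space riesz_measure"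
  by (rule prob_spaceI)
     (simp add: space_riesz_measure emeasure_riesz_measure content_outer_open[OF state] state_content_UNIV[OF state])

lemma measure_riesz_open: "open U \<Longrightarrow> measure riesz_measure U = state_content \<phi> U"
  by (simp add: measure_def emeasure_riesz_measure content_outer_open[OF state] state_content_nonneg[OF state])

text \<open>A layer-cake argument: \<open>real n * f\<close> is the sum of its unit layers
  \<open>g k\<close>. The indicator of the set where \<open>real n * f\<close> exceeds
  \<open>k + 1\<close> lies between \<open>g (Suc k)\<close> and \<open>g k\<close>, so the state of
  one layer is at most the integral of the preceding one. Only the bottom layer is left over; it
  costs at most 1, that is \<open>1 / n\<close> after division.\<close>

lemma state_le_riesz_unit:
  assumes f: "continuous_on UNIV f" "\<And>x. 0 \<le> f x" "\<And>x. f x \<le> 1"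
  shows "\<phi> f \<le> (\<integral>x. f x \<partial>riesz_measure)"
proof (rule field_le_epsilon)
  fix e :: real assume e: "0 < e"
  interpret prob_space riesz_measure by (rule prob_space_riesz_measure)
  have meas: "g \<in> borel_measurable riesz_measure" if "continuous_on UNIV g" for g :: "'k \<Rightarrow> real"
    using borel_measurable_continuous_onI[OF that] measurable_cong_sets[OF sets_riesz_measure refl]
    by auto
  obtain m where m: "1 / e < real m" using reals_Archimedean2 by blast
  define n where "n = Suc m"
  define g where "g k x = max 0 (min 1 (real n * f x - real k))" for k x
  have g: "continuous_on UNIV (g k)" for k
    unfolding g_def using f(1) by (intro continuous_intros)
  have g01: "0 \<le> g k x" "g k x \<le> 1" for k x unfolding g_def by auto
  have gi: "integrable riesz_measure (g k)" for k
    by (rule integrable_const_bound[of _ 1]) (use g01 meas[OF g] in auto)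
  have min_sum: "(\<Sum>k<j. max 0 (min 1 (t - real k))) = min t (real j)" if "0 \<le> t" for t j
    using that by (induction j) auto
  have sumg: "(\<Sum>k<n. g k x) = real n * f x" for x
    unfolding g_def using min_sum[of "real n * f x" n] f(2,3)[of x]
    by (simp add: mult_left_le)
  have step: "\<phi> (g (Suc k)) \<le> (\<integral>x. g k x \<partial>riesz_measure)" for k
  proof -
    let ?U = "{x. real k + 1 < real n * f x}"
    have oU: "open ?U"
      using f(1) by (intro open_Collect_less continuous_intros)
    have "\<phi> (g (Suc k)) \<le> state_content \<phi> ?U"
      by (rule state_content_upper[OF state g g01(1)]) (auto simp: g_def split: split_indicator)
    also have "\<dots> = measure riesz_measure ?U" by (simp add: measure_riesz_open[OF oU])
    also have "\<dots> = (\<integral>x. indicator ?U x \<partial>riesz_measure)"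
      using oU by (simp add: sets_riesz_measure space_riesz_measure)
    also have "\<dots> \<le> (\<integral>x. g k x \<partial>riesz_measure)"
    proof (rule integral_mono)
      show "integrable riesz_measure (indicator ?U :: 'k \<Rightarrow> real)"
        using oU by (intro integrable_real_indicator) (auto simp: sets_riesz_measure less_top[symmetric])
      show "indicator ?U x \<le> g k x" for x
        using g01(1)[of k x] by (auto simp: g_def split: split_indicator)
    qed (rule gi)
    finally show ?thesis .
  qed
  have "real n * \<phi> f = \<phi> (\<lambda>x. \<Sum>k<n. g k x)"
    using state_scale[OF state f(1), of "real n"] by (simp add: sumg)
  also have "\<dots> = (\<Sum>k<n. \<phi> (g k))" by (rule state_sum[OF state g])
  also have "\<dots> = \<phi> (g 0) + (\<Sum>k<m. \<phi> (g (Suc k)))"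
    unfolding n_def by (simp add: sum.lessThan_Suc_shift del: sum.lessThan_Suc)
  also have "\<phi> (g 0) \<le> 1"
    using state_mono[OF state g, of "\<lambda>_. 1" 0] g01 state_const[OF state, of 1] by simp
  also have "(\<Sum>k<m. \<phi> (g (Suc k))) \<le> (\<Sum>k<m. \<integral>x. g k x \<partial>riesz_measure)"
    by (intro sum_mono step)
  also have "\<dots> \<le> (\<Sum>k<n. \<integral>x. g k x \<partial>riesz_measure)"
    unfolding n_def using g01 by (intro sum_mono2) (auto intro!: integral_nonneg)
  also have "\<dots> = (\<integral>x. (\<Sum>k<n. g k x) \<partial>riesz_measure)"
    using gi by (simp add: Bochner_Integration.integral_sum)
  also have "\<dots> = real n * (\<integral>x. f x \<partial>riesz_measure)" by (simp add: sumg)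
  finally have "real n * \<phi> f \<le> 1 + real n * (\<integral>x. f x \<partial>riesz_measure)" by simp
  moreover have "1 \<le> real n * e"
    using m e by (simp add: n_def field_simps)
  ultimately have "real n * \<phi> f \<le> real n * ((\<integral>x. f x \<partial>riesz_measure) + e)"
    by (simp add: algebra_simps)
  moreover have "0 < real n" by (simp add: n_def)
  ultimately show "\<phi> f \<le> (\<integral>x. f x \<partial>riesz_measure) + e"
    by (simp only: mult_le_cancel_left_pos)
qed

end

lemma continuous_bounded:
  fixes f :: "'k \<Rightarrow> 'b::real_normed_vector"
  assumes "continuous_on UNIV f"
  obtains B where "0 < B" "\<And>x. norm (f x) \<le> B"
proof -
  have "bounded (range f)"
    using compact_continuous_image[OF assms compact_K] by (rule compact_imp_bounded)
  then show ?thesis using that by (auto simp: bounded_pos)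
qed

text \<open>The affine change to \<open>(f x + B) / (2 * B)\<close> brings the values into the unit
  interval; states and integrals against a probability measure transform alike under it.\<close>

lemma state_le_riesz:
  fixes \<phi> :: "('k \<Rightarrow> real) \<Rightarrow> real"
  assumes st: "state \<phi>" and f: "continuous_on UNIV f"
  shows "\<phi> f \<le> (\<integral>x. f x \<partial>riesz_measure \<phi>)"
proof -
  interpret prob_space "riesz_measure \<phi>" by (rule prob_space_riesz_measure[OF st])
  obtain B where B: "0 < B" "\<And>x. norm (f x) \<le> B" using continuous_bounded[OF f] by blast
  let ?g = "\<lambda>x. (f x + B) / (2 * B)"
  have fb: "- B \<le> f x \<and> f x \<le> B" for x using B(2)[of x] by auto
  have g: "continuous_on UNIV ?g"
    using f B by (intro continuous_intros) auto
  have fi: "integrable (riesz_measure \<phi>) f"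
    by (rule integrable_const_bound[of _ B])
       (use B borel_measurable_continuous_onI[OF f] measurable_cong_sets[OF sets_riesz_measure[OF st] refl] in auto)
  have "\<phi> ?g \<le> (\<integral>x. ?g x \<partial>riesz_measure \<phi>)"
  proof (rule state_le_riesz_unit[OF st g])
    show "0 \<le> ?g x" for x using fb[of x] B(1) by (intro divide_nonneg_pos) auto
    show "?g x \<le> 1" for x using fb[of x] B(1) by simp
  qed
  also have "(\<integral>x. ?g x \<partial>riesz_measure \<phi>) = ((\<integral>x. f x \<partial>riesz_measure \<phi>) + B) / (2 * B)"
    using fi by (simp add: prob_space)
  also have "\<phi> ?g = (\<phi> f + B) / (2 * B)"
    using state_scale[OF st, of "\<lambda>x. f x + B" "1 / (2*B)"] f state_add[OF st f, of "\<lambda>_. B"]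
      state_const[OF st, of B] by (simp add: continuous_on_add)
  finally show ?thesis using B(1) by (simp add: divide_le_cancel)
qed

text \<open>Outer regularity is built into \<open>content_outer\<close>. Inner regularity is outer
  regularity of the complement, since the complement of an open set is closed and hence
  compact.\<close>

lemma regular_riesz_measure:
  fixes \<phi> :: "('k \<Rightarrow> real) \<Rightarrow> real"
  assumes st: "state \<phi>"
  shows "regular_borel_measure (riesz_measure \<phi>)"
  unfolding regular_borel_measure_def
proof (intro conjI ballI)
  let ?M = "riesz_measure \<phi>"
  interpret prob_space ?M by (rule prob_space_riesz_measure[OF st])
  show sets: "sets ?M = sets borel" by (rule sets_riesz_measure[OF st])
  have outer: "emeasure ?M A = (INF U\<in>{U. open U \<and> A \<subseteq> U}. emeasure ?M U)" if "A \<in> sets borel" for A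
    using that unfolding emeasure_riesz_measure[OF st that] content_outer_def
    by (intro INF_cong) (auto simp: emeasure_riesz_measure[OF st] content_outer_open[OF st])
  fix A :: "'k set" assume A: "A \<in> sets borel"
  show "emeasure ?M A = (INF U\<in>{U. open U \<and> A \<subseteq> U}. emeasure ?M U)" by (rule outer[OF A])
  show "emeasure ?M A = (SUP C\<in>{C. compact C \<and> C \<subseteq> A}. emeasure ?M C)"
  proof (rule antisym)
    show "(SUP C\<in>{C. compact C \<and> C \<subseteq> A}. emeasure ?M C) \<le> emeasure ?M A"
      using A by (intro SUP_least emeasure_mono) (auto simp: sets)
    show "emeasure ?M A \<le> (SUP C\<in>{C. compact C \<and> C \<subseteq> A}. emeasure ?M C)"
    proof (rule ennreal_le_epsilon)
      fix e :: real assume e: "0 < e"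
      have nA: "- A \<in> sets borel" using A by (metis sets.compl_sets space_borel Compl_eq_Diff_UNIV)
      have "emeasure ?M (-A) < emeasure ?M (-A) + ennreal e"
        using e by (simp add: less_top[symmetric])
      then obtain U where U: "open U" "- A \<subseteq> U" "emeasure ?M U < emeasure ?M (-A) + ennreal e"
        unfolding outer[OF nA] INF_less_iff by auto
      let ?C = "- U"
      have C: "compact ?C" "?C \<subseteq> A" using U compact_of_closed[of ?C] by auto
      have "measure ?M U < measure ?M (-A) + e"
        using U(3) e by (simp add: emeasure_eq_measure ennreal_less_iff flip: ennreal_plus)
      moreover have "measure ?M (-A) = 1 - measure ?M A"
        using prob_compl[of A] A by (simp add: sets space_riesz_measure[OF st] Compl_eq_Diff_UNIV)
      moreover have "measure ?M ?C = 1 - measure ?M U"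
        using prob_compl[of U] U(1) by (simp add: sets space_riesz_measure[OF st] Compl_eq_Diff_UNIV)
      ultimately have "measure ?M A \<le> measure ?M ?C + e" by simp
      then have "emeasure ?M A \<le> emeasure ?M ?C + ennreal e"
        using e by (simp add: emeasure_eq_measure flip: ennreal_plus)
      also have "\<dots> \<le> (SUP C\<in>{C. compact C \<and> C \<subseteq> A}. emeasure ?M C) + ennreal e"
        using C by (intro add_right_mono SUP_upper) auto
      finally show "emeasure ?M A \<le> (SUP C\<in>{C. compact C \<and> C \<subseteq> A}. emeasure ?M C) + ennreal e" .
    qed
  qed
qed

text \<open>The inequality \<open>state_le_riesz\<close>, used for \<open>f\<close> and for
  \<open>-f\<close>, is an equality.\<close>

lemma riesz_representation:
  fixes \<phi> :: "('k \<Rightarrow> real) \<Rightarrow> real"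
  assumes st: "state \<phi>"
  obtains M :: "'k measure" where "prob_space M" "regular_borel_measure M"
    "\<And>f. continuous_on UNIV f \<Longrightarrow> (\<integral>x. f x \<partial>M) = \<phi> f"
proof (rule that[of "riesz_measure \<phi>"])
  fix f :: "'k \<Rightarrow> real" assume f: "continuous_on UNIV f"
  have "continuous_on UNIV (\<lambda>x. -1 * f x)" using f by (intro continuous_intros)
  from state_le_riesz[OF st this] state_le_riesz[OF st f]
  show "(\<integral>x. f x \<partial>riesz_measure \<phi>) = \<phi> f"
    using state_scale[OF st f, of "-1"] by simp
qed (rule prob_space_riesz_measure[OF st] regular_riesz_measure[OF st])+

subsection \<open>Regular measures and approximation by continuous functions\<close>

lemma Bcontfun_apply:
  fixes f :: "'k \<Rightarrow> complex"
  assumes "continuous_on UNIV f"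
  shows "apply_bcontfun (Bcontfun f) = f"
proof -
  obtain B where "\<And>x. norm (f x) \<le> B" using continuous_bounded[OF assms] by blast
  then have "f \<in> bcontfun" using assms by (auto simp: bcontfun_def bounded_iff)
  then show ?thesis by (rule Bcontfun_inverse)
qed

definition regular_prob :: "'k measure \<Rightarrow> bool" where
  "regular_prob M \<longleftrightarrow> prob_space M \<and> regular_borel_measure M"

context
  fixes M :: "'k measure"
  assumes reg: "regular_prob M"
begin

lemma regular_prob_prob_space: "prob_space M"
  using reg by (simp add: regular_prob_def)

lemma regular_prob_sets: "sets M = sets borel"
  using reg by (simp add: regular_prob_def regular_borel_measure_def)

lemma regular_prob_space: "space M = UNIV"
  using sets_eq_imp_space_eq[OF regular_prob_sets] by simp

lemma regular_prob_measurable: "f \<in> borel_measurable M" if "continuous_on UNIV f" for f :: "'k \<Rightarrow> 'b::topological_space"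
  using borel_measurable_continuous_onI[OF that] measurable_cong_sets[OF regular_prob_sets refl] by auto

lemma integrable_continuous:
  fixes f :: "'k \<Rightarrow> 'b::{banach, second_countable_topology}"
  assumes "continuous_on UNIV f"
  shows "integrable M f"
proof -
  interpret prob_space M by (rule regular_prob_prob_space)
  obtain B where "\<And>x. norm (f x) \<le> B" using continuous_bounded[OF assms] by blast
  then show ?thesis using regular_prob_measurable[OF assms] by (intro integrable_const_bound[of _ B]) auto
qed

lemma integrable_CK: "integrable M (apply_bcontfun (f :: 'k CK))"
  by (rule integrable_continuous[OF continuous_on_apply_bcontfun])

lemma compact_inner_approx:
  assumes "A \<in> sets borel" "0 < e"
  obtains C where "compact C" "C \<subseteq> A" "measure M A < measure M C + e"
proof -
  interpret prob_space M by (rule regular_prob_prob_space)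
  have eq: "emeasure M A = (SUP C\<in>{C. compact C \<and> C \<subseteq> A}. emeasure M C)"
    using reg assms(1) unfolding regular_prob_def regular_borel_measure_def by blast
  show ?thesis
  \<comment> \<open>\<open>ennreal\<close> sends negative reals to 0, so a strict comparison in
    \<open>ennreal\<close> is available only for a nonnegative bound; in the other case the empty
    set serves.\<close>
  proof (cases "measure M A - e < 0")
    case True
    then show ?thesis using that[of "{}"] by auto
  next
    case False
    then have "ennreal (measure M A - e) < emeasure M A"
      using assms(2) by (simp add: emeasure_eq_measure ennreal_less_iff)
    then obtain C where C: "compact C" "C \<subseteq> A" "ennreal (measure M A - e) < emeasure M C"
      unfolding eq less_SUP_iff by auto
    then have "measure M A - e < measure M C"
      using False by (simp add: emeasure_eq_measure ennreal_less_iff)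
    then show ?thesis using that C by simp
  qed
qed

lemma open_outer_approx:
  assumes "A \<in> sets borel" "0 < e"
  obtains U where "open U" "A \<subseteq> U" "measure M U < measure M A + e"
proof -
  interpret prob_space M by (rule regular_prob_prob_space)
  have eq: "emeasure M A = (INF U\<in>{U. open U \<and> A \<subseteq> U}. emeasure M U)"
    using reg assms(1) unfolding regular_prob_def regular_borel_measure_def by blast
  have "emeasure M A < ennreal (measure M A + e)"
    using assms(2) by (simp add: emeasure_eq_measure ennreal_less_iff)
  then obtain U where U: "open U" "A \<subseteq> U" "emeasure M U < ennreal (measure M A + e)"
    unfolding eq INF_less_iff by auto
  then have "measure M U < measure M A + e"
    by (simp add: emeasure_eq_measure ennreal_less_iff)
  then show ?thesis using that U by simp
qed

text \<open>A Urysohn function between a compact subset and an open superset of nearly the same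
  measure. For open \<open>A\<close> the superset is chosen as \<open>A\<close> itself, so the
  approximant vanishes off \<open>A\<close>; this clause is what later puts it into an ideal with
  nonvanishing set \<open>A\<close>.\<close>

lemma continuous_approx_indicator:
  assumes "A \<in> sets borel" "0 < e"
  obtains f :: "'k \<Rightarrow> real" where "continuous_on UNIV f" "\<And>x. 0 \<le> f x" "\<And>x. f x \<le> 1"
    "L1_dist M (indicator A) f < e" "open A \<longrightarrow> (\<forall>x. x \<notin> A \<longrightarrow> f x = 0)"
proof -
  interpret prob_space M by (rule regular_prob_prob_space)
  obtain C where C: "compact C" "C \<subseteq> A" "measure M A < measure M C + e / 2"
    by (rule compact_inner_approx[OF assms(1) half_gt_zero[OF assms(2)]])
  obtain U where U: "open U" "A \<subseteq> U" "measure M U < measure M A + e / 2" "open A \<longrightarrow> U = A"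
  proof (cases "open A")
    case True
    then show ?thesis using assms(2) by (intro that[of A]) auto
  next
    case False
    obtain U where "open U" "A \<subseteq> U" "measure M U < measure M A + e / 2"
      by (rule open_outer_approx[OF assms(1) half_gt_zero[OF assms(2)]])
    then show ?thesis using False by (intro that[of U]) auto
  qed
  have cC: "closed C" using C(1) by (rule compact_imp_closed)
  obtain f :: "'k \<Rightarrow> real" where f: "continuous_on UNIV f" "\<And>x. 0 \<le> f x" "\<And>x. f x \<le> 1"
      "\<And>x. x \<in> C \<Longrightarrow> f x = 1" "\<And>x. x \<notin> U \<Longrightarrow> f x = 0"
    using urysohn_compact[OF cC U(1) order_trans[OF C(2) U(2)]] by blast
  have m: "C \<in> sets M" "U \<in> sets M" "A \<in> sets M"
    using cC U(1) assms(1) by (auto simp: regular_prob_sets)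
  have "L1_dist M (indicator A) f \<le> (\<integral>x. indicator (U - C) x \<partial>M)"
    unfolding L1_dist_def
  proof (rule integral_mono)
    show "integrable M (\<lambda>x. norm (indicator A x - f x))"
      using m integrable_continuous[OF f(1)] by (intro integrable_norm Bochner_Integration.integrable_diff integrable_real_indicator) (auto simp: less_top[symmetric])
    show "integrable M (indicator (U - C) :: 'k \<Rightarrow> real)"
      using m by (intro integrable_real_indicator) (auto simp: less_top[symmetric])
    show "norm (indicator A x - f x) \<le> indicator (U - C) x" for x
      using f(2,3)[of x] f(4)[of x] f(5)[of x] C(2) U(2)
      by (auto simp: indicator_def)
  qed
  also have "\<dots> = measure M (U - C)" using m by (simp add: regular_prob_space)
  also have "\<dots> = measure M U - measure M C"
    using m C(2) U(2) by (intro finite_measure_Diff) auto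
  also have "\<dots> < e" using C U by auto
  finally show ?thesis using that[OF f(1-3)] f(5) U(4) by auto
qed

lemma continuous_dense_L1:
  fixes g :: "'k \<Rightarrow> 'b::{banach, second_countable_topology}"
  assumes "integrable M g" "0 < e"
  obtains f :: "'k \<Rightarrow> 'b" where "continuous_on UNIV f" "L1_dist M g f < e"
proof -
  have "\<forall>e>0. \<exists>f. continuous_on UNIV f \<and> L1_dist M g f < e"
    using assms(1)
  proof (induction rule: integrable_induct)
    case (base A c)
    show ?case
    proof (intro allI impI)
      fix e :: real assume e: "0 < e"
      have "A \<in> sets borel" using base by (simp add: regular_prob_sets)
      \<comment> \<open>The summand 1 keeps the quotient positive when \<open>c\<close> is
        0.\<close>
      moreover have "0 < e / (norm c + 1)" using e by (intro divide_pos_pos add_nonneg_pos) auto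
      ultimately obtain f :: "'k \<Rightarrow> real" where f: "continuous_on UNIV f" "L1_dist M (indicator A) f < e / (norm c + 1)"
        by (rule continuous_approx_indicator) blast
      have "L1_dist M (\<lambda>x. indicator A x *\<^sub>R c) (\<lambda>x. f x *\<^sub>R c) = L1_dist M (indicator A) f * norm c"
        unfolding L1_dist_def by (simp add: scaleR_diff_left[symmetric])
      also have "\<dots> \<le> L1_dist M (indicator A) f * (norm c + 1)"
        by (intro mult_left_mono L1_dist_nonneg) auto
      also have "\<dots> < e"
        using f(2) norm_ge_zero[of c] by (simp add: pos_less_divide_eq add_nonneg_pos)
      finally show "\<exists>f. continuous_on UNIV f \<and> L1_dist M (\<lambda>x. indicator A x *\<^sub>R c) f < e"
        using f(1) by (intro exI[of _ "\<lambda>x. f x *\<^sub>R c"]) (auto intro!: continuous_intros)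
    qed
  next
    case (add u v)
    show ?case
    proof (intro allI impI)
      fix e :: real assume e: "0 < e"
      obtain f where f: "continuous_on UNIV f" "L1_dist M u f < e / 2"
        using add.IH(1) e half_gt_zero by blast
      obtain k where k: "continuous_on UNIV k" "L1_dist M v k < e / 2"
        using add.IH(2) e half_gt_zero by blast
      have "L1_dist M (\<lambda>x. u x + v x) (\<lambda>x. f x + k x) \<le> L1_dist M u f + L1_dist M v k"
        by (intro L1_dist_add add.hyps integrable_continuous f(1) k(1))
      then have "L1_dist M (\<lambda>x. u x + v x) (\<lambda>x. f x + k x) < e" using f k by linarith
      then show "\<exists>f. continuous_on UNIV f \<and> L1_dist M (\<lambda>x. u x + v x) f < e"
        using f(1) k(1) by (intro exI[of _ "\<lambda>x. f x + k x"]) (auto intro!: continuous_intros)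
    qed
  next
    case (lim u s)
    show ?case
    proof (intro allI impI)
      fix e :: real assume e: "0 < e"
      have "(\<lambda>i. \<integral>x. norm (u x - s i x) \<partial>M) \<longlonglongrightarrow> (\<integral>x. 0 \<partial>M)"
      proof (rule integral_dominated_convergence)
        show "integrable M (\<lambda>x. 3 * norm (u x))" using lim by auto
        show "AE x in M. (\<lambda>i. norm (u x - s i x)) \<longlonglongrightarrow> 0"
        proof (rule AE_I2)
          fix x assume "x \<in> space M"
          then have "(\<lambda>i. u x - s i x) \<longlonglongrightarrow> u x - u x" using lim by (intro tendsto_intros) auto
          then show "(\<lambda>i. norm (u x - s i x)) \<longlonglongrightarrow> 0" using tendsto_norm_zero by fastforce
        qed
        show "AE x in M. norm (norm (u x - s i x)) \<le> 3 * norm (u x)" for i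
        proof (rule AE_I2)
          fix x assume "x \<in> space M"
          then have "norm (s i x) \<le> 2 * norm (u x)" using lim by auto
          then show "norm (norm (u x - s i x)) \<le> 3 * norm (u x)"
            using norm_triangle_ineq4[of "u x" "s i x"] by simp
        qed
      qed (use lim in auto)
      then have "(\<lambda>i. L1_dist M u (s i)) \<longlonglongrightarrow> 0" by (simp add: L1_dist_def)
      then have "eventually (\<lambda>i. L1_dist M u (s i) < e / 2) sequentially"
        using e by (intro order_tendstoD(2)[where y = 0]) auto
      then obtain i where i: "L1_dist M u (s i) < e / 2"
        by (auto simp: eventually_sequentially)
      obtain f where f: "continuous_on UNIV f" "L1_dist M (s i) f < e / 2"
        using lim.IH e half_gt_zero by blast
      have "L1_dist M u f \<le> L1_dist M u (s i) + L1_dist M (s i) f"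
        by (intro L1_dist_triangle lim.hyps integrable_continuous f(1))
      then show "\<exists>f. continuous_on UNIV f \<and> L1_dist M u f < e"
        using f i by (intro exI[of _ f]) auto
    qed
  qed
  then show ?thesis using that assms(2) by blast
qed

lemma CK_dense_L1:
  assumes "integrable M g" "0 < e"
  obtains f :: "'k CK" where "L1_dist M g (apply_bcontfun f) < e"
  by (rule continuous_dense_L1[OF assms]) (use that Bcontfun_apply in metis)

end

subsection \<open>Markov operators and their extensions to \<open>L\<^sup>1\<close>\<close>

lemma Bcontfun_of_real_apply:
  fixes f :: "'k \<Rightarrow> real"
  assumes "continuous_on UNIV f"
  shows "apply_bcontfun (Bcontfun (\<lambda>x. complex_of_real (f x))) = (\<lambda>x. complex_of_real (f x))"
  using assms by (intro Bcontfun_apply continuous_intros)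

lemma apply_cscale: "apply_bcontfun (cscale c f) x = c * apply_bcontfun f x"
  by (simp add: cscale.rep_eq)

context
  fixes S :: "'k opCK"
  assumes markov: "markov_op S"
begin

lemma markov_cscale: "blinfun_apply S (cscale c f) = cscale c (blinfun_apply S f)"
  using markov by (simp add: markov_op_def complex_linear_op_def)

lemma markov_one: "blinfun_apply S one_CK = one_CK"
  using markov by (simp add: markov_op_def)

lemma markov_nonneg:
  "(\<And>x. apply_bcontfun f x \<in> \<real>\<^sub>\<ge>\<^sub>0) \<Longrightarrow> apply_bcontfun (blinfun_apply S f) x \<in> \<real>\<^sub>\<ge>\<^sub>0"
  using markov by (auto simp: markov_op_def positive_op_def)

text \<open>Adding a constant \<open>B\<close> makes \<open>f\<close> nonnegative. The image of
  \<open>f + B\<close> is then nonnegative, in particular real, and since \<open>S\<close> fixes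
  constants it differs from the image of \<open>f\<close> by the real number
  \<open>B\<close>.\<close>

lemma of_real_real_action:
  assumes f: "continuous_on UNIV f"
  shows "apply_bcontfun (blinfun_apply S (Bcontfun (\<lambda>x. complex_of_real (f x)))) x
    = complex_of_real (real_action S f x)"
proof -
  obtain B where B: "\<And>x. norm (f x) \<le> B" using continuous_bounded[OF f] by blast
  let ?F = "Bcontfun (\<lambda>x. complex_of_real (f x))"
  have nn: "0 \<le> f x + B" for x using B[of x] by auto
  have "apply_bcontfun (?F + B *\<^sub>R one_CK) x = complex_of_real (f x + B)" for x
    by (simp add: Bcontfun_of_real_apply[OF f] scaleR_conv_of_real)
  then have "apply_bcontfun (blinfun_apply S (?F + B *\<^sub>R one_CK)) x \<in> \<real>\<^sub>\<ge>\<^sub>0"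
    using nn by (intro markov_nonneg) (simp del: of_real_add)
  then have "apply_bcontfun (blinfun_apply S ?F) x + complex_of_real B \<in> \<real>\<^sub>\<ge>\<^sub>0"
    by (simp add: blinfun.add_right blinfun.scaleR_right markov_one scaleR_conv_of_real)
  then have "Im (apply_bcontfun (blinfun_apply S ?F) x) = 0"
    by (auto simp: complex_nonneg_Reals_iff)
  then show ?thesis by (simp add: real_action_def complex_eq_iff)
qed

lemma real_action_continuous: "continuous_on UNIV (real_action S f)"
  unfolding real_action_def[abs_def] by (intro continuous_on_Re continuous_on_apply_bcontfun)

text \<open>Applying a Markov operator and evaluating at a point is a state; all pointwise rules for
  \<open>real_action\<close> are therefore instances of the rules for states.\<close>

lemma state_real_action: "state (\<lambda>f. real_action S f x)"
  unfolding state_def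
proof (intro conjI allI impI)
  fix f g :: "'k \<Rightarrow> real" and c :: real
  assume f: "continuous_on UNIV f"
  {
    assume g: "continuous_on UNIV g"
    have "Bcontfun (\<lambda>x. complex_of_real (f x + g x))
        = Bcontfun (\<lambda>x. complex_of_real (f x)) + Bcontfun (\<lambda>x. complex_of_real (g x))"
      by (rule bcontfun_eqI) (simp add: Bcontfun_of_real_apply f g continuous_on_add del: of_real_add, simp)
    then show "real_action S (\<lambda>x. f x + g x) x = real_action S f x + real_action S g x"
      by (simp add: real_action_def blinfun.add_right)
  }
  have "Bcontfun (\<lambda>x. complex_of_real (c * f x)) = c *\<^sub>R Bcontfun (\<lambda>x. complex_of_real (f x))"
    by (rule bcontfun_eqI)
       (simp add: Bcontfun_of_real_apply f continuous_on_mult_left del: of_real_mult, simp add: scaleR_conv_of_real)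
  then show "real_action S (\<lambda>x. c * f x) x = c * real_action S f x"
    by (simp add: real_action_def blinfun.scaleR_right)
  assume "\<forall>x. 0 \<le> f x"
  then have "apply_bcontfun (blinfun_apply S (Bcontfun (\<lambda>x. complex_of_real (f x)))) x \<in> \<real>\<^sub>\<ge>\<^sub>0"
    by (intro markov_nonneg) (simp add: Bcontfun_of_real_apply[OF f])
  then show "0 \<le> real_action S f x"
    by (auto simp: real_action_def complex_nonneg_Reals_iff)
next
  have "Bcontfun (\<lambda>x. complex_of_real 1) = (one_CK :: 'k CK)"
    by (rule bcontfun_eqI) (simp only: Bcontfun_of_real_apply continuous_on_const, simp)
  then show "real_action S (\<lambda>_. 1) x = 1"
    using markov_one by (simp add: real_action_def)
qed

lemmas real_action_add = state_add[OF state_real_action]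
  and real_action_diff = state_diff[OF state_real_action]
  and real_action_scale = state_scale[OF state_real_action]
  and real_action_nonneg = state_nonneg[OF state_real_action]
  and real_action_mono = state_mono[OF state_real_action]
  and real_action_const = state_const[OF state_real_action]

lemma abs_real_action_le:
  assumes f: "continuous_on UNIV f"
  shows "\<bar>real_action S f x\<bar> \<le> real_action S (\<lambda>x. \<bar>f x\<bar>) x"
proof -
  have "continuous_on UNIV (\<lambda>x. \<bar>f x\<bar>)" "continuous_on UNIV (\<lambda>x. -1 * f x)"
    by (intro continuous_on_rabs continuous_on_mult_left f)+
  then have "real_action S f x \<le> real_action S (\<lambda>x. \<bar>f x\<bar>) x"
      "real_action S (\<lambda>x. -1 * f x) x \<le> real_action S (\<lambda>x. \<bar>f x\<bar>) x"
    using f by (intro real_action_mono; auto)+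
  then show ?thesis using real_action_scale[OF f, of "-1" x] by simp
qed

lemma apply_markov:
  "apply_bcontfun (blinfun_apply S h) x
    = Complex (real_action S (\<lambda>x. Re (apply_bcontfun h x)) x) (real_action S (\<lambda>x. Im (apply_bcontfun h x)) x)"
proof -
  have c: "continuous_on UNIV (\<lambda>x. Re (apply_bcontfun h x))" "continuous_on UNIV (\<lambda>x. Im (apply_bcontfun h x))"
    using continuous_on_apply_bcontfun[of UNIV h] by (intro continuous_intros; assumption)+
  have "h = Bcontfun (\<lambda>x. complex_of_real (Re (apply_bcontfun h x)))
      + cscale \<i> (Bcontfun (\<lambda>x. complex_of_real (Im (apply_bcontfun h x))))"
    by (rule bcontfun_eqI)
       (simp add: apply_cscale Bcontfun_of_real_apply[OF c(1)] Bcontfun_of_real_apply[OF c(2)] complex_eq_iff)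
  then have "blinfun_apply S h = blinfun_apply S (Bcontfun (\<lambda>x. complex_of_real (Re (apply_bcontfun h x))))
      + cscale \<i> (blinfun_apply S (Bcontfun (\<lambda>x. complex_of_real (Im (apply_bcontfun h x)))))"
    by (metis blinfun.add_right markov_cscale)
  then show ?thesis
    by (simp add: apply_cscale of_real_real_action[OF c(1)] of_real_real_action[OF c(2)] complex_eq_iff)
qed

text \<open>Multiplying \<open>h\<close> by the conjugate phase \<open>c\<close> of the value at
  \<open>x\<close> turns that value into its modulus. It is then the image of the real function
  \<open>Re (c * h)\<close>, which lies below the modulus of \<open>h\<close>.\<close>

lemma cmod_markov_le:
  "cmod (apply_bcontfun (blinfun_apply S h) x) \<le> real_action S (\<lambda>x. cmod (apply_bcontfun h x)) x"
proof -
  have ch: "continuous_on UNIV (apply_bcontfun h)" by (rule continuous_on_apply_bcontfun)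
  then have cm: "continuous_on UNIV (\<lambda>x. cmod (apply_bcontfun h x))" by (intro continuous_intros)
  let ?z = "apply_bcontfun (blinfun_apply S h) x"
  define c where "c = cnj (sgn ?z)"
  have c1: "cmod c \<le> 1" by (simp add: c_def norm_sgn)
  have "c * ?z = complex_of_real (cmod ?z)"
    by (cases "?z = 0") (simp_all add: c_def sgn_eq complex_norm_square[symmetric] power2_eq_square mult.commute)
  then have "cmod ?z = Re (apply_bcontfun (blinfun_apply S (cscale c h)) x)"
    by (simp add: markov_cscale apply_cscale)
  also have "\<dots> = real_action S (\<lambda>x. Re (c * apply_bcontfun h x)) x"
    by (simp add: apply_markov apply_cscale)
  also have "\<dots> \<le> real_action S (\<lambda>x. cmod (apply_bcontfun h x)) x"
  proof (rule real_action_mono)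
    show "continuous_on UNIV (\<lambda>x. Re (c * apply_bcontfun h x))"
      using ch by (intro continuous_intros)
    show "Re (c * apply_bcontfun h y) \<le> cmod (apply_bcontfun h y)" for y
      using complex_Re_le_cmod[of "c * apply_bcontfun h y"] mult_right_mono[OF c1, of "cmod (apply_bcontfun h y)"]
      by (simp add: norm_mult)
  qed (rule cm)
  finally show ?thesis .
qed

lemma real_action_compose:
  assumes f: "continuous_on UNIV f"
  shows "real_action (T o\<^sub>L S) f = real_action T (real_action S f)"
proof -
  have "Bcontfun (\<lambda>x. complex_of_real (real_action S f x)) = blinfun_apply S (Bcontfun (\<lambda>x. complex_of_real (f x)))"
    by (rule bcontfun_eqI)
       (simp add: Bcontfun_of_real_apply[OF real_action_continuous] of_real_real_action[OF f])
  then show ?thesis by (simp add: real_action_def[abs_def])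
qed

end

section \<open>The operator on L1 induced by an invariant measure\<close>

definition invariant_under :: "'k measure \<Rightarrow> 'k opCK \<Rightarrow> bool" where
  "invariant_under M S \<longleftrightarrow>
     (\<forall>f. (LINT x|M. apply_bcontfun (blinfun_apply S f) x) = (LINT x|M. apply_bcontfun f x))"

text \<open>
  This inequality determines \<open>E g\<close> up to null sets, and linearity of \<open>E\<close> follows from it by
  approximation with continuous functions.
\<close>

definition L1_extension :: "'k measure \<Rightarrow> 'k opCK \<Rightarrow> (('k \<Rightarrow> complex) \<Rightarrow> 'k \<Rightarrow> complex) \<Rightarrow> bool" where
  "L1_extension M S E \<longleftrightarrow> (\<forall>g. integrable M g \<longrightarrow> integrable M (E g) \<and>
     (\<forall>f. L1_dist M (E g) (apply_bcontfun (blinfun_apply S f)) \<le> L1_dist M g (apply_bcontfun f)))"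

context
  fixes S :: "'k opCK" and M :: "'k measure"
  assumes markov: "markov_op S" and reg: "regular_prob M" and inv: "invariant_under M S"
begin


lemma integral_real_action:
  assumes f: "continuous_on UNIV f"
  shows "(\<integral>x. real_action S f x \<partial>M) = (\<integral>x. f x \<partial>M)"
proof -
  have "(LINT x|M. complex_of_real (real_action S f x)) = (LINT x|M. complex_of_real (f x))"
    unfolding of_real_real_action[OF markov f, symmetric]
    using inv[unfolded invariant_under_def, rule_format, of "Bcontfun (\<lambda>x. complex_of_real (f x))"]
    by (simp only: Bcontfun_of_real_apply[OF f])
  then show ?thesis by simp
qed

text \<open>Positivity moves the absolute value inside the operator, and invariance of
  \<open>M\<close> removes the operator under the integral.\<close>

lemma L1_dist_real_action:
  assumes f: "continuous_on UNIV f" and g: "continuous_on UNIV g"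
  shows "L1_dist M (real_action S f) (real_action S g) \<le> L1_dist M f g"
proof -
  have d: "continuous_on UNIV (\<lambda>x. f x - g x)" using f g by (intro continuous_intros)
  then have a: "continuous_on UNIV (\<lambda>x. \<bar>f x - g x\<bar>)" by (rule continuous_on_rabs)
  have "L1_dist M (real_action S f) (real_action S g) \<le> (\<integral>x. real_action S (\<lambda>x. \<bar>f x - g x\<bar>) x \<partial>M)"
    unfolding L1_dist_def
    using real_action_continuous[OF markov] abs_real_action_le[OF markov d] real_action_diff[OF markov f g]
    by (intro integral_mono integrable_continuous[OF reg] continuous_on_norm continuous_on_diff f g) auto
  also have "\<dots> = L1_dist M f g"
    using integral_real_action[OF a] by (simp add: L1_dist_def)
  finally show ?thesis .
qed

lemma L1_dist_markov:
  "L1_dist M (apply_bcontfun (blinfun_apply S f)) (apply_bcontfun (blinfun_apply S g))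
    \<le> L1_dist M (apply_bcontfun f) (apply_bcontfun g)"
proof -
  have a: "continuous_on UNIV (\<lambda>x. cmod (apply_bcontfun (f - g) x))"
    using continuous_on_apply_bcontfun by (intro continuous_intros)
  have "L1_dist M (apply_bcontfun (blinfun_apply S f)) (apply_bcontfun (blinfun_apply S g))
      = (\<integral>x. cmod (apply_bcontfun (blinfun_apply S (f - g)) x) \<partial>M)"
    by (simp add: L1_dist_def blinfun.diff_right)
  also have "\<dots> \<le> (\<integral>x. real_action S (\<lambda>x. cmod (apply_bcontfun (f - g) x)) x \<partial>M)"
    by (intro integral_mono integrable_norm integrable_CK[OF reg] integrable_continuous[OF reg] real_action_continuous[OF markov] cmod_markov_le[OF markov])
  also have "\<dots> = L1_dist M (apply_bcontfun f) (apply_bcontfun g)"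
    using integral_real_action[OF a] by (simp add: L1_dist_def)
  finally show ?thesis .
qed

text \<open>Take continuous functions within \<open>(1/2) ^ n\<close> of \<open>g\<close>. As
  \<open>S\<close> contracts the L1 distance, their images have summable increments and converge by
  \<open>L1_complete\<close>. The inequality for a given \<open>f\<close> holds along the sequence
  up to an error tending to 0.\<close>

lemma L1_extension_exists: "\<exists>E. L1_extension M S E"
proof -
  have "\<exists>H. integrable M H \<and> (\<forall>f. L1_dist M H (apply_bcontfun (blinfun_apply S f)) \<le> L1_dist M g (apply_bcontfun f))"
    if g: "integrable M g" for g
  proof -
    have "\<exists>f :: 'k CK. L1_dist M g (apply_bcontfun f) < (1/2) ^ n" for n
    proof -
      have pos: "0 < (1/2 :: real) ^ n" by simp
      obtain f :: "'k CK" where "L1_dist M g (apply_bcontfun f) < (1/2) ^ n"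
        by (rule CK_dense_L1[OF reg g pos])
      then show ?thesis ..
    qed
    then have "\<forall>n. \<exists>f :: 'k CK. L1_dist M g (apply_bcontfun f) < (1/2) ^ n" ..
    from choice[OF this]
    obtain a :: "nat \<Rightarrow> 'k CK" where "\<forall>n. L1_dist M g (apply_bcontfun (a n)) < (1/2) ^ n" ..
    then have a: "L1_dist M g (apply_bcontfun (a n)) < (1/2) ^ n" for n ..
    let ?h = "\<lambda>n. apply_bcontfun (blinfun_apply S (a n))"
    have "summable (\<lambda>n. L1_dist M (?h (Suc n)) (?h n))"
    proof (rule summable_comparison_test)
      have "norm (1/2 :: real) < 1" by simp
      from summable_mult[OF summable_geometric[OF this]]
      show "summable (\<lambda>n. 2 * (1/2 :: real) ^ n)" .
      have "L1_dist M (?h (Suc n)) (?h n) \<le> 2 * (1/2) ^ n" for n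
      proof -
        have "L1_dist M (?h (Suc n)) (?h n) \<le> L1_dist M (apply_bcontfun (a (Suc n))) (apply_bcontfun (a n))"
          by (rule L1_dist_markov)
        also have "\<dots> \<le> L1_dist M (apply_bcontfun (a (Suc n))) g + L1_dist M g (apply_bcontfun (a n))"
          by (intro L1_dist_triangle integrable_CK[OF reg] g)
        also have "\<dots> \<le> (1/2) ^ Suc n + (1/2) ^ n"
          using a[of n] a[of "Suc n"] L1_dist_commute[of M g "apply_bcontfun (a (Suc n))"] by linarith
        also have "\<dots> \<le> 2 * (1/2) ^ n" by simp
        finally show ?thesis .
      qed
      then show "\<exists>N. \<forall>n\<ge>N. norm (L1_dist M (?h (Suc n)) (?h n)) \<le> 2 * (1/2) ^ n"
        by (simp add: L1_dist_nonneg)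
    qed
    from L1_complete[OF integrable_CK[OF reg] this]
    obtain H where H: "integrable M H" "(\<lambda>n. L1_dist M (?h n) H) \<longlonglongrightarrow> 0" .
    have "L1_dist M H (apply_bcontfun (blinfun_apply S f)) \<le> L1_dist M g (apply_bcontfun f)" for f
    proof (rule LIMSEQ_le_const)
      have "(\<lambda>n. (1/2 :: real) ^ n) \<longlonglongrightarrow> 0" by (rule LIMSEQ_realpow_zero) auto
      then have "(\<lambda>n. L1_dist M (?h n) H + (1/2) ^ n + L1_dist M g (apply_bcontfun f))
          \<longlonglongrightarrow> 0 + 0 + L1_dist M g (apply_bcontfun f)"
        by (intro tendsto_add tendsto_const H(2))
      then show "(\<lambda>n. L1_dist M (?h n) H + (1/2) ^ n + L1_dist M g (apply_bcontfun f))
          \<longlonglongrightarrow> L1_dist M g (apply_bcontfun f)" by simp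
      have "L1_dist M H (apply_bcontfun (blinfun_apply S f))
          \<le> L1_dist M (?h n) H + (1/2) ^ n + L1_dist M g (apply_bcontfun f)" for n
      proof -
        have "L1_dist M H (apply_bcontfun (blinfun_apply S f))
            \<le> L1_dist M H (?h n) + L1_dist M (?h n) (apply_bcontfun (blinfun_apply S f))"
          by (intro L1_dist_triangle integrable_CK[OF reg] H)
        moreover have "L1_dist M (?h n) (apply_bcontfun (blinfun_apply S f))
            \<le> L1_dist M (apply_bcontfun (a n)) (apply_bcontfun f)" by (rule L1_dist_markov)
        moreover have "L1_dist M (apply_bcontfun (a n)) (apply_bcontfun f)
            \<le> L1_dist M (apply_bcontfun (a n)) g + L1_dist M g (apply_bcontfun f)"
          by (intro L1_dist_triangle integrable_CK[OF reg] g)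
        ultimately show ?thesis
          using a[of n] L1_dist_commute[of M g "apply_bcontfun (a n)"] L1_dist_commute[of M H "?h n"] by linarith
      qed
      then show "\<exists>N. \<forall>n\<ge>N. L1_dist M H (apply_bcontfun (blinfun_apply S f))
          \<le> L1_dist M (?h n) H + (1/2) ^ n + L1_dist M g (apply_bcontfun f)" by simp
    qed
    then show ?thesis using H(1) by (intro exI[of _ H] conjI allI)
  qed
  then have "\<forall>g. \<exists>H. integrable M g \<longrightarrow> integrable M H \<and>
      (\<forall>f. L1_dist M H (apply_bcontfun (blinfun_apply S f)) \<le> L1_dist M g (apply_bcontfun f))"
    by simp
  then show ?thesis unfolding L1_extension_def by (rule choice)
qed

lemma CK_approx2:
  assumes "integrable M g" "integrable M h" "0 < e"
  obtains f k :: "'k CK" where "L1_dist M g (apply_bcontfun f) + L1_dist M h (apply_bcontfun k) < e"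
proof -
  obtain f :: "'k CK" where "L1_dist M g (apply_bcontfun f) < e / 2"
    by (rule CK_dense_L1[OF reg assms(1) half_gt_zero[OF assms(3)]])
  moreover obtain k :: "'k CK" where "L1_dist M h (apply_bcontfun k) < e / 2"
    by (rule CK_dense_L1[OF reg assms(2) half_gt_zero[OF assms(3)]])
  ultimately have "L1_dist M g (apply_bcontfun f) + L1_dist M h (apply_bcontfun k) < e" by linarith
  then show ?thesis by (rule that)
qed

lemma L1_extension_induces:
  assumes E: "L1_extension M S E"
  shows "L1_bounded_operator M E \<and> (\<forall>f. AE x in M. E (apply_bcontfun f) x = apply_bcontfun (blinfun_apply S f) x)"
proof (intro conjI allI)
  have Ei: "integrable M (E g)" if "integrable M g" for g
    using E that by (auto simp: L1_extension_def)
  have Ed: "L1_dist M (E g) (apply_bcontfun (blinfun_apply S f)) \<le> L1_dist M g (apply_bcontfun f)"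
    if "integrable M g" for g f
    using E that by (auto simp: L1_extension_def)
  show "AE x in M. E (apply_bcontfun f) x = apply_bcontfun (blinfun_apply S f) x" for f
    using Ed[of "apply_bcontfun f" f] by (intro L1_dist_eq_0_AE Ei integrable_CK[OF reg]) (simp add: integrable_CK[OF reg] L1_dist_def)
  show "L1_bounded_operator M E"
    unfolding L1_bounded_operator_def
  proof (intro conjI allI impI)
    show "integrable M (E g)" if "integrable M g" for g by (rule Ei[OF that])
    show "AE x in M. E g x = E h x"
      if g: "integrable M g" and h: "integrable M h" and eq: "AE x in M. g x = h x" for g h
    proof (rule L1_dist_arbitrarily_small_AE)
      fix e :: real assume e: "0 < e"
      obtain f :: "'k CK" where f: "L1_dist M g (apply_bcontfun f) < e / 2"
        by (rule CK_dense_L1[OF reg g half_gt_zero[OF e]])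
      \<comment> \<open>One approximant serves both functions, because the L1 distance does not see
        null sets.\<close>
      have "L1_dist M h (apply_bcontfun f) = L1_dist M g (apply_bcontfun f)"
        by (rule L1_dist_cong_AE) (use g h integrable_CK[OF reg] eq in \<open>auto simp: eq_commute\<close>)
      then have "L1_dist M (E h) (apply_bcontfun (blinfun_apply S f)) < e / 2"
        using Ed[OF h, of f] f by linarith
      moreover have "L1_dist M (E g) (apply_bcontfun (blinfun_apply S f)) < e / 2"
        using Ed[OF g, of f] f by linarith
      moreover have "L1_dist M (E g) (E h) \<le> L1_dist M (E g) (apply_bcontfun (blinfun_apply S f))
          + L1_dist M (apply_bcontfun (blinfun_apply S f)) (E h)"
        by (intro L1_dist_triangle Ei g h integrable_CK[OF reg])
      ultimately show "L1_dist M (E g) (E h) \<le> e"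
        using L1_dist_commute[of M "E h" "apply_bcontfun (blinfun_apply S f)"] by linarith
    qed (rule Ei g h)+
    show "AE x in M. E (\<lambda>y. g y + h y) x = E g x + E h x"
      if g: "integrable M g" and h: "integrable M h" for g h
    proof (rule L1_dist_arbitrarily_small_AE)
      have gh: "integrable M (\<lambda>y. g y + h y)" using g h by auto
      show "integrable M (E (\<lambda>y. g y + h y))" by (rule Ei[OF gh])
      show "integrable M (\<lambda>x. E g x + E h x)" using Ei g h by auto
      fix e :: real assume e: "0 < e"
      obtain f k :: "'k CK" where fk: "L1_dist M g (apply_bcontfun f) + L1_dist M h (apply_bcontfun k) < e / 2"
        by (rule CK_approx2[OF g h half_gt_zero[OF e]])
      have "L1_dist M (E (\<lambda>y. g y + h y)) (apply_bcontfun (blinfun_apply S (f + k)))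
          \<le> L1_dist M (\<lambda>y. g y + h y) (\<lambda>y. apply_bcontfun f y + apply_bcontfun k y)"
        using Ed[OF gh, of "f + k"] by (simp add: plus_bcontfun.rep_eq)
      also have "\<dots> \<le> L1_dist M g (apply_bcontfun f) + L1_dist M h (apply_bcontfun k)"
        by (intro L1_dist_add g h integrable_CK[OF reg])
      finally have 1: "L1_dist M (E (\<lambda>y. g y + h y)) (apply_bcontfun (blinfun_apply S (f + k))) < e / 2"
        using fk by linarith
      have "L1_dist M (\<lambda>x. E g x + E h x) (apply_bcontfun (blinfun_apply S (f + k)))
          \<le> L1_dist M (E g) (apply_bcontfun (blinfun_apply S f)) + L1_dist M (E h) (apply_bcontfun (blinfun_apply S k))"
        using L1_dist_add[OF Ei[OF g] Ei[OF h] integrable_CK[OF reg] integrable_CK[OF reg]]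
        by (simp add: blinfun.add_right plus_bcontfun.rep_eq)
      then have 2: "L1_dist M (\<lambda>x. E g x + E h x) (apply_bcontfun (blinfun_apply S (f + k))) < e / 2"
        using fk Ed[OF g, of f] Ed[OF h, of k] by linarith
      have "L1_dist M (E (\<lambda>y. g y + h y)) (\<lambda>x. E g x + E h x)
          \<le> L1_dist M (E (\<lambda>y. g y + h y)) (apply_bcontfun (blinfun_apply S (f + k)))
          + L1_dist M (apply_bcontfun (blinfun_apply S (f + k))) (\<lambda>x. E g x + E h x)"
        using Ei g h by (intro L1_dist_triangle Ei gh integrable_CK[OF reg]) auto
      then show "L1_dist M (E (\<lambda>y. g y + h y)) (\<lambda>x. E g x + E h x) \<le> e"
        using 1 2 L1_dist_commute[of M "\<lambda>x. E g x + E h x" "apply_bcontfun (blinfun_apply S (f + k))"] by linarith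
    qed
    show "AE x in M. E (\<lambda>y. c * g y) x = c * E g x" if g: "integrable M g" for c g
    proof (rule L1_dist_arbitrarily_small_AE)
      have cg: "integrable M (\<lambda>y. c * g y)" using g by auto
      show "integrable M (E (\<lambda>y. c * g y))" by (rule Ei[OF cg])
      show cE: "integrable M (\<lambda>x. c * E g x)" using Ei g by auto
      fix e :: real assume e: "0 < e"
      have pos: "0 < 2 * (cmod c + 1)" by (simp add: add_nonneg_pos)
      obtain f :: "'k CK" where f: "L1_dist M g (apply_bcontfun f) < e / (2 * (cmod c + 1))"
        by (rule CK_dense_L1[OF reg g divide_pos_pos[OF e pos]])
      have scale: "L1_dist M (\<lambda>x. c * u x) (\<lambda>x. c * v x) = cmod c * L1_dist M u v" for u v
        by (simp add: L1_dist_def norm_mult flip: right_diff_distrib)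
      have cS: "apply_bcontfun (blinfun_apply S (cscale c f)) = (\<lambda>x. c * apply_bcontfun (blinfun_apply S f) x)"
        by (simp add: markov_cscale[OF markov] cscale.rep_eq)
      have 1: "L1_dist M (E (\<lambda>y. c * g y)) (apply_bcontfun (blinfun_apply S (cscale c f)))
          \<le> cmod c * L1_dist M g (apply_bcontfun f)"
        using Ed[OF cg, of "cscale c f"] by (simp add: cscale.rep_eq scale)
      have 2: "L1_dist M (\<lambda>x. c * E g x) (apply_bcontfun (blinfun_apply S (cscale c f)))
          \<le> cmod c * L1_dist M g (apply_bcontfun f)"
        unfolding cS scale by (intro mult_left_mono Ed g) auto
      have "L1_dist M (E (\<lambda>y. c * g y)) (\<lambda>x. c * E g x)
          \<le> L1_dist M (E (\<lambda>y. c * g y)) (apply_bcontfun (blinfun_apply S (cscale c f)))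
          + L1_dist M (apply_bcontfun (blinfun_apply S (cscale c f))) (\<lambda>x. c * E g x)"
        by (intro L1_dist_triangle Ei cg integrable_CK[OF reg] cE)
      also have "\<dots> \<le> 2 * cmod c * L1_dist M g (apply_bcontfun f)"
        using 1 2 L1_dist_commute[of M "\<lambda>x. c * E g x" "apply_bcontfun (blinfun_apply S (cscale c f))"] by linarith
      also have "\<dots> \<le> 2 * (cmod c + 1) * L1_dist M g (apply_bcontfun f)"
        by (intro mult_right_mono L1_dist_nonneg) auto
      also have "\<dots> \<le> e"
        using f pos by (simp add: pos_less_divide_eq mult.commute less_imp_le)
      finally show "L1_dist M (E (\<lambda>y. c * g y)) (\<lambda>x. c * E g x) \<le> e" .
    qed
    \<comment> \<open>The defining inequality with test function 0 is the contraction bound.\<close>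
    have "(LINT x|M. cmod (E g x)) \<le> 1 * (LINT x|M. cmod (g x))" if "integrable M g" for g
      using Ed[OF that, of 0] by (simp add: L1_dist_def blinfun.zero_right)
    then show "\<exists>B. \<forall>g. integrable M g \<longrightarrow> (LINT x|M. cmod (E g x)) \<le> B * (LINT x|M. cmod (g x))"
      by blast
  qed
qed

text \<open>The unspecified bound \<open>B\<close> improves to 1: by linearity \<open>E g\<close> is
  within \<open>B\<close> times the error of \<open>S k\<close> for any continuous \<open>k\<close>,
  and among continuous functions \<open>S\<close> is a contraction. Letting \<open>k\<close> tend to
  \<open>g\<close> removes the term with \<open>B\<close>.\<close>

lemma induces_L1_extension:
  assumes E: "L1_bounded_operator M E"
    and ES: "\<And>f. AE x in M. E (apply_bcontfun f) x = apply_bcontfun (blinfun_apply S f) x"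
  shows "L1_extension M S E"
  unfolding L1_extension_def
proof (intro allI impI conjI)
  fix g :: "'k \<Rightarrow> complex" and f :: "'k CK" assume g: "integrable M g"
  have Ei: "integrable M (E g)" if "integrable M g" for g
    using E that by (auto simp: L1_bounded_operator_def)
  have Ea: "AE x in M. E (\<lambda>y. g y + h y) x = E g x + E h x" if "integrable M g" "integrable M h" for g h
    using E that unfolding L1_bounded_operator_def by blast
  have Ec: "AE x in M. E (\<lambda>y. c * g y) x = c * E g x" if "integrable M g" for c g
    using E that unfolding L1_bounded_operator_def by blast
  obtain B where "\<forall>g. integrable M g \<longrightarrow> (LINT x|M. cmod (E g x)) \<le> B * (LINT x|M. cmod (g x))"
    using E unfolding L1_bounded_operator_def by (elim conjE exE)
  then have B: "(LINT x|M. cmod (E g x)) \<le> B * (LINT x|M. cmod (g x))" if "integrable M g" for g :: "'k \<Rightarrow> complex"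
    using that by blast
  show "integrable M (E g)" by (rule Ei[OF g])
  have bound: "L1_dist M (E g) (apply_bcontfun (blinfun_apply S k)) \<le> B * L1_dist M g (apply_bcontfun k)" for k
  proof -
    let ?k = "\<lambda>y. (-1) * apply_bcontfun k y"
    have ki: "integrable M ?k" using integrable_CK[OF reg, of k] by auto
    have "AE x in M. E g x - apply_bcontfun (blinfun_apply S k) x = E (\<lambda>y. g y + ?k y) x"
      using Ea[OF g ki] Ec[OF integrable_CK[OF reg, of k], of "-1"] ES[of k] by eventually_elim simp
    then have "L1_dist M (E g) (apply_bcontfun (blinfun_apply S k)) = (LINT x|M. cmod (E (\<lambda>y. g y + ?k y) x))"
      unfolding L1_dist_def
      using Ei[OF g] integrable_CK[OF reg] Ei[of "\<lambda>y. g y + ?k y"] g ki by (intro integral_cong_AE) auto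
    also have "\<dots> \<le> B * (LINT x|M. cmod (g x + ?k x))"
      using g ki by (intro B) auto
    finally show ?thesis by (simp add: L1_dist_def)
  qed
  show "L1_dist M (E g) (apply_bcontfun (blinfun_apply S f)) \<le> L1_dist M g (apply_bcontfun f)"
  proof (rule field_le_epsilon)
    fix e :: real assume e: "0 < e"
    have pos: "0 < \<bar>B\<bar> + 1" by simp
    obtain k :: "'k CK" where k: "L1_dist M g (apply_bcontfun k) < e / (\<bar>B\<bar> + 1)"
      by (rule CK_dense_L1[OF reg g divide_pos_pos[OF e pos]])
    have "L1_dist M (E g) (apply_bcontfun (blinfun_apply S f)) \<le>
        L1_dist M (E g) (apply_bcontfun (blinfun_apply S k))
        + L1_dist M (apply_bcontfun (blinfun_apply S k)) (apply_bcontfun (blinfun_apply S f))"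
      by (intro L1_dist_triangle Ei g integrable_CK[OF reg])
    also have "\<dots> \<le> \<bar>B\<bar> * L1_dist M g (apply_bcontfun k) + L1_dist M (apply_bcontfun k) (apply_bcontfun f)"
      using L1_dist_nonneg[of M g "apply_bcontfun k"]
      by (intro add_mono L1_dist_markov order_trans[OF bound] mult_right_mono) auto
    also have "L1_dist M (apply_bcontfun k) (apply_bcontfun f) \<le> L1_dist M (apply_bcontfun k) g + L1_dist M g (apply_bcontfun f)"
      by (intro L1_dist_triangle g integrable_CK[OF reg])
    finally have "L1_dist M (E g) (apply_bcontfun (blinfun_apply S f))
        \<le> (\<bar>B\<bar> + 1) * L1_dist M g (apply_bcontfun k) + L1_dist M g (apply_bcontfun f)"
      by (simp add: L1_dist_commute[of M _ g] algebra_simps)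
    also have "(\<bar>B\<bar> + 1) * L1_dist M g (apply_bcontfun k) \<le> e"
      using k pos by (simp add: pos_less_divide_eq mult.commute less_imp_le)
    finally show "L1_dist M (E g) (apply_bcontfun (blinfun_apply S f)) \<le> L1_dist M g (apply_bcontfun f) + e"
      by simp
  qed
qed

text \<open>Existence makes the choice in \<open>induced_L1_operator\<close> legitimate; the chosen
  operator is then known only through its two defining properties, which
  \<open>induces_L1_extension\<close> converts.\<close>

lemma L1_extension_induced: "L1_extension M S (induced_L1_operator M S)"
proof -
  obtain E where "L1_extension M S E" using L1_extension_exists by blast
  from someI_ex[OF exI[where P = "\<lambda>E. L1_bounded_operator M E \<and>
      (\<forall>f. AE x in M. E (apply_bcontfun f) x = apply_bcontfun (blinfun_apply S f) x)", OF L1_extension_induces[OF this]]]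
  show ?thesis
    unfolding induced_L1_operator_def[symmetric] by (intro induces_L1_extension) auto
qed

text \<open>This eliminates the induced operator \<open>E\<close>. If \<open>E g = g\<close>, the
  right side is the defining inequality of the extension. Conversely, for continuous
  \<open>f\<close> near \<open>g\<close>, the function \<open>S f\<close> is near \<open>E g\<close>
  by that inequality and near \<open>g\<close> by assumption.\<close>

lemma induced_fixed_iff:
  assumes g: "integrable M g"
  shows "(AE x in M. induced_L1_operator M S g x = g x) \<longleftrightarrow>
    (\<forall>f. L1_dist M g (apply_bcontfun (blinfun_apply S f)) \<le> L1_dist M g (apply_bcontfun f))"
proof
  let ?E = "induced_L1_operator M S"
  have Ei: "integrable M (?E g)"
    and Ed: "L1_dist M (?E g) (apply_bcontfun (blinfun_apply S f)) \<le> L1_dist M g (apply_bcontfun f)" for f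
    using L1_extension_induced g by (auto simp: L1_extension_def)
  {
    assume "AE x in M. ?E g x = g x"
    then have "L1_dist M (?E g) (apply_bcontfun (blinfun_apply S f)) = L1_dist M g (apply_bcontfun (blinfun_apply S f))" for f
      using Ei g integrable_CK[OF reg] by (intro L1_dist_cong_AE) auto
    then show "\<forall>f. L1_dist M g (apply_bcontfun (blinfun_apply S f)) \<le> L1_dist M g (apply_bcontfun f)"
      using Ed by simp
  next
    assume fix': "\<forall>f. L1_dist M g (apply_bcontfun (blinfun_apply S f)) \<le> L1_dist M g (apply_bcontfun f)"
    show "AE x in M. ?E g x = g x"
    proof (rule L1_dist_arbitrarily_small_AE[OF Ei g])
      fix e :: real assume e: "0 < e"
      obtain f :: "'k CK" where f: "L1_dist M g (apply_bcontfun f) < e / 2"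
        by (rule CK_dense_L1[OF reg g half_gt_zero[OF e]])
      have "L1_dist M (?E g) g \<le> L1_dist M (?E g) (apply_bcontfun (blinfun_apply S f))
          + L1_dist M (apply_bcontfun (blinfun_apply S f)) g"
        by (intro L1_dist_triangle Ei g integrable_CK[OF reg])
      also have "\<dots> \<le> e"
        using f Ed[of f] fix'[rule_format, of f] L1_dist_commute[of M g "apply_bcontfun (blinfun_apply S f)"] by linarith
      finally show "L1_dist M (?E g) g \<le> e" .
    qed
  }
qed

end

subsection \<open>Fixed functions\<close>

text \<open>
  For invariant \<open>M\<close> this says that \<open>g\<close> is fixed by the operator induced on \<open>L\<^sup>1\<close>, without
  reference to that operator.
\<close>

definition L1_fixed :: "'k measure \<Rightarrow> 'k opCK \<Rightarrow> ('k \<Rightarrow> real) \<Rightarrow> bool" where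
  "L1_fixed M S g \<longleftrightarrow> integrable M g \<and>
     (\<forall>f. continuous_on UNIV f \<longrightarrow> L1_dist M g (real_action S f) \<le> L1_dist M g f)"

context
  fixes S :: "'k opCK" and M :: "'k measure"
  assumes markov: "markov_op S" and reg: "regular_prob M" and inv: "invariant_under M S"
begin

lemma integrable_real_action: "integrable M (real_action S f)"
  by (rule integrable_continuous[OF reg real_action_continuous[OF markov]])

lemma L1_fixed_integrable: "L1_fixed M S g \<Longrightarrow> integrable M g"
  by (simp add: L1_fixed_def)

text \<open>It suffices that some continuous functions near \<open>g\<close> have images near
  \<open>g\<close>: any other test function is compared with these through the contraction property.
  Together with \<open>L1_fixed_approx\<close> this is the working form of fixedness for all closure
  properties below.\<close>

lemma L1_fixedI:
  assumes g: "integrable M g"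
    and a: "\<And>e. 0 < e \<Longrightarrow> \<exists>f. continuous_on UNIV f \<and> L1_dist M g f < e \<and> L1_dist M g (real_action S f) < e"
  shows "L1_fixed M S g"
  unfolding L1_fixed_def
proof (intro conjI allI impI g)
  fix f0 :: "'k \<Rightarrow> real" assume f0: "continuous_on UNIV f0"
  note [intro] = integrable_continuous[OF reg]
  show "L1_dist M g (real_action S f0) \<le> L1_dist M g f0"
  proof (rule field_le_epsilon)
    fix e :: real assume "0 < e"
    then obtain f where f: "continuous_on UNIV f" "L1_dist M g f < e/2" "L1_dist M g (real_action S f) < e/2"
      using a[of "e/2"] by auto
    have "L1_dist M g (real_action S f0) \<le> L1_dist M g (real_action S f) + L1_dist M (real_action S f) (real_action S f0)"
      by (intro L1_dist_triangle g integrable_real_action)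
    also have "L1_dist M (real_action S f) (real_action S f0) \<le> L1_dist M f f0"
      by (rule L1_dist_real_action[OF markov reg inv f(1) f0])
    also have "L1_dist M f f0 \<le> L1_dist M f g + L1_dist M g f0"
      using f(1) f0 by (intro L1_dist_triangle g) auto
    finally show "L1_dist M g (real_action S f0) \<le> L1_dist M g f0 + e"
      using f(2,3) L1_dist_commute[of M f g] by linarith
  qed
qed

lemma L1_fixed_approx:
  assumes "L1_fixed M S g" "0 < e"
  obtains f where "continuous_on UNIV f" "L1_dist M g f < e" "L1_dist M g (real_action S f) < e"
proof -
  have g: "integrable M g" using assms(1) by (simp add: L1_fixed_def)
  obtain f where f: "continuous_on UNIV f" "L1_dist M g f < e"
    by (rule continuous_dense_L1[OF reg g assms(2)])
  moreover have "L1_dist M g (real_action S f) \<le> L1_dist M g f"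
    using assms(1) f(1) by (simp add: L1_fixed_def)
  ultimately show ?thesis using that by fastforce
qed

lemma L1_fixed_const: "L1_fixed M S (\<lambda>_. c)"
proof (rule L1_fixedI)
  interpret prob_space M by (rule regular_prob_prob_space[OF reg])
  show "integrable M (\<lambda>_. c)" by simp
  have "real_action S (\<lambda>_. c) = (\<lambda>_. c)"
    using real_action_const[OF markov] by (intro ext)
  then show "\<exists>f. continuous_on UNIV f \<and> L1_dist M (\<lambda>_. c) f < e \<and> L1_dist M (\<lambda>_. c) (real_action S f) < e"
    if "0 < e" for e
    using that by (intro exI[of _ "\<lambda>_. c"]) (simp add: L1_dist_def)
qed

lemma L1_fixed_add:
  assumes u: "L1_fixed M S u" and v: "L1_fixed M S v"
  shows "L1_fixed M S (\<lambda>x. u x + v x)"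
proof (rule L1_fixedI)
  note ui = L1_fixed_integrable[OF u] and vi = L1_fixed_integrable[OF v]
  show "integrable M (\<lambda>x. u x + v x)" using ui vi by auto
  fix e :: real assume e: "0 < e"
  obtain f where f: "continuous_on UNIV f" "L1_dist M u f < e/2" "L1_dist M u (real_action S f) < e/2"
    by (rule L1_fixed_approx[OF u half_gt_zero[OF e]])
  obtain k where k: "continuous_on UNIV k" "L1_dist M v k < e/2" "L1_dist M v (real_action S k) < e/2"
    by (rule L1_fixed_approx[OF v half_gt_zero[OF e]])
  have "L1_dist M (\<lambda>x. u x + v x) (\<lambda>x. f x + k x) \<le> L1_dist M u f + L1_dist M v k"
    by (intro L1_dist_add ui vi integrable_continuous[OF reg] f(1) k(1))
  moreover have "L1_dist M (\<lambda>x. u x + v x) (\<lambda>x. real_action S f x + real_action S k x)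
      \<le> L1_dist M u (real_action S f) + L1_dist M v (real_action S k)"
    by (intro L1_dist_add ui vi integrable_real_action)
  moreover have "real_action S (\<lambda>x. f x + k x) = (\<lambda>x. real_action S f x + real_action S k x)"
    using real_action_add[OF markov f(1) k(1)] by (intro ext)
  ultimately show "\<exists>f. continuous_on UNIV f \<and> L1_dist M (\<lambda>x. u x + v x) f < e
      \<and> L1_dist M (\<lambda>x. u x + v x) (real_action S f) < e"
    using f k by (intro exI[of _ "\<lambda>x. f x + k x"]) (simp add: continuous_on_add)
qed

lemma L1_fixed_scale:
  assumes u: "L1_fixed M S u"
  shows "L1_fixed M S (\<lambda>x. c * u x)"
proof (rule L1_fixedI)
  show "integrable M (\<lambda>x. c * u x)" using L1_fixed_integrable[OF u] by auto
  fix e :: real assume e: "0 < e"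
  have pos: "0 < \<bar>c\<bar> + 1" by simp
  obtain f where f: "continuous_on UNIV f" "L1_dist M u f < e / (\<bar>c\<bar> + 1)"
      "L1_dist M u (real_action S f) < e / (\<bar>c\<bar> + 1)"
    by (rule L1_fixed_approx[OF u divide_pos_pos[OF e pos]])
  have scale: "L1_dist M (\<lambda>x. c * a x) (\<lambda>x. c * b x) < e" if "L1_dist M a b < e / (\<bar>c\<bar> + 1)" for a b
  proof -
    have "L1_dist M (\<lambda>x. c * a x) (\<lambda>x. c * b x) = \<bar>c\<bar> * L1_dist M a b"
      by (simp add: L1_dist_def abs_mult flip: right_diff_distrib)
    also have "\<dots> \<le> (\<bar>c\<bar> + 1) * L1_dist M a b"
      by (intro mult_right_mono L1_dist_nonneg) auto
    also have "\<dots> < e" using that pos by (simp add: pos_less_divide_eq mult.commute)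
    finally show ?thesis .
  qed
  have "real_action S (\<lambda>x. c * f x) = (\<lambda>x. c * real_action S f x)"
    using real_action_scale[OF markov f(1)] by (intro ext)
  then show "\<exists>f. continuous_on UNIV f \<and> L1_dist M (\<lambda>x. c * u x) f < e
      \<and> L1_dist M (\<lambda>x. c * u x) (real_action S f) < e"
    using f scale by (intro exI[of _ "\<lambda>x. c * f x"]) (simp add: continuous_on_mult_left)
qed

text \<open>
  \<open>S \<bar>f\<bar>\<close> dominates \<open>\<bar>S f\<bar>\<close>, and for \<open>f\<close> close to \<open>u\<close> both have almost the same integral.
\<close>

lemma L1_fixed_abs:
  assumes u: "L1_fixed M S u"
  shows "L1_fixed M S (\<lambda>x. \<bar>u x\<bar>)"
proof (rule L1_fixedI)
  note ui = L1_fixed_integrable[OF u]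
  show ai: "integrable M (\<lambda>x. \<bar>u x\<bar>)" using ui by auto
  have abs_le: "L1_dist M (\<lambda>x. \<bar>a x\<bar>) (\<lambda>x. \<bar>b x\<bar>) \<le> L1_dist M a b"
    if "integrable M a" "integrable M b" for a b :: "'k \<Rightarrow> real"
    using that by (intro L1_dist_mono) auto
  fix e :: real assume e: "0 < e"
  have e3: "0 < e / 3" using e by simp
  obtain f where f: "continuous_on UNIV f" "L1_dist M u f < e/3" "L1_dist M u (real_action S f) < e/3"
    by (rule L1_fixed_approx[OF u e3])
  let ?a = "\<lambda>x. \<bar>f x\<bar>" and ?r = "\<lambda>x. \<bar>real_action S f x\<bar>"
  have ca: "continuous_on UNIV ?a" using f(1) by (rule continuous_on_rabs)
  note fi = integrable_continuous[OF reg f(1)]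
  note cai = integrable_continuous[OF reg ca]
  have ri: "integrable M ?r" using integrable_real_action[of f] by auto
  have 1: "L1_dist M (\<lambda>x. \<bar>u x\<bar>) ?a < e / 3"
    using abs_le[OF ui fi] f(2) by linarith
  have 2: "L1_dist M (\<lambda>x. \<bar>u x\<bar>) ?r < e / 3"
    using abs_le[OF ui integrable_real_action] f(3) by (rule le_less_trans)
  \<comment> \<open>By domination the distance is a difference of integrals. Invariance turns the
    first into the integral of \<open>?a\<close>, and both integrals are close to that of the
    absolute value of \<open>u\<close>.\<close>
  have "L1_dist M ?r (real_action S ?a) = (\<integral>x. real_action S ?a x - ?r x \<partial>M)"
    unfolding L1_dist_def using abs_real_action_le[OF markov f(1)]
    by (intro Bochner_Integration.integral_cong) auto
  also have "\<dots> = (\<integral>x. ?a x \<partial>M) - (\<integral>x. ?r x \<partial>M)"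
    using integrable_real_action[of ?a] ri by (simp add: integral_real_action[OF markov reg inv ca])
  also have "\<dots> \<le> L1_dist M (\<lambda>x. \<bar>u x\<bar>) ?a + L1_dist M (\<lambda>x. \<bar>u x\<bar>) ?r"
    using abs_integral_diff_le_L1_dist[OF ai cai] abs_integral_diff_le_L1_dist[OF ai ri]
    unfolding real_norm_def by linarith
  finally have "L1_dist M ?r (real_action S ?a) < 2 * e / 3" using 1 2 by linarith
  moreover have "L1_dist M (\<lambda>x. \<bar>u x\<bar>) (real_action S ?a) \<le> L1_dist M (\<lambda>x. \<bar>u x\<bar>) ?r + L1_dist M ?r (real_action S ?a)"
    by (intro L1_dist_triangle ai ri integrable_real_action)
  ultimately have "L1_dist M (\<lambda>x. \<bar>u x\<bar>) (real_action S ?a) < e" using 2 by linarith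
  then show "\<exists>f. continuous_on UNIV f \<and> L1_dist M (\<lambda>x. \<bar>u x\<bar>) f < e
      \<and> L1_dist M (\<lambda>x. \<bar>u x\<bar>) (real_action S f) < e"
    using ca 1 e by (intro exI[of _ ?a]) auto
qed

lemma L1_fixed_limit:
  assumes g: "integrable M g" and u: "\<And>n. L1_fixed M S (u n)" and lim: "(\<lambda>n. L1_dist M g (u n)) \<longlonglongrightarrow> 0"
  shows "L1_fixed M S g"
proof (rule L1_fixedI[OF g])
  fix e :: real assume e: "0 < e"
  have "eventually (\<lambda>n. L1_dist M g (u n) < e / 2) sequentially"
    by (rule order_tendstoD(2)[OF lim half_gt_zero[OF e]])
  then obtain n where n: "L1_dist M g (u n) < e / 2" by (auto simp: eventually_sequentially)
  obtain f where f: "continuous_on UNIV f" "L1_dist M (u n) f < e/2" "L1_dist M (u n) (real_action S f) < e/2"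
    by (rule L1_fixed_approx[OF u half_gt_zero[OF e]])
  have "L1_dist M g f \<le> L1_dist M g (u n) + L1_dist M (u n) f"
    by (intro L1_dist_triangle g L1_fixed_integrable[OF u] integrable_continuous[OF reg f(1)])
  moreover have "L1_dist M g (real_action S f) \<le> L1_dist M g (u n) + L1_dist M (u n) (real_action S f)"
    by (intro L1_dist_triangle g L1_fixed_integrable[OF u] integrable_real_action)
  ultimately show "\<exists>f. continuous_on UNIV f \<and> L1_dist M g f < e \<and> L1_dist M g (real_action S f) < e"
    using f n by (intro exI[of _ f]) auto
qed

text \<open>With \<open>h'\<close> the positive part of \<open>h\<close>, the indicator is the
  increasing limit of \<open>min 1 (n h')\<close>. Each member of this sequence is fixed, being
  built by sums, multiples and absolute values, and dominated convergence gives the limit in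
  L1.\<close>

lemma L1_fixed_indicator_pos:
  assumes h: "L1_fixed M S h"
  shows "L1_fixed M S (indicator {x. 0 < h x})"
proof (rule L1_fixed_limit)
  interpret prob_space M by (rule regular_prob_prob_space[OF reg])
  have [measurable]: "h \<in> borel_measurable M" using L1_fixed_integrable[OF h] by auto
  have "{x \<in> space M. 0 < h x} \<in> sets M" by measurable
  then have A: "{x. 0 < h x} \<in> sets M" by (simp add: regular_prob_space[OF reg])
  then show ii: "integrable M (indicator {x. 0 < h x} :: 'k \<Rightarrow> real)"
    by (intro integrable_real_indicator) (auto simp: less_top[symmetric])
  \<comment> \<open>\<open>?p n\<close> is \<open>n\<close> times the positive part of
    \<open>h\<close>, and \<open>?u n\<close> is its minimum with 1, both written with absolute
    values so that the closure rules apply literally.\<close>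
  let ?p = "\<lambda>n x. real n * ((1/2) * (\<bar>h x\<bar> + h x))"
  let ?u = "\<lambda>n x. (1/2) * ((1 + ?p n x) + (-1) * \<bar>1 + (-1) * ?p n x\<bar>)"
  have p: "L1_fixed M S (?p n)" for n
    by (rule L1_fixed_scale[OF L1_fixed_scale[OF L1_fixed_add[OF L1_fixed_abs[OF h] h]]])
  show u: "L1_fixed M S (?u n)" for n
    by (rule L1_fixed_scale[OF L1_fixed_add[OF L1_fixed_add[OF L1_fixed_const p]
          L1_fixed_scale[OF L1_fixed_abs[OF L1_fixed_add[OF L1_fixed_const L1_fixed_scale[OF p]]]]]])
  have ueq: "?u n x = min 1 (real n * max 0 (h x))" for n x
  proof -
    have "(1/2) * (\<bar>a\<bar> + a) = max 0 a" "(1/2) * ((1 + a) + (-1) * \<bar>1 + (-1) * a\<bar>) = min 1 a" for a :: real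
      by (simp_all add: max_def min_def abs_if)
    then show ?thesis by (simp only:)
  qed
  let ?v = "\<lambda>n x. min 1 (real n * max 0 (h x))"
  have "(\<lambda>n. \<integral>x. norm (indicator {x. 0 < h x} x - ?v n x) \<partial>M) \<longlonglongrightarrow> (\<integral>x. 0 \<partial>M)"
  proof (rule integral_dominated_convergence)
    show "integrable M (\<lambda>_. 1 :: real)" by simp
    have "(\<lambda>n. norm (indicator {x. 0 < h x} x - ?v n x)) \<longlonglongrightarrow> 0" for x
    proof (rule tendsto_eventually)
      obtain m :: nat where m: "1 / h x < real m" using reals_Archimedean2 by blast
      have "norm (indicator {x. 0 < h x} x - ?v n x) = 0" if "m \<le> n" for n
      proof (cases "0 < h x")
        case True
        have "1 < real m * h x" using m True by (simp add: pos_divide_less_eq)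
        also have "\<dots> \<le> real n * h x" using that True by (intro mult_right_mono) auto
        finally show ?thesis using True by simp
      next
        case False
        then show ?thesis by (simp add: max_absorb1)
      qed
      then show "eventually (\<lambda>n. norm (indicator {x. 0 < h x} x - ?v n x) = 0) sequentially"
        unfolding eventually_sequentially by blast
    qed
    then show "AE x in M. (\<lambda>n. norm (indicator {x. 0 < h x} x - ?v n x)) \<longlonglongrightarrow> 0"
      by simp
    have "norm (norm (indicator {x. 0 < h x} x - ?v n x)) \<le> 1" for n x
      by (cases "0 < h x") simp_all
    then show "AE x in M. norm (norm (indicator {x. 0 < h x} x - ?v n x)) \<le> 1" for n
      by simp
    have "integrable M (?v n)" for n
      using L1_fixed_integrable[OF u, of n] unfolding ueq .
    then show "(\<lambda>x. norm (indicator {x. 0 < h x} x - ?v n x)) \<in> borel_measurable M" for n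
      using ii by (intro borel_measurable_integrable integrable_norm Bochner_Integration.integrable_diff)
  qed simp
  then show "(\<lambda>n. L1_dist M (indicator {x. 0 < h x}) (?u n)) \<longlonglongrightarrow> 0"
    unfolding L1_dist_def ueq by simp
qed

text \<open>
  Write \<open>f = f u + f (1 - u)\<close> with \<open>u\<close> continuous and close to the indicator of \<open>A\<close>. As \<open>S u\<close> is
  close to this indicator, too, \<open>S (f u)\<close> is concentrated on \<open>A\<close> and \<open>S (f (1 - u))\<close> off \<open>A\<close>.
\<close>

lemma L1_fixed_indicator_invariant:
  assumes A: "A \<in> sets borel" and fA: "L1_fixed M S (indicator A)" and f: "continuous_on UNIV f"
  shows "(\<integral>x. indicator A x * real_action S f x \<partial>M) = (\<integral>x. indicator A x * f x \<partial>M)"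
proof -
  interpret prob_space M by (rule regular_prob_prob_space[OF reg])
  have As: "A \<in> sets M" using A unfolding regular_prob_sets[OF reg] .
  obtain B where B: "0 < B" "\<And>x. norm (f x) \<le> B" using continuous_bounded[OF f] by blast
  have Ai: "integrable M (\<lambda>x. indicator A x * k x)" if "continuous_on UNIV k" for k :: "'k \<Rightarrow> real"
    using integrable_mult_indicator[OF As integrable_continuous[OF reg that]]
    unfolding real_scaleR_def .
  note iA = L1_fixed_integrable[OF fA]
  \<comment> \<open>Here \<open>w\<close> plays the part of \<open>v\<close> that lives on
    \<open>A\<close>, up to an error controlled by how far \<open>k\<close> is from the indicator.
    It is used with \<open>S f\<close>, \<open>S (f u)\<close>, \<open>S u\<close>, and then with
    \<open>f\<close>, \<open>f u\<close>, \<open>u\<close>; the two middle integrals coincide by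
    invariance.\<close>
  have est: "\<bar>(\<integral>x. indicator A x * v x \<partial>M) - (\<integral>x. w x \<partial>M)\<bar> \<le> B * L1_dist M (indicator A) k"
    if "continuous_on UNIV v" "continuous_on UNIV w" "continuous_on UNIV k"
      and p: "\<And>x. \<bar>indicator A x * v x - w x\<bar> \<le> B * \<bar>indicator A x - k x\<bar>" for v w k
  proof -
    note wi = integrable_continuous[OF reg that(2)] and ki = integrable_continuous[OF reg that(3)]
    have "\<bar>(\<integral>x. indicator A x * v x \<partial>M) - (\<integral>x. w x \<partial>M)\<bar> \<le> L1_dist M (\<lambda>x. indicator A x * v x) w"
      using abs_integral_diff_le_L1_dist[OF Ai[OF that(1)] wi] by simp
    also have "\<dots> \<le> (\<integral>x. B * norm (indicator A x - k x) \<partial>M)"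
      unfolding L1_dist_def
    proof (rule integral_mono)
      show "norm (indicator A x * v x - w x) \<le> B * norm (indicator A x - k x)" for x
        using p[of x] by simp
    qed (use Ai[OF that(1)] wi iA ki in auto)
    finally show ?thesis by (simp add: L1_dist_def)
  qed
  have "\<bar>(\<integral>x. indicator A x * real_action S f x \<partial>M) - (\<integral>x. indicator A x * f x \<partial>M)\<bar> \<le> 0"
  proof (rule field_le_epsilon)
    fix e :: real assume e: "0 < e"
    have e2: "0 < e / (2 * B)" using e B(1) by simp
    obtain u :: "'k \<Rightarrow> real" where u: "continuous_on UNIV u" "\<And>x. 0 \<le> u x" "\<And>x. u x \<le> 1"
        "L1_dist M (indicator A) u < e / (2 * B)"
      by (rule continuous_approx_indicator[OF reg A e2]) (rule that)
    have fu: "continuous_on UNIV (\<lambda>x. f x * u x)" "continuous_on UNIV (\<lambda>x. f x - f x * u x)"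
      by (intro continuous_on_mult continuous_on_diff f u(1))+
    have Bu: "continuous_on UNIV (\<lambda>x. B * u x)" "continuous_on UNIV (\<lambda>x. B - B * u x)"
      by (intro continuous_on_mult continuous_on_diff continuous_on_const u(1))+
    have "\<bar>f x * u x\<bar> \<le> B * u x" for x
      using B(2)[of x] u(2)[of x] by (simp add: abs_mult mult_right_mono)
    moreover have fu2: "\<bar>f x - f x * u x\<bar> \<le> B - B * u x" for x
    proof -
      have "f x - f x * u x = f x * (1 - u x)" by (simp add: algebra_simps)
      then have "\<bar>f x - f x * u x\<bar> = norm (f x) * (1 - u x)" using u(3)[of x] by (simp only: abs_mult) simp
      also have "\<dots> \<le> B * (1 - u x)" using B(2)[of x] u(3)[of x] by (intro mult_right_mono) auto
      finally show ?thesis by (simp add: right_diff_distrib)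
    qed
    ultimately have le:
        "real_action S (\<lambda>x. \<bar>f x * u x\<bar>) x \<le> real_action S (\<lambda>x. B * u x) x"
        "real_action S (\<lambda>x. \<bar>f x - f x * u x\<bar>) x \<le> real_action S (\<lambda>x. B - B * u x) x" for x
      using real_action_mono[OF markov continuous_on_rabs[OF fu(1)] Bu(1)]
        real_action_mono[OF markov continuous_on_rabs[OF fu(2)] Bu(2)] by simp_all
    have r1: "\<bar>real_action S (\<lambda>x. f x * u x) x\<bar> \<le> B * real_action S u x" for x
      using abs_real_action_le[OF markov fu(1), of x] le(1)[of x]
        real_action_scale[OF markov u(1), of B x] by linarith
    have r2: "\<bar>real_action S (\<lambda>x. f x - f x * u x) x\<bar> \<le> B - B * real_action S u x" for x
      using abs_real_action_le[OF markov fu(2), of x] le(2)[of x]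
        real_action_scale[OF markov u(1), of B x]
        real_action_diff[OF markov continuous_on_const Bu(1), of B x]
        real_action_const[OF markov, of B x] by linarith
    have "\<bar>(\<integral>x. indicator A x * real_action S f x \<partial>M) - (\<integral>x. real_action S (\<lambda>x. f x * u x) x \<partial>M)\<bar>
        \<le> B * L1_dist M (indicator A) (real_action S u)"
    proof (rule est)
      have le1: "0 \<le> real_action S u x" "real_action S u x \<le> 1" for x
        using real_action_nonneg[OF markov u(1,2)] real_action_const[OF markov, of 1 x]
          real_action_mono[OF markov u(1) continuous_on_const u(3), of x] by auto
      show "\<bar>indicator A x * real_action S f x - real_action S (\<lambda>x. f x * u x) x\<bar>
          \<le> B * \<bar>indicator A x - real_action S u x\<bar>" for x
      proof (cases "x \<in> A")
        case True
        have "B * \<bar>1 - real_action S u x\<bar> = B - B * real_action S u x"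
          using le1[of x] by (simp add: algebra_simps)
        then show ?thesis
          using r2[of x] real_action_diff[OF markov f fu(1), of x] True by simp
      next
        case False
        then show ?thesis using r1[of x] le1[of x] by simp
      qed
    qed (rule real_action_continuous[OF markov])+
    also have "\<dots> \<le> B * L1_dist M (indicator A) u"
      using fA u(1) B(1) by (intro mult_left_mono) (auto simp: L1_fixed_def)
    finally have 1: "\<bar>(\<integral>x. indicator A x * real_action S f x \<partial>M) - (\<integral>x. f x * u x \<partial>M)\<bar>
        \<le> B * L1_dist M (indicator A) u"
      by (simp add: integral_real_action[OF markov reg inv fu(1)])
    have 2: "\<bar>(\<integral>x. indicator A x * f x \<partial>M) - (\<integral>x. f x * u x \<partial>M)\<bar> \<le> B * L1_dist M (indicator A) u"
    proof (rule est[OF f fu(1) u(1)])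
      fix x
      have "indicator A x * f x - f x * u x = f x * (indicator A x - u x)" by (simp add: algebra_simps)
      then show "\<bar>indicator A x * f x - f x * u x\<bar> \<le> B * \<bar>indicator A x - u x\<bar>"
        using B(2)[of x] by (simp add: abs_mult mult_right_mono)
    qed
    have "2 * (B * L1_dist M (indicator A) u) \<le> e"
      using u(4) B(1) by (simp add: pos_less_divide_eq mult.commute mult.left_commute)
    then show "\<bar>(\<integral>x. indicator A x * real_action S f x \<partial>M) - (\<integral>x. indicator A x * f x \<partial>M)\<bar> \<le> 0 + e"
      using 1 2 by linarith
  qed
  then show ?thesis by simp
qed

text \<open>\<open>L1_fixed\<close> tests real functions only. A real approximant of
  \<open>h\<close> whose image is also near \<open>h\<close> suffices, since a complex test function
  is compared with it through the complex contraction estimate.\<close>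

lemma L1_fixed_complex:
  assumes h: "L1_fixed M S h"
  shows "L1_dist M (\<lambda>x. complex_of_real (h x)) (apply_bcontfun (blinfun_apply S F))
    \<le> L1_dist M (\<lambda>x. complex_of_real (h x)) (apply_bcontfun F)"
proof (rule field_le_epsilon)
  fix e :: real assume e: "0 < e"
  obtain f where f: "continuous_on UNIV f" "L1_dist M h f < e/2" "L1_dist M h (real_action S f) < e/2"
    by (rule L1_fixed_approx[OF h half_gt_zero[OF e]])
  let ?h = "\<lambda>x. complex_of_real (h x)" and ?f = "Bcontfun (\<lambda>x. complex_of_real (f x))"
  have hi: "integrable M ?h" using L1_fixed_integrable[OF h] by auto
  have cd: "L1_dist M (\<lambda>x. complex_of_real (a x)) (\<lambda>x. complex_of_real (b x)) = L1_dist M a b" for a b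
    by (simp add: L1_dist_def flip: of_real_diff)
  note f' = Bcontfun_of_real_apply[OF f(1)]
  have Sf: "apply_bcontfun (blinfun_apply S ?f) = (\<lambda>x. complex_of_real (real_action S f x))"
    by (intro ext of_real_real_action[OF markov f(1)])
  note CKi = integrable_CK[OF reg]
  have "L1_dist M ?h (apply_bcontfun (blinfun_apply S F)) \<le> L1_dist M ?h (apply_bcontfun (blinfun_apply S ?f))
      + L1_dist M (apply_bcontfun (blinfun_apply S ?f)) (apply_bcontfun (blinfun_apply S F))"
    by (intro L1_dist_triangle hi CKi)
  also have "L1_dist M (apply_bcontfun (blinfun_apply S ?f)) (apply_bcontfun (blinfun_apply S F))
      \<le> L1_dist M (apply_bcontfun ?f) (apply_bcontfun F)"
    by (rule L1_dist_markov[OF markov reg inv])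
  also have "\<dots> \<le> L1_dist M (apply_bcontfun ?f) ?h + L1_dist M ?h (apply_bcontfun F)"
    by (intro L1_dist_triangle hi CKi)
  finally show "L1_dist M ?h (apply_bcontfun (blinfun_apply S F)) \<le> L1_dist M ?h (apply_bcontfun F) + e"
    using f(2,3) L1_dist_commute[of M f h] by (simp add: Sf cd f')
qed

text \<open>A real test function \<open>f\<close> for the real part is completed to the complex one
  \<open>f + i k\<close> with \<open>k\<close> near the imaginary part of \<open>g\<close>, so that
  the distance from \<open>g\<close> exceeds the distance of the real parts by little.\<close>

lemma L1_fixed_Re:
  assumes g: "integrable M g"
    and fix_g: "\<And>F. L1_dist M g (apply_bcontfun (blinfun_apply S F)) \<le> L1_dist M g (apply_bcontfun F)"
  shows "L1_fixed M S (\<lambda>x. Re (g x))"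
  unfolding L1_fixed_def
proof (intro conjI allI impI)
  note CKi = integrable_CK[OF reg] and ci = integrable_continuous[OF reg]
  show Ri: "integrable M (\<lambda>x. Re (g x))" using g by auto
  have Ii: "integrable M (\<lambda>x. Im (g x))" using g by auto
  fix f :: "'k \<Rightarrow> real" assume f: "continuous_on UNIV f"
  show "L1_dist M (\<lambda>x. Re (g x)) (real_action S f) \<le> L1_dist M (\<lambda>x. Re (g x)) f"
  proof (rule field_le_epsilon)
    fix e :: real assume e: "0 < e"
    obtain k where k: "continuous_on UNIV k" "L1_dist M (\<lambda>x. Im (g x)) k < e"
      by (rule continuous_dense_L1[OF reg Ii e])
    have "continuous_on UNIV (\<lambda>x. Complex (f x) (k x))"
      unfolding Complex_eq
      by (intro continuous_on_add continuous_on_mult continuous_on_const continuous_on_of_real f k(1))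
    note F = Bcontfun_apply[OF this]
    let ?F = "Bcontfun (\<lambda>x. Complex (f x) (k x))"
    have SF: "apply_bcontfun (blinfun_apply S ?F) = (\<lambda>x. Complex (real_action S f x) (real_action S k x))"
      by (intro ext) (simp add: apply_markov[OF markov] F)
    note Fi = Bochner_Integration.integrable_diff[OF g CKi[of ?F], unfolded F]
    note SFi = Bochner_Integration.integrable_diff[OF g CKi[of "blinfun_apply S ?F"], unfolded SF]
    have "L1_dist M (\<lambda>x. Re (g x)) (real_action S f) \<le> L1_dist M g (apply_bcontfun (blinfun_apply S ?F))"
      unfolding L1_dist_def SF
    proof (rule integral_mono)
      show "norm (Re (g x) - real_action S f x) \<le> cmod (g x - Complex (real_action S f x) (real_action S k x))" for x
        using abs_Re_le_cmod[of "g x - Complex (real_action S f x) (real_action S k x)"] by simp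
    qed (use SFi Ri integrable_real_action in auto)
    also have "\<dots> \<le> L1_dist M g (apply_bcontfun ?F)" by (rule fix_g)
    also have "\<dots> \<le> (\<integral>x. norm (Re (g x) - f x) + norm (Im (g x) - k x) \<partial>M)"
      unfolding L1_dist_def F
    proof (rule integral_mono)
      show "cmod (g x - Complex (f x) (k x)) \<le> norm (Re (g x) - f x) + norm (Im (g x) - k x)" for x
        using cmod_le[of "g x - Complex (f x) (k x)"] by simp
    qed (use Fi Ri Ii ci[OF f] ci[OF k(1)] in auto)
    also have "\<dots> = L1_dist M (\<lambda>x. Re (g x)) f + L1_dist M (\<lambda>x. Im (g x)) k"
      unfolding L1_dist_def using Ri Ii ci[OF f] ci[OF k(1)] by (intro Bochner_Integration.integral_add) auto
    finally show "L1_dist M (\<lambda>x. Re (g x)) (real_action S f) \<le> L1_dist M (\<lambda>x. Re (g x)) f + e"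
      using k(2) by linarith
  qed
qed

text \<open>Multiplication by \<open>-i\<close> makes the imaginary part a real part and preserves
  distances once the test function is rotated by \<open>i\<close>.\<close>

lemma L1_fixed_Im:
  assumes g: "integrable M g"
    and fix_g: "\<And>F. L1_dist M g (apply_bcontfun (blinfun_apply S F)) \<le> L1_dist M g (apply_bcontfun F)"
  shows "L1_fixed M S (\<lambda>x. Im (g x))"
proof -
  have rot: "L1_dist M (\<lambda>x. - \<i> * g x) (apply_bcontfun F) = L1_dist M g (apply_bcontfun (cscale \<i> F))" for F
  proof -
    have "- \<i> * g x - apply_bcontfun F x = - \<i> * (g x - \<i> * apply_bcontfun F x)" for x
      by (simp add: algebra_simps)
    then show ?thesis by (simp only: L1_dist_def apply_cscale norm_mult norm_minus_cancel norm_ii mult_1)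
  qed
  have "L1_fixed M S (\<lambda>x. Re (- \<i> * g x))"
  proof (rule L1_fixed_Re)
    show "integrable M (\<lambda>x. - \<i> * g x)" using g by (intro integrable_mult_right)
    show "L1_dist M (\<lambda>x. - \<i> * g x) (apply_bcontfun (blinfun_apply S F))
        \<le> L1_dist M (\<lambda>x. - \<i> * g x) (apply_bcontfun F)" for F
      unfolding rot markov_cscale[OF markov, symmetric] by (rule fix_g)
  qed
  then show ?thesis by simp
qed

end

subsection \<open>Extreme invariant states\<close>

text \<open>
  The value \<open>0\<close> on discontinuous functions makes this a compact set in the product topology on
  functionals defined on all functions.
\<close>

definition invariant_states_on :: "'k opCK set \<Rightarrow> ('k \<Rightarrow> real) set \<Rightarrow> (('k \<Rightarrow> real) \<Rightarrow> real) set" where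
  "invariant_states_on \<S> N = {\<phi>. invariant_state \<S> \<phi> \<and> (\<forall>h\<in>N. \<phi> h = 0) \<and> (\<forall>f. \<not> continuous_on UNIV f \<longrightarrow> \<phi> f = 0)}"

lemma closed_invariant_states_on: "closed (invariant_states_on \<S> N)"
  unfolding invariant_states_on_def invariant_state_def state_def Ball_def
  by (intro closed_Collect_conj closed_Collect_all closed_Collect_imp open_Collect_const closed_Collect_eq
      closed_Collect_le continuous_on_const continuous_on_add continuous_on_mult continuous_on_product_coordinates)

text \<open>A state maps \<open>f\<close> into \<open>[-b, b]\<close> for any bound \<open>b\<close>
  of the absolute value of \<open>f\<close>, so the set is a closed subset of a product of compact
  intervals, which is compact by Tychonoff. On discontinuous \<open>f\<close> the prescribed value 0
  lies in the interval as well.\<close>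

lemma compact_invariant_states_on: "compact (invariant_states_on \<S> N)"
proof -
  have "\<exists>B. 0 < B \<and> (continuous_on UNIV f \<longrightarrow> (\<forall>x. \<bar>f x\<bar> \<le> B))" for f :: "'k \<Rightarrow> real"
  proof (cases "continuous_on UNIV f")
    case True
    obtain B where "0 < B" "\<And>x. norm (f x) \<le> B"
      by (rule continuous_bounded[OF True]) (rule that)
    then show ?thesis by (intro exI[of _ B]) auto
  next
    case False
    then show ?thesis by (intro exI[of _ 1]) auto
  qed
  then have "\<forall>f :: 'k \<Rightarrow> real. \<exists>B. 0 < B \<and> (continuous_on UNIV f \<longrightarrow> (\<forall>x::'k. \<bar>f x\<bar> \<le> B))" by (rule allI)
  from choice[OF this] obtain b where
    "\<forall>f :: 'k \<Rightarrow> real. 0 < b f \<and> (continuous_on UNIV f \<longrightarrow> (\<forall>x. \<bar>f x\<bar> \<le> b f))" ..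
  then have b: "0 < b f" "continuous_on UNIV f \<Longrightarrow> \<bar>f x\<bar> \<le> b f" for f x by auto
  have "compactin (product_topology (\<lambda>_. euclidean) UNIV) (PiE UNIV (\<lambda>f. {- b f .. b f}))"
    unfolding compactin_PiE by simp
  then have "compact (PiE UNIV (\<lambda>f. {- b f .. b f}))"
    by (simp add: euclidean_product_topology)
  then have "compact (PiE UNIV (\<lambda>f. {- b f .. b f}) \<inter> invariant_states_on \<S> N)"
    by (rule compact_Int_closed[OF _ closed_invariant_states_on])
  moreover have "invariant_states_on \<S> N \<subseteq> PiE UNIV (\<lambda>f. {- b f .. b f})"
  proof (rule subsetI, rule PiE_I)
    fix \<phi> and f :: "'k \<Rightarrow> real" assume \<phi>: "\<phi> \<in> invariant_states_on \<S> N"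
    then have st: "state \<phi>" by (simp add: invariant_states_on_def invariant_state_def)
    show "\<phi> f \<in> {- b f .. b f}"
    proof (cases "continuous_on UNIV f")
      case True
      have le: "- b f \<le> f x" "f x \<le> b f" for x using b(2)[OF True, of x] by auto
      show ?thesis
        using state_mono[OF st continuous_on_const True le(1)] state_mono[OF st True continuous_on_const le(2)]
        by (simp add: state_const[OF st])
    next
      case False
      then show ?thesis using \<phi> b(1)[of f] by (simp add: invariant_states_on_def less_imp_le)
    qed
  qed auto
  ultimately show ?thesis by (simp add: Int_absorb1)
qed

text \<open>Functionals are compared on continuous functions only, so that a state and integration
  against its representing measure are extreme together. Extremality is meant among all invariant
  states, not only those vanishing on a given set.\<close>

definition extreme_state :: "'k opCK set \<Rightarrow> (('k \<Rightarrow> real) \<Rightarrow> real) \<Rightarrow> bool" where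
  "extreme_state \<S> \<phi> \<longleftrightarrow> (\<forall>\<psi> \<psi>' t. invariant_state \<S> \<psi> \<longrightarrow> invariant_state \<S> \<psi>' \<longrightarrow> 0 < t \<longrightarrow> t < 1 \<longrightarrow>
     (\<forall>f. continuous_on UNIV f \<longrightarrow> \<phi> f = t * \<psi> f + (1 - t) * \<psi>' f) \<longrightarrow>
     (\<forall>f. continuous_on UNIV f \<longrightarrow> \<psi> f = \<phi> f))"

text \<open>Vanishing on nonnegative functions is a face condition: if a proper convex combination
  of two states vanishes on such an \<open>h\<close>, both do. Hence an extreme point among the
  states that kill \<open>N\<close> is extreme among all invariant states.\<close>

lemma extreme_invariant_state_exists:
  assumes ne: "invariant_states_on \<S> N \<noteq> {}"
    and N: "N \<subseteq> {h. continuous_on UNIV h \<and> (\<forall>x. 0 \<le> h x)}"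
  obtains \<phi> where "\<phi> \<in> invariant_states_on \<S> N" "extreme_state \<S> \<phi>"
proof -
  obtain \<phi> where \<phi>: "\<phi> \<in> invariant_states_on \<S> N" and
    ext: "\<And>\<psi> \<psi>' t. \<psi> \<in> invariant_states_on \<S> N \<Longrightarrow> \<psi>' \<in> invariant_states_on \<S> N \<Longrightarrow> 0 < t \<Longrightarrow> t < 1 \<Longrightarrow>
      \<phi> = (\<lambda>x. t * \<psi> x + (1 - t) * \<psi>' x) \<Longrightarrow> \<psi> = \<phi>"
    by (rule extreme_point_exists[OF compact_invariant_states_on closed_invariant_states_on ne]) (rule that)
  show ?thesis
  proof (rule that[OF \<phi>], unfold extreme_state_def, intro allI impI)
    fix \<psi> \<psi>' :: "('k \<Rightarrow> real) \<Rightarrow> real" and t :: real and f0 :: "'k \<Rightarrow> real"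
    assume \<psi>: "invariant_state \<S> \<psi>" "invariant_state \<S> \<psi>'" and t: "0 < t" "t < 1"
      and "\<forall>f. continuous_on UNIV f \<longrightarrow> \<phi> f = t * \<psi> f + (1 - t) * \<psi>' f" and f0: "continuous_on UNIV f0"
    then have eq: "\<phi> f = t * \<psi> f + (1 - t) * \<psi>' f" if "continuous_on UNIV f" for f using that by blast
    have st: "state \<psi>" "state \<psi>'" using \<psi> by (auto simp: invariant_state_def)
    have N0: "\<psi> h = 0 \<and> \<psi>' h = 0" if h: "h \<in> N" for h
    proof -
      have hc: "continuous_on UNIV h" "\<And>x. 0 \<le> h x" using subsetD[OF N h] by auto
      note p = state_nonneg[OF st(1) hc] state_nonneg[OF st(2) hc]
      have "t * \<psi> h + (1 - t) * \<psi>' h = 0"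
        using \<phi> h eq[OF hc(1)] by (simp add: invariant_states_on_def)
      moreover have "0 \<le> t * \<psi> h" "0 \<le> (1 - t) * \<psi>' h" using p t by auto
      ultimately have "t * \<psi> h = 0" "(1 - t) * \<psi>' h = 0" by linarith+
      then show ?thesis using t by simp
    qed
    \<comment> \<open>Arbitrary invariant states are reset to 0 on discontinuous functions in order
      to enter the compact set.\<close>
    let ?cut = "\<lambda>\<xi> f. if continuous_on UNIV f then \<xi> f else (0 :: real)"
    have cut: "?cut \<xi> \<in> invariant_states_on \<S> N" if \<xi>: "invariant_state \<S> \<xi>" "\<And>h. h \<in> N \<Longrightarrow> \<xi> h = 0"
      and R: "\<And>S f. S \<in> \<S> \<Longrightarrow> continuous_on UNIV (real_action S f)" for \<xi>
      using \<xi> R unfolding invariant_states_on_def invariant_state_def state_def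
      by (simp add: continuous_on_add continuous_on_mult_left)
    have R: "continuous_on UNIV (real_action S f)" for S :: "'k opCK" and f
      unfolding real_action_def[abs_def] by (intro continuous_on_Re continuous_on_apply_bcontfun)
    have "?cut \<psi> = \<phi>"
    proof (rule ext)
      show "\<phi> = (\<lambda>x. t * ?cut \<psi> x + (1 - t) * ?cut \<psi>' x)"
        using eq \<phi> by (auto simp: invariant_states_on_def)
    qed (use cut[OF \<psi>(1)] cut[OF \<psi>(2)] N0 R t in auto)
    from fun_cong[OF this, of f0] show "\<psi> f0 = \<phi> f0" using f0 by simp
  qed
qed

lemma invariant_measures_iff:
  "M \<in> invariant_measures \<S> \<longleftrightarrow> regular_prob M \<and> (\<forall>S\<in>\<S>. invariant_under M (S :: 'k opCK))"
  unfolding invariant_measures_def regular_prob_def invariant_under_def by simp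

lemma invariant_underI:
  assumes markov: "markov_op (S :: 'k opCK)" and reg: "regular_prob M"
    and inv: "\<And>f. continuous_on UNIV f \<Longrightarrow> (\<integral>x. real_action S f x \<partial>M) = (\<integral>x. f x \<partial>M)"
  shows "invariant_under M S"
  unfolding invariant_under_def
proof
  fix F :: "'k CK"
  note CKi = integrable_CK[OF reg]
  have c: "continuous_on UNIV (\<lambda>x. Re (apply_bcontfun F x))" "continuous_on UNIV (\<lambda>x. Im (apply_bcontfun F x))"
    by (intro continuous_on_Re continuous_on_Im continuous_on_apply_bcontfun)+
  have "Re (LINT x|M. apply_bcontfun (blinfun_apply S F) x) = (\<integral>x. Re (apply_bcontfun (blinfun_apply S F) x) \<partial>M)"
    by (rule integral_Re[OF CKi, symmetric])
  also have "\<dots> = (\<integral>x. Re (apply_bcontfun F x) \<partial>M)"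
    unfolding apply_markov[OF markov] complex.sel by (rule inv[OF c(1)])
  also have "\<dots> = Re (LINT x|M. apply_bcontfun F x)" by (rule integral_Re[OF CKi])
  finally have 1: "Re (LINT x|M. apply_bcontfun (blinfun_apply S F) x) = Re (LINT x|M. apply_bcontfun F x)" .
  have "Im (LINT x|M. apply_bcontfun (blinfun_apply S F) x) = (\<integral>x. Im (apply_bcontfun (blinfun_apply S F) x) \<partial>M)"
    by (rule integral_Im[OF CKi, symmetric])
  also have "\<dots> = (\<integral>x. Im (apply_bcontfun F x) \<partial>M)"
    unfolding apply_markov[OF markov] complex.sel by (rule inv[OF c(2)])
  also have "\<dots> = Im (LINT x|M. apply_bcontfun F x)" by (rule integral_Im[OF CKi])
  finally show "(LINT x|M. apply_bcontfun (blinfun_apply S F) x) = (LINT x|M. apply_bcontfun F x)"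
    using 1 by (intro complex_eqI)
qed

subsection \<open>Null ideals\<close>

text \<open>The complement of the common zero set of \<open>J\<close>. For the null ideal of a
  regular measure it is the complement of the support.\<close>

definition nonvanishing_set :: "'k CK set \<Rightarrow> 'k set" where
  "nonvanishing_set J = (\<Union>f\<in>J. {x. apply_bcontfun f x \<noteq> 0})"

lemma open_nonzero: "open {x. apply_bcontfun (f :: 'k CK) x \<noteq> 0}"
  by (intro open_Collect_neq continuous_on_const continuous_on_apply_bcontfun)

lemma open_nonvanishing_set: "open (nonvanishing_set J)"
  unfolding nonvanishing_set_def by (intro open_UN ballI open_nonzero)

context
  fixes M :: "'k measure"
  assumes reg: "regular_prob M"
begin

lemma null_ideal_iff_AE: "f \<in> null_ideal M \<longleftrightarrow> (AE x in M. apply_bcontfun f x = 0)"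
proof -
  have "integrable M (\<lambda>x. cmod (apply_bcontfun f x))"
    by (rule integrable_norm[OF integrable_CK[OF reg]])
  from integral_nonneg_eq_0_iff_AE[OF this] show ?thesis
    by (simp add: null_ideal_def)
qed

lemma null_ideal_iff_measure: "f \<in> null_ideal M \<longleftrightarrow> measure M {x. apply_bcontfun f x \<noteq> 0} = 0"
proof -
  interpret prob_space M by (rule regular_prob_prob_space[OF reg])
  have "{x. apply_bcontfun f x \<noteq> 0} \<in> sets M"
    unfolding regular_prob_sets[OF reg] by (rule borel_open[OF open_nonzero])
  from prob_eq_0[OF this] show ?thesis by (simp add: null_ideal_iff_AE)
qed

text \<open>The set is a union of possibly uncountably many null sets, but each compact subset is
  covered by finitely many of them because they are open. Inner regularity concludes.\<close>

lemma measure_nonvanishing_set: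
  assumes J: "J \<subseteq> null_ideal M"
  shows "measure M (nonvanishing_set J) = 0"
proof -
  interpret prob_space M by (rule regular_prob_prob_space[OF reg])
  have sb: "sets M = sets borel" by (rule regular_prob_sets[OF reg])
  have "measure M (nonvanishing_set J) \<le> 0"
  proof (rule field_le_epsilon)
    fix e :: real assume e: "0 < e"
    obtain C where C: "compact C" "C \<subseteq> nonvanishing_set J" "measure M (nonvanishing_set J) < measure M C + e"
      by (rule compact_inner_approx[OF reg borel_open[OF open_nonvanishing_set] e])
    obtain D where D: "D \<subseteq> J" "finite D" "C \<subseteq> (\<Union>f\<in>D. {x. apply_bcontfun f x \<noteq> 0})"
      by (rule compactE_image[OF C(1) open_nonzero C(2)[unfolded nonvanishing_set_def]])
    have null: "(\<Union>f\<in>D. {x. apply_bcontfun f x \<noteq> 0}) \<in> null_sets M"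
    proof (rule null_sets_UN')
      show "countable D" using D(2) by (rule countable_finite)
      fix f assume "f \<in> D"
      then have "f \<in> null_ideal M" using D(1) J by auto
      moreover have "{x. apply_bcontfun f x \<noteq> 0} \<in> sets M"
        unfolding sb by (rule borel_open[OF open_nonzero])
      ultimately show "{x. apply_bcontfun f x \<noteq> 0} \<in> null_sets M"
        by (simp add: null_ideal_iff_measure null_sets_def emeasure_eq_measure)
    qed
    have "measure M C \<le> measure M (\<Union>f\<in>D. {x. apply_bcontfun f x \<noteq> 0})"
      by (rule finite_measure_mono[OF D(3) null_setsD2[OF null]])
    also have "\<dots> = 0" using null by (simp add: measure_def null_setsD1)
    finally show "measure M (nonvanishing_set J) \<le> 0 + e" using C(3) by linarith
  qed
  then show ?thesis using measure_nonneg[of M] by (intro antisym)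
qed

lemma null_ideal_of_subset:
  assumes "{x. apply_bcontfun f x \<noteq> 0} \<subseteq> U" "open U" "measure M U = 0"
  shows "f \<in> null_ideal M"
proof -
  interpret prob_space M by (rule regular_prob_prob_space[OF reg])
  have "U \<in> sets M" unfolding regular_prob_sets[OF reg] by (rule borel_open[OF assms(2)])
  from finite_measure_mono[OF assms(1) this] show ?thesis
    unfolding null_ideal_iff_measure using assms(3) measure_nonneg[of M] by (intro antisym) simp_all
qed

lemma one_notin_null_ideal: "one_CK \<notin> null_ideal M"
proof -
  interpret prob_space M by (rule regular_prob_prob_space[OF reg])
  show ?thesis by (simp add: null_ideal_iff_AE)
qed

lemma null_ideal_diff: "f \<in> null_ideal M \<Longrightarrow> g \<in> null_ideal M \<Longrightarrow> f - g \<in> null_ideal M"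
  unfolding null_ideal_iff_AE by (erule (1) AE_mp[OF _ AE_mp]) (rule AE_I2, simp)

lemma null_ideal_modulus: "f \<in> null_ideal M \<Longrightarrow> modulus f \<in> null_ideal M"
  unfolding null_ideal_iff_AE by (simp add: modulus.rep_eq)

lemma null_ideal_markov:
  assumes S: "markov_op S" "invariant_under M S" and f: "f \<in> null_ideal M"
  shows "blinfun_apply S f \<in> null_ideal M"
proof -
  have c: "continuous_on UNIV (\<lambda>x. cmod (apply_bcontfun f x))"
    by (intro continuous_on_norm continuous_on_apply_bcontfun)
  have "(\<integral>x. cmod (apply_bcontfun (blinfun_apply S f) x) \<partial>M) \<le> (\<integral>x. real_action S (\<lambda>x. cmod (apply_bcontfun f x)) x \<partial>M)"
    by (intro integral_mono integrable_norm integrable_CK[OF reg]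
        integrable_continuous[OF reg real_action_continuous[OF S(1)]] cmod_markov_le[OF S(1)])
  also have "\<dots> = (\<integral>x. cmod (apply_bcontfun f x) \<partial>M)"
    by (rule integral_real_action[OF S(1) reg S(2) c])
  also have "\<dots> = 0" using f by (simp add: null_ideal_def)
  finally have "(\<integral>x. cmod (apply_bcontfun (blinfun_apply S f) x) \<partial>M) \<le> 0" .
  moreover have "0 \<le> (\<integral>x. cmod (apply_bcontfun (blinfun_apply S f) x) \<partial>M)"
    by simp
  ultimately show ?thesis unfolding null_ideal_def mem_Collect_eq by (rule antisym)
qed

lemma integral_of_null_ideal_diff:
  assumes "f - const_bcontfun c \<in> null_ideal M"
  shows "(LINT x|M. apply_bcontfun f x) = c"
proof -
  interpret prob_space M by (rule regular_prob_prob_space[OF reg])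
  have "AE x in M. apply_bcontfun f x = c"
    using assms unfolding null_ideal_iff_AE by simp
  then have "(LINT x|M. apply_bcontfun f x) = (LINT x|M. c)"
    using integrable_CK[OF reg, of f] by (intro integral_cong_AE) auto
  then show ?thesis by (simp add: prob_space)
qed

end

subsection \<open>Ergodic measures\<close>

context
  fixes \<S> :: "'k opCK set"
  assumes markov: "\<forall>S\<in>\<S>. markov_op S"
begin

lemma L1_fix_space_iff:
  assumes M: "M \<in> invariant_measures \<S>"
  shows "g \<in> L1_fix_space \<S> M \<longleftrightarrow> integrable M g \<and>
    (\<forall>S\<in>\<S>. \<forall>F. L1_dist M g (apply_bcontfun (blinfun_apply S F)) \<le> L1_dist M g (apply_bcontfun F))"
proof -
  have reg: "regular_prob M" and inv: "\<And>S. S \<in> \<S> \<Longrightarrow> invariant_under M S"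
    using M by (auto simp: invariant_measures_iff)
  have "(AE x in M. induced_L1_operator M S g x = g x) \<longleftrightarrow>
      (\<forall>F. L1_dist M g (apply_bcontfun (blinfun_apply S F)) \<le> L1_dist M g (apply_bcontfun F))"
    if "integrable M g" "S \<in> \<S>" for S
    by (rule induced_fixed_iff[OF bspec[OF markov that(2)] reg inv[OF that(2)] that(1)])
  then show ?thesis unfolding L1_fix_space_def mem_Collect_eq by (intro conj_cong refl ball_cong)
qed

lemma L1_fixed_in_L1_fix_space:
  assumes M: "M \<in> invariant_measures \<S>" and h: "integrable M h" "\<And>S. S \<in> \<S> \<Longrightarrow> L1_fixed M S h"
  shows "(\<lambda>x. complex_of_real (h x)) \<in> L1_fix_space \<S> M"
proof -
  have reg: "regular_prob M" and inv: "\<And>S. S \<in> \<S> \<Longrightarrow> invariant_under M S"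
    using M by (auto simp: invariant_measures_iff)
  show ?thesis
    unfolding L1_fix_space_iff[OF M]
  proof (intro conjI ballI allI)
    show "integrable M (\<lambda>x. complex_of_real (h x))" using h(1) by (rule integrable_of_real)
    fix S F assume S: "S \<in> \<S>"
    show "L1_dist M (\<lambda>x. complex_of_real (h x)) (apply_bcontfun (blinfun_apply S F))
        \<le> L1_dist M (\<lambda>x. complex_of_real (h x)) (apply_bcontfun F)"
      by (rule L1_fixed_complex[OF bspec[OF markov S] reg inv[OF S] h(2)[OF S]])
  qed
qed

lemma one_in_L1_fix_space:
  assumes M: "M \<in> invariant_measures \<S>"
  shows "(\<lambda>_. 1) \<in> L1_fix_space \<S> M"
proof -
  have reg: "regular_prob M" and inv: "\<And>S. S \<in> \<S> \<Longrightarrow> invariant_under M S"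
    using M by (auto simp: invariant_measures_iff)
  have "(\<lambda>_. complex_of_real 1) \<in> L1_fix_space \<S> M"
  proof (rule L1_fixed_in_L1_fix_space[OF M])
    show "integrable M (\<lambda>_. 1 :: real)" by (rule integrable_continuous[OF reg continuous_on_const])
    show "L1_fixed M S (\<lambda>_. 1)" if "S \<in> \<S>" for S
      by (rule L1_fixed_const[OF bspec[OF markov that] reg inv[OF that]])
  qed
  then show ?thesis by simp
qed

text \<open>The constant 1 is fixed, so it is a nonzero multiple of the generator \<open>e\<close>
  of the fixed space. Thus \<open>e\<close>, and with it every fixed function, is constant almost
  everywhere, and the constant is the integral.\<close>

lemma ergodic_fixed_const:
  assumes M: "M \<in> ergodic_measures \<S>" and g: "g \<in> L1_fix_space \<S> M"
  shows "AE x in M. g x = (LINT x|M. g x)"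
proof -
  have inv: "M \<in> invariant_measures \<S>" using M by (simp add: ergodic_measures_def)
  then have reg: "regular_prob M" by (simp add: invariant_measures_iff)
  interpret prob_space M by (rule regular_prob_prob_space[OF reg])
  obtain e where e: "\<forall>g\<in>L1_fix_space \<S> M. \<exists>c. AE x in M. g x = c * e x"
    using M unfolding ergodic_measures_def by blast
  obtain c0 where c0: "AE x in M. 1 = c0 * e x" using bspec[OF e one_in_L1_fix_space[OF inv]] ..
  obtain c where c: "AE x in M. g x = c * e x" using bspec[OF e g] ..
  have AEc: "AE x in M. g x = c / c0"
    using c0 c
  proof eventually_elim
    case (elim x)
    then have "c0 \<noteq> 0" by auto
    then have "e x = 1 / c0" using elim(1) by (simp add: field_simps)
    then show ?case using elim(2) by simp
  qed
  have "integrable M g" using g by (simp add: L1_fix_space_def)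
  then have "(LINT x|M. g x) = (LINT x|M. c / c0)"
    using AEc by (intro integral_cong_AE) auto
  then have "(LINT x|M. g x) = c / c0" by (simp add: prob_space)
  then show ?thesis using AEc by simp
qed

lemma fix_space_in_L1_fix_space:
  assumes M: "M \<in> invariant_measures \<S>" and f: "f \<in> fix_space \<S>"
  shows "apply_bcontfun f \<in> L1_fix_space \<S> M"
proof -
  have reg: "regular_prob M" and inv: "\<And>S. S \<in> \<S> \<Longrightarrow> invariant_under M S"
    using M by (auto simp: invariant_measures_iff)
  show ?thesis
    unfolding L1_fix_space_iff[OF M]
  proof (intro conjI ballI allI)
    show "integrable M (apply_bcontfun f)" by (rule integrable_CK[OF reg])
    fix S F assume S: "S \<in> \<S>"
    have "L1_dist M (apply_bcontfun (blinfun_apply S f)) (apply_bcontfun (blinfun_apply S F))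
        \<le> L1_dist M (apply_bcontfun f) (apply_bcontfun F)"
      by (rule L1_dist_markov[OF bspec[OF markov S] reg inv[OF S]])
    then show "L1_dist M (apply_bcontfun f) (apply_bcontfun (blinfun_apply S F)) \<le> L1_dist M (apply_bcontfun f) (apply_bcontfun F)"
      using f S by (simp add: fix_space_def)
  qed
qed

lemmas ergodic_fix_space_const = ergodic_fixed_const[OF _ fix_space_in_L1_fix_space]

text \<open>The normalized restriction of \<open>M\<close> to a set with fixed indicator. Applied to
  such a set and its complement it writes \<open>M\<close> as a convex combination of invariant
  states.\<close>

lemma invariant_state_restrict:
  assumes M: "M \<in> invariant_measures \<S>" and A: "A \<in> sets borel" and pos: "0 < measure M A"
    and fA: "\<And>S. S \<in> \<S> \<Longrightarrow> L1_fixed M S (indicator A)"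
  shows "invariant_state \<S> (\<lambda>f. (\<integral>x. indicator A x * f x \<partial>M) / measure M A)"
proof -
  have reg: "regular_prob M" and inv: "\<And>S. S \<in> \<S> \<Longrightarrow> invariant_under M S"
    using M by (auto simp: invariant_measures_iff)
  have As: "A \<in> sets M" using A unfolding regular_prob_sets[OF reg] .
  have Ai: "integrable M (\<lambda>x. indicator A x * k x)" if "continuous_on UNIV k" for k :: "'k \<Rightarrow> real"
    using integrable_mult_indicator[OF As integrable_continuous[OF reg that]]
    unfolding real_scaleR_def .
  show ?thesis
    unfolding invariant_state_def state_def
  proof (intro conjI allI impI ballI)
    fix f g :: "'k \<Rightarrow> real" assume f: "continuous_on UNIV f" and g: "continuous_on UNIV g"
    show "(\<integral>x. indicator A x * (f x + g x) \<partial>M) / measure M A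
        = (\<integral>x. indicator A x * f x \<partial>M) / measure M A + (\<integral>x. indicator A x * g x \<partial>M) / measure M A"
      unfolding distrib_left Bochner_Integration.integral_add[OF Ai[OF f] Ai[OF g]] by (rule add_divide_distrib)
  next
    fix f :: "'k \<Rightarrow> real" and c :: real
    have "(\<integral>x. indicator A x * (c * f x) \<partial>M) = (\<integral>x. c * (indicator A x * f x) \<partial>M)"
      by (simp only: mult.left_commute)
    then show "(\<integral>x. indicator A x * (c * f x) \<partial>M) / measure M A = c * ((\<integral>x. indicator A x * f x \<partial>M) / measure M A)"
      by simp
  next
    fix f :: "'k \<Rightarrow> real" assume "\<forall>x. 0 \<le> f x"
    then show "0 \<le> (\<integral>x. indicator A x * f x \<partial>M) / measure M A"
      by (intro divide_nonneg_nonneg integral_nonneg) auto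
  next
    show "(\<integral>x. indicator A x * 1 \<partial>M) / measure M A = 1"
      using As pos by (simp add: regular_prob_space[OF reg])
  next
    fix S f assume S: "S \<in> \<S>" and f: "continuous_on UNIV (f :: 'k \<Rightarrow> real)"
    show "(\<integral>x. indicator A x * real_action S f x \<partial>M) / measure M A = (\<integral>x. indicator A x * f x \<partial>M) / measure M A"
      unfolding L1_fixed_indicator_invariant[OF bspec[OF markov S] reg inv[OF S] A fA[OF S] f] ..
  qed
qed

text \<open>Let \<open>A\<close> be the set where \<open>h\<close> exceeds its integral. Measure 1
  is impossible, since \<open>h\<close> minus its integral would be positive almost everywhere with
  integral 0. A measure strictly between 0 and 1 would split \<open>M\<close> into the restrictions
  to \<open>A\<close> and its complement, against extremality.\<close>

lemma extreme_fixed_le_integral: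
  assumes M: "M \<in> invariant_measures \<S>"
    and extr: "extreme_state \<S> (\<lambda>f. \<integral>x. f x \<partial>M)"
    and hi: "integrable M h" and h: "\<And>S. S \<in> \<S> \<Longrightarrow> L1_fixed M S h"
  shows "AE x in M. h x \<le> (\<integral>x. h x \<partial>M)"
proof -
  have reg: "regular_prob M" and inv: "\<And>S. S \<in> \<S> \<Longrightarrow> invariant_under M S"
    using M by (auto simp: invariant_measures_iff)
  interpret prob_space M by (rule regular_prob_prob_space[OF reg])
  note sp = regular_prob_space[OF reg]
  let ?c = "\<integral>x. h x \<partial>M"
  let ?k = "\<lambda>x. h x + - ?c"
  define A where "A = {x. 0 < ?k x}"
  have km: "?k \<in> borel_measurable M" using hi by auto
  have "{x \<in> space M. 0 < ?k x} \<in> sets M" using km by measurable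
  then have As: "A \<in> sets M" by (simp add: A_def sp)
  then have A: "A \<in> sets borel" unfolding regular_prob_sets[OF reg] .
  then have nA: "- A \<in> sets borel" by (metis sets.compl_sets space_borel Compl_eq_Diff_UNIV)
  have fA: "L1_fixed M S (indicator A)" if S: "S \<in> \<S>" for S
    unfolding A_def
    by (intro L1_fixed_indicator_pos[OF bspec[OF markov S] reg inv[OF S]]
        L1_fixed_add[OF bspec[OF markov S] reg inv[OF S]] h[OF S]
        L1_fixed_const[OF bspec[OF markov S] reg inv[OF S]])
  have fnA: "L1_fixed M S (indicator (- A))" if S: "S \<in> \<S>" for S
  proof -
    have "L1_fixed M S (\<lambda>x. 1 + (-1) * indicator A x)"
      by (intro L1_fixed_add[OF bspec[OF markov S] reg inv[OF S]]
          L1_fixed_scale[OF bspec[OF markov S] reg inv[OF S]] fA[OF S]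
          L1_fixed_const[OF bspec[OF markov S] reg inv[OF S]])
    moreover have "(\<lambda>x. 1 + (-1) * indicator A x) = (indicator (- A) :: 'k \<Rightarrow> real)"
      by (rule ext) (simp add: indicator_def)
    ultimately show ?thesis by (simp only:)
  qed
  define t where "t = measure M A"
  have mnA: "measure M (- A) = 1 - t"
    using prob_compl[OF As] by (simp add: sp t_def Compl_eq_Diff_UNIV)
  have "t = 0"
  proof (rule ccontr)
    assume "t \<noteq> 0"
    then have t0: "0 < t" by (simp add: t_def zero_less_measure_iff)
    show False
    proof (cases "t = 1")
      case True
      then have "AE x in M. x \<in> A" using prob_eq_1[OF As] by (simp add: t_def)
      then have pos: "AE x in M. 0 < ?k x" by (simp add: A_def)
      have ki: "integrable M ?k" using hi by auto
      have "(\<integral>x. ?k x \<partial>M) = 0" using hi by (simp add: prob_space)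
      moreover have "AE x in M. 0 \<le> ?k x" using pos by eventually_elim simp
      ultimately have "AE x in M. ?k x = 0" using integral_nonneg_eq_0_iff_AE[OF ki] by blast
      with pos have "AE x in M. False" by eventually_elim simp
      then show False by simp
    next
      case False
      then have t1: "t < 1" using prob_le_1[of A] by (simp add: t_def order_less_le)
      have st: "invariant_state \<S> (\<lambda>f. (\<integral>x. indicator A x * f x \<partial>M) / t)"
        unfolding t_def by (rule invariant_state_restrict[OF M A _ fA]) (use t0 in \<open>simp_all add: t_def\<close>)
      have st': "invariant_state \<S> (\<lambda>f. (\<integral>x. indicator (-A) x * f x \<partial>M) / (1 - t))"
        unfolding mnA[symmetric] by (rule invariant_state_restrict[OF M nA _ fnA]) (use t1 mnA in simp_all)
      have nAs: "- A \<in> sets M" using nA unfolding regular_prob_sets[OF reg] .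
      have Ai: "integrable M (\<lambda>x. indicator B x * k x)" if "continuous_on UNIV k" "B \<in> sets M" for k :: "'k \<Rightarrow> real" and B
        using integrable_mult_indicator[OF that(2) integrable_continuous[OF reg that(1)]]
        unfolding real_scaleR_def .
      have eq: "(\<integral>x. indicator A x * f x \<partial>M) / t = (\<integral>x. f x \<partial>M)" if f: "continuous_on UNIV f" for f
      proof (rule extr[unfolded extreme_state_def, rule_format, OF st st' t0 t1 _ f])
        fix f :: "'k \<Rightarrow> real" assume f: "continuous_on UNIV f"
        have "(\<integral>x. f x \<partial>M) = (\<integral>x. indicator A x * f x + indicator (-A) x * f x \<partial>M)"
          by (intro Bochner_Integration.integral_cong refl) (simp add: indicator_def)
        also have "\<dots> = (\<integral>x. indicator A x * f x \<partial>M) + (\<integral>x. indicator (-A) x * f x \<partial>M)"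
          by (rule Bochner_Integration.integral_add[OF Ai[OF f As] Ai[OF f nAs]])
        finally show "(\<integral>x. f x \<partial>M) = t * ((\<integral>x. indicator A x * f x \<partial>M) / t)
            + (1 - t) * ((\<integral>x. indicator (-A) x * f x \<partial>M) / (1 - t))"
          using t0 t1 by simp
      qed
      \<comment> \<open>Extremality gives \<open>M\<close> and its normalized restriction to
        \<open>A\<close> the same integrals of continuous functions. Testing on functions near the
        indicator of \<open>A\<close> yields \<open>t = t * t\<close>.\<close>
      have "\<bar>t - t * t\<bar> \<le> 0"
      proof (rule field_le_epsilon)
        fix e :: real assume e: "0 < e"
        obtain f :: "'k \<Rightarrow> real" where f: "continuous_on UNIV f" "L1_dist M (indicator A) f < e / 2"
          by (rule continuous_approx_indicator[OF reg A half_gt_zero[OF e]]) (rule that)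
        have iA: "integrable M (indicator A :: 'k \<Rightarrow> real)"
          using As by (intro integrable_real_indicator) (auto simp: less_top[symmetric])
        note fi = integrable_continuous[OF reg f(1)]
        have IA: "(\<integral>x. indicator A x \<partial>M) = t" using As by (simp add: t_def sp)
        have 1: "\<bar>t - (\<integral>x. f x \<partial>M)\<bar> \<le> L1_dist M (indicator A) f"
          using abs_integral_diff_le_L1_dist[OF iA fi] IA by simp
        have "\<bar>(\<integral>x. indicator A x \<partial>M) - (\<integral>x. indicator A x * f x \<partial>M)\<bar> \<le> L1_dist M (indicator A) (\<lambda>x. indicator A x * f x)"
          using abs_integral_diff_le_L1_dist[OF iA Ai[OF f(1) As]] by simp
        also have "\<dots> \<le> L1_dist M (indicator A) f"
          by (intro L1_dist_mono Bochner_Integration.integrable_diff iA fi Ai[OF f(1) As] AE_I2)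
            (simp add: indicator_def)
        finally have 2: "\<bar>t - t * (\<integral>x. f x \<partial>M)\<bar> \<le> L1_dist M (indicator A) f"
          using eq[OF f(1)] t0 IA by (simp add: field_simps)
        have "\<bar>t * (\<integral>x. f x \<partial>M) - t * t\<bar> = t * \<bar>t - (\<integral>x. f x \<partial>M)\<bar>"
          using t0 by (simp add: abs_mult abs_minus_commute flip: right_diff_distrib)
        also have "\<dots> \<le> 1 * \<bar>t - (\<integral>x. f x \<partial>M)\<bar>" using t1 by (intro mult_right_mono) auto
        finally have "\<bar>t - t * (\<integral>x. f x \<partial>M)\<bar> + \<bar>t * (\<integral>x. f x \<partial>M) - t * t\<bar> \<le> e"
          using 1 2 f(2) by simp
        then show "\<bar>t - t * t\<bar> \<le> 0 + e"
          using abs_triangle_ineq[of "t - t * (\<integral>x. f x \<partial>M)" "t * (\<integral>x. f x \<partial>M) - t * t"] by simp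
      qed
      then have "t * (1 - t) = 0" by (simp add: algebra_simps)
      then show False using t0 t1 by simp
    qed
  qed
  then have "AE x in M. x \<notin> A" using prob_eq_0[OF As] by (simp add: t_def)
  then show ?thesis by eventually_elim (simp add: A_def)
qed

text \<open>The one-sided estimate for \<open>h\<close> and for \<open>-h\<close> makes real fixed
  functions constant; a complex fixed function is handled through its real and imaginary
  parts.\<close>

lemma extreme_imp_ergodic:
  assumes M: "M \<in> invariant_measures \<S>"
    and extr: "extreme_state \<S> (\<lambda>f. \<integral>x. f x \<partial>M)"
  shows "M \<in> ergodic_measures \<S>"
proof -
  have reg: "regular_prob M" and inv: "\<And>S. S \<in> \<S> \<Longrightarrow> invariant_under M S"
    using M by (auto simp: invariant_measures_iff)
  interpret prob_space M by (rule regular_prob_prob_space[OF reg])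
  have const: "AE x in M. h x = (\<integral>x. h x \<partial>M)"
    if hi: "integrable M h" and h: "\<And>S. S \<in> \<S> \<Longrightarrow> L1_fixed M S h" for h
  proof -
    have "integrable M (\<lambda>x. -1 * h x)" using hi by auto
    moreover have "L1_fixed M S (\<lambda>x. -1 * h x)" if S: "S \<in> \<S>" for S
      by (rule L1_fixed_scale[OF bspec[OF markov S] reg inv[OF S] h[OF S]])
    ultimately have "AE x in M. -1 * h x \<le> (\<integral>x. -1 * h x \<partial>M)"
      by (rule extreme_fixed_le_integral[OF M extr])
    moreover have "AE x in M. h x \<le> (\<integral>x. h x \<partial>M)"
      by (rule extreme_fixed_le_integral[OF M extr hi h])
    ultimately show ?thesis by eventually_elim simp
  qed
  have "\<exists>c. AE x in M. g x = c * 1" if g: "g \<in> L1_fix_space \<S> M" for g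
  proof -
    have gi: "integrable M g"
      and fix_g: "\<And>S F. S \<in> \<S> \<Longrightarrow> L1_dist M g (apply_bcontfun (blinfun_apply S F)) \<le> L1_dist M g (apply_bcontfun F)"
      using g unfolding L1_fix_space_iff[OF M] by blast+
    have R: "L1_fixed M S (\<lambda>x. Re (g x))" if S: "S \<in> \<S>" for S
      by (rule L1_fixed_Re[OF bspec[OF markov S] reg inv[OF S] gi fix_g[OF S]])
    have I: "L1_fixed M S (\<lambda>x. Im (g x))" if S: "S \<in> \<S>" for S
      by (rule L1_fixed_Im[OF bspec[OF markov S] reg inv[OF S] gi fix_g[OF S]])
    have "AE x in M. Re (g x) = (\<integral>x. Re (g x) \<partial>M)" by (rule const[OF integrable_Re[OF gi] R])
    moreover have "AE x in M. Im (g x) = (\<integral>x. Im (g x) \<partial>M)" by (rule const[OF integrable_Im[OF gi] I])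
    ultimately have "AE x in M. g x = Complex (\<integral>x. Re (g x) \<partial>M) (\<integral>x. Im (g x) \<partial>M) * 1"
      by eventually_elim (simp add: complex_eq_iff)
    then show ?thesis ..
  qed
  then show ?thesis
    unfolding ergodic_measures_def
    by (intro CollectI conjI M bexI[OF _ one_in_L1_fix_space[OF M]] ballI) auto
qed

section \<open>Ergodic measures from extreme states, and from the orbit of a point\<close>

lemma ergodic_measure_exists:
  assumes ne: "invariant_states_on \<S> N \<noteq> {}"
    and N: "N \<subseteq> {h. continuous_on UNIV h \<and> (\<forall>x. 0 \<le> h x)}"
  obtains M where "M \<in> ergodic_measures \<S>" "\<And>h. h \<in> N \<Longrightarrow> (\<integral>x. h x \<partial>M) = 0"
proof -
  obtain \<phi> where \<phi>: "\<phi> \<in> invariant_states_on \<S> N" and extr: "extreme_state \<S> \<phi>"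
    by (rule extreme_invariant_state_exists[OF ne N])
  note conj = \<phi>[unfolded invariant_states_on_def mem_Collect_eq]
  note inv\<phi> = conjunct1[OF conj] and N0' = conjunct1[OF conjunct2[OF conj]]
  have st: "state \<phi>" using inv\<phi> by (simp add: invariant_state_def)
  obtain M :: "'k measure" where p: "prob_space M" "regular_borel_measure M"
    and M: "\<And>f. continuous_on UNIV f \<Longrightarrow> (\<integral>x. f x \<partial>M) = \<phi> f"
    by (rule riesz_representation[OF st]) (rule that)
  have reg: "regular_prob M" using p by (simp add: regular_prob_def)
  have "invariant_under M S" if S: "S \<in> \<S>" for S
  proof (rule invariant_underI[OF bspec[OF markov S] reg])
    fix f :: "'k \<Rightarrow> real" assume f: "continuous_on UNIV f"
    have "\<phi> (real_action S f) = \<phi> f" using inv\<phi> S f by (simp add: invariant_state_def)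
    then show "(\<integral>x. real_action S f x \<partial>M) = (\<integral>x. f x \<partial>M)"
      using M[OF f] M[OF real_action_continuous[OF bspec[OF markov S], of f]] by simp
  qed
  then have inv: "M \<in> invariant_measures \<S>" using reg by (simp add: invariant_measures_iff)
  show ?thesis
  proof (rule that)
    show "M \<in> ergodic_measures \<S>"
    proof (rule extreme_imp_ergodic[OF inv])
      show "extreme_state \<S> (\<lambda>f. \<integral>x. f x \<partial>M)"
        unfolding extreme_state_def
      proof (intro allI impI)
        fix \<psi> \<psi>' :: "('k \<Rightarrow> real) \<Rightarrow> real" and t :: real and f :: "'k \<Rightarrow> real"
        assume a: "invariant_state \<S> \<psi>" "invariant_state \<S> \<psi>'" "0 < t" "t < 1"
          and eq: "\<forall>f. continuous_on UNIV f \<longrightarrow> (\<integral>x. f x \<partial>M) = t * \<psi> f + (1 - t) * \<psi>' f"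
          and f: "continuous_on UNIV f"
        \<comment> \<open>The state and integration against \<open>M\<close> are known to agree only
          on continuous functions, which are the only ones that \<open>extreme_state\<close>
          inspects.\<close>
        have eq': "\<forall>f. continuous_on UNIV f \<longrightarrow> \<phi> f = t * \<psi> f + (1 - t) * \<psi>' f"
        proof (intro allI impI)
          fix f :: "'k \<Rightarrow> real" assume f: "continuous_on UNIV f"
          show "\<phi> f = t * \<psi> f + (1 - t) * \<psi>' f"
            unfolding M[OF f, symmetric] by (rule eq[THEN spec, THEN mp, OF f])
        qed
        show "\<psi> f = (\<integral>x. f x \<partial>M)"
          unfolding M[OF f]
          by (rule extr[unfolded extreme_state_def, THEN spec[of _ \<psi>], THEN spec[of _ \<psi>'],
                THEN spec[of _ t], THEN mp, THEN mp, THEN mp, THEN mp, THEN mp, OF a eq', THEN spec, THEN mp, OF f])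
      qed
    qed
    show "(\<integral>x. h x \<partial>M) = 0" if "h \<in> N" for h
      using M[of h] bspec[OF N0' that] subsetD[OF N that] by simp
  qed
qed

lemma continuous_evaluation: "continuous_on UNIV (\<lambda>f :: 'k CK. apply_bcontfun f x)"
  unfolding continuous_on_iff by (meson dist_bounded le_less_trans)

text \<open>The mean is applied to the orbit function that sends \<open>T\<close> to
  \<open>T f\<close> at \<open>x\<close>. Since \<open>(T S) f = T (S f)\<close>, the orbit function
  of \<open>S f\<close> is the right translate by \<open>S\<close> of that of \<open>f\<close>; this
  is why amenability on the right is the appropriate side. If \<open>T h\<close> vanishes at
  \<open>x\<close> for all \<open>T\<close>, the orbit function of \<open>h\<close> is 0.\<close>

lemma mean_orbit_state:
  assumes sg: "op_semigroup \<S>" and ra: "right_amenable \<S>"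
  shows "invariant_states_on \<S> {h. continuous_on UNIV h \<and> (\<forall>y. 0 \<le> h y) \<and> (\<forall>T\<in>\<S>. real_action T h x = 0)} \<noteq> {}"
proof -
  let ?X = "subtopology strong_operator_topology \<S>"
  have tX: "topspace ?X = \<S>" by (simp add: strong_operator_topology_topspace)
  obtain m where m: "positive_normalized_functional ?X m"
    and minv: "\<forall>S\<in>\<S>. \<forall>f\<in>bounded_continuous_functions ?X. m (right_translate \<S> S f) = m f"
    using ra unfolding right_amenable_def Let_def by blast
  note m' = m[unfolded positive_normalized_functional_def tX]
  let ?o = "\<lambda>f. (\<lambda>T\<in>\<S>. complex_of_real (real_action T f x))"
  have o: "?o f \<in> bounded_continuous_functions ?X" if f: "continuous_on UNIV f" for f
  proof -
    have "continuous_map ?X euclidean ((\<lambda>g. apply_bcontfun g x) \<circ>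
        (\<lambda>T. blinfun_apply T (Bcontfun (\<lambda>y. complex_of_real (f y)))))"
      by (rule continuous_map_compose[OF continuous_map_from_subtopology[OF strong_operator_topology_continuous_evaluation]])
        (simp add: continuous_evaluation)
    then have "continuous_map ?X euclidean (?o f)"
    proof (rule continuous_map_eq)
      fix T assume "T \<in> topspace ?X"
      then have T: "T \<in> \<S>" by (simp add: tX)
      then show "((\<lambda>g. apply_bcontfun g x) \<circ> (\<lambda>T. blinfun_apply T (Bcontfun (\<lambda>y. complex_of_real (f y))))) T = ?o f T"
        using of_real_real_action[OF bspec[OF markov T] f, of x] by simp
    qed
    moreover have "bounded (?o f ` \<S>)"
    proof -
      obtain B where B: "0 < B" "\<And>y. norm (f y) \<le> B"
        by (rule continuous_bounded[OF f]) (rule that)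
      have "cmod (?o f T) \<le> B" if T: "T \<in> \<S>" for T
      proof -
        note mk = bspec[OF markov T]
        have "\<bar>real_action T f x\<bar> \<le> real_action T (\<lambda>y. \<bar>f y\<bar>) x" by (rule abs_real_action_le[OF mk f])
        also have "\<dots> \<le> real_action T (\<lambda>_. B) x"
          using B(2) by (intro real_action_mono[OF mk continuous_on_rabs[OF f] continuous_on_const]) simp
        also have "\<dots> = B" by (rule real_action_const[OF mk])
        finally show ?thesis using T by simp
      qed
      then show ?thesis unfolding bounded_iff by blast
    qed
    ultimately show ?thesis
      unfolding bounded_continuous_functions_def continuous_functions_def tX by simp
  qed
  define \<phi> where "\<phi> f = (if continuous_on UNIV f then Re (m (?o f)) else 0)" for f
  have \<phi>: "\<phi> f = Re (m (?o f))" if "continuous_on UNIV f" for f using that by (simp add: \<phi>_def)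
  have "state \<phi>"
    unfolding state_def
  proof (intro conjI allI impI)
    fix f g :: "'k \<Rightarrow> real" assume f: "continuous_on UNIV f" and g: "continuous_on UNIV g"
    have "?o (\<lambda>y. f y + g y) = (\<lambda>T\<in>\<S>. ?o f T + ?o g T)"
      by (rule restrict_ext) (simp add: real_action_add[OF bspec[OF markov] f g])
    moreover have "m (\<lambda>T\<in>\<S>. ?o f T + ?o g T) = m (?o f) + m (?o g)"
      using m' o[OF f] o[OF g] by blast
    ultimately show "\<phi> (\<lambda>y. f y + g y) = \<phi> f + \<phi> g"
      unfolding \<phi>[OF continuous_on_add[OF f g]] \<phi>[OF f] \<phi>[OF g] by (simp only: plus_complex.sel)
  next
    fix f :: "'k \<Rightarrow> real" and c :: real assume f: "continuous_on UNIV f"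
    have "?o (\<lambda>y. c * f y) = (\<lambda>T\<in>\<S>. complex_of_real c * ?o f T)"
      by (rule restrict_ext) (simp add: real_action_scale[OF bspec[OF markov] f])
    moreover have "m (\<lambda>T\<in>\<S>. complex_of_real c * ?o f T) = complex_of_real c * m (?o f)"
      using m' o[OF f] by blast
    ultimately show "\<phi> (\<lambda>y. c * f y) = c * \<phi> f"
      unfolding \<phi>[OF continuous_on_mult_left[OF f]] \<phi>[OF f] by simp
  next
    fix f :: "'k \<Rightarrow> real" assume f: "continuous_on UNIV f" and nn: "\<forall>y. 0 \<le> f y"
    have "?o f T \<in> \<real>\<^sub>\<ge>\<^sub>0" if T: "T \<in> \<S>" for T
      using real_action_nonneg[OF bspec[OF markov T] f spec[OF nn]] T by simp
    then have "m (?o f) \<in> \<real>\<^sub>\<ge>\<^sub>0" using m' o[OF f] by blast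
    then show "0 \<le> \<phi> f" by (simp add: \<phi>[OF f] complex_nonneg_Reals_iff)
  next
    have "?o (\<lambda>_. 1) = (\<lambda>T\<in>\<S>. 1)"
      by (rule restrict_ext) (simp add: real_action_const[OF bspec[OF markov]])
    then show "\<phi> (\<lambda>_. 1) = 1" using m' by (simp add: \<phi>)
  qed
  moreover have "\<phi> (real_action S f) = \<phi> f" if S: "S \<in> \<S>" and f: "continuous_on UNIV f" for S f
  proof -
    have "right_translate \<S> S (?o f) = ?o (real_action S f)"
      unfolding right_translate_def
    proof (rule restrict_ext)
      fix T assume T: "T \<in> \<S>"
      then have "T o\<^sub>L S \<in> \<S>" using sg S by (simp add: op_semigroup_def)
      then show "?o f (T o\<^sub>L S) = complex_of_real (real_action T (real_action S f) x)"
        by (simp add: real_action_compose[OF bspec[OF markov S] f])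
    qed
    moreover have "m (right_translate \<S> S (?o f)) = m (?o f)" using minv S o[OF f] by blast
    ultimately show ?thesis
      by (simp add: \<phi>[OF f] \<phi>[OF real_action_continuous[OF bspec[OF markov S]]])
  qed
  moreover have "\<phi> h = 0" if h: "continuous_on UNIV h" "\<forall>T\<in>\<S>. real_action T h x = 0" for h
  proof -
    \<comment> \<open>That the mean of the zero function is 0 is read off from homogeneity with the
      scalar 0.\<close>
    have "?o h = (\<lambda>T\<in>\<S>. 0 * ?o h T)" by (rule restrict_ext) (simp add: h(2))
    moreover have "m (\<lambda>T\<in>\<S>. 0 * ?o h T) = 0 * m (?o h)" using m' o[OF h(1)] by blast
    ultimately show ?thesis by (simp add: \<phi>[OF h(1)])
  qed
  ultimately have "\<phi> \<in> invariant_states_on \<S> {h. continuous_on UNIV h \<and> (\<forall>y. 0 \<le> h y) \<and> (\<forall>T\<in>\<S>. real_action T h x = 0)}"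
    by (simp add: invariant_states_on_def invariant_state_def \<phi>_def)
  then show ?thesis by blast
qed

lemma ergodic_on_orbit_exists:
  assumes sg: "op_semigroup \<S>" and ra: "right_amenable \<S>"
  obtains M where "M \<in> ergodic_measures \<S>"
    "\<And>h. continuous_on UNIV h \<and> (\<forall>y. 0 \<le> h y) \<and> (\<forall>T\<in>\<S>. real_action T h x = 0) \<Longrightarrow> (\<integral>y. h y \<partial>M) = 0"
proof -
  obtain M where M: "M \<in> ergodic_measures \<S>"
    "\<And>h. h \<in> {h. continuous_on UNIV h \<and> (\<forall>y. 0 \<le> h y) \<and> (\<forall>T\<in>\<S>. real_action T h x = 0)} \<Longrightarrow> (\<integral>y. h y \<partial>M) = 0"
    by (rule ergodic_measure_exists[OF mean_orbit_state[OF sg ra, of x]]) (blast, rule that)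
  show ?thesis by (rule that[OF M(1) M(2)]) (rule CollectI)
qed

subsection \<open>The hull-kernel topology\<close>

lemma ergodicD:
  assumes "M \<in> ergodic_measures \<S>"
  shows "regular_prob M" "M \<in> invariant_measures \<S>" "S \<in> \<S> \<Longrightarrow> invariant_under M S"
proof -
  show i: "M \<in> invariant_measures \<S>" using assms by (simp add: ergodic_measures_def)
  then show "regular_prob M" "S \<in> \<S> \<Longrightarrow> invariant_under M S"
    by (simp_all add: invariant_measures_iff)
qed

lemma PrimE:
  assumes "p \<in> Prim \<S>"
  obtains M where "M \<in> ergodic_measures \<S>" "p = null_ideal M"
  using assms unfolding Prim_def by (rule imageE)

lemma Prim_I: "M \<in> ergodic_measures \<S> \<Longrightarrow> null_ideal M \<in> Prim \<S>"
  unfolding Prim_def by (rule imageI)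

text \<open>Membership in an intersection of primitive ideals depends only on where a function is
  nonzero: the nonvanishing set of the intersection is null for each measure involved. Continuous
  functions supported there can thus be used freely.\<close>

lemma Inter_Prim_of_subset:
  assumes A: "A \<subseteq> Prim \<S>" and f: "{x. apply_bcontfun f x \<noteq> 0} \<subseteq> nonvanishing_set (\<Inter>A)"
  shows "f \<in> \<Inter>A"
proof
  fix p assume p: "p \<in> A"
  then obtain M where M: "M \<in> ergodic_measures \<S>" "p = null_ideal M" using A PrimE by blast
  have "\<Inter>A \<subseteq> null_ideal M" using p M(2) by auto
  from measure_nonvanishing_set[OF ergodicD(1)[OF M(1)] this]
  show "f \<in> p" unfolding M(2)
    by (rule null_ideal_of_subset[OF ergodicD(1)[OF M(1)] f open_nonvanishing_set])
qed

lemma Inter_Prim_markov: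
  assumes A: "A \<subseteq> Prim \<S>" and f: "f \<in> \<Inter>A" and S: "S \<in> \<S>"
  shows "blinfun_apply S f \<in> \<Inter>A"
proof
  fix p assume p: "p \<in> A"
  then obtain M where M: "M \<in> ergodic_measures \<S>" "p = null_ideal M" using A PrimE by blast
  have "f \<in> null_ideal M" using f p M(2) by auto
  then show "blinfun_apply S f \<in> p" unfolding M(2)
    by (rule null_ideal_markov[OF ergodicD(1)[OF M(1)] bspec[OF markov S] ergodicD(3)[OF M(1) S]])
qed

text \<open>A zero-one law. Approximate the indicator of \<open>U\<close> from below by
  \<open>f\<close> in the intersection; invariance of the ideals keeps \<open>S f\<close> below the
  indicator, and as \<open>f\<close> and \<open>S f\<close> have the same integral,
  \<open>S f\<close> is equally close. So the indicator is fixed, hence constant almost everywhere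
  by ergodicity.\<close>

lemma measure_nonvanishing_set_cases:
  assumes A: "A \<subseteq> Prim \<S>" and M: "M \<in> ergodic_measures \<S>"
  shows "measure M (nonvanishing_set (\<Inter>A)) = 0 \<or> measure M (nonvanishing_set (\<Inter>A)) = 1"
proof -
  define U where "U = nonvanishing_set (\<Inter>A)"
  have oU: "open U" unfolding U_def by (rule open_nonvanishing_set)
  have bU: "U \<in> sets borel" by (rule borel_open[OF oU])
  note reg = ergodicD(1)[OF M]
  interpret prob_space M by (rule regular_prob_prob_space[OF reg])
  have Us: "U \<in> sets M" unfolding regular_prob_sets[OF reg] by (rule bU)
  have iU: "integrable M (indicator U :: 'k \<Rightarrow> real)"
    using Us by (intro integrable_real_indicator) (auto simp: less_top[symmetric])
  have fixed: "L1_fixed M S (indicator U)" if S: "S \<in> \<S>" for S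
  proof (rule L1_fixedI[OF bspec[OF markov S] reg ergodicD(3)[OF M S] iU])
    note mk = bspec[OF markov S]
    fix e :: real assume e: "0 < e"
    obtain f :: "'k \<Rightarrow> real" where f: "continuous_on UNIV f" "\<And>x. 0 \<le> f x" "\<And>x. f x \<le> 1"
        "L1_dist M (indicator U) f < e" and "open U \<longrightarrow> (\<forall>x. x \<notin> U \<longrightarrow> f x = 0)"
      by (rule continuous_approx_indicator[OF reg bU e]) (rule that)
    then have f0: "f x = 0" if "x \<notin> U" for x using oU that by blast
    have fle: "f x \<le> indicator U x" for x using f(3)[of x] f0[of x] by (simp add: indicator_def)
    let ?F = "Bcontfun (\<lambda>x. complex_of_real (f x))"
    note F = Bcontfun_of_real_apply[OF f(1)]
    have "{x. apply_bcontfun ?F x \<noteq> 0} \<subseteq> U" unfolding F using f0 by auto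
    then have "?F \<in> \<Inter>A" unfolding U_def by (rule Inter_Prim_of_subset[OF A])
    then have "blinfun_apply S ?F \<in> \<Inter>A" by (rule Inter_Prim_markov[OF A _ S])
    then have SU: "{x. apply_bcontfun (blinfun_apply S ?F) x \<noteq> 0} \<subseteq> U"
      unfolding U_def nonvanishing_set_def by (rule UN_upper)
    have r0: "real_action S f x = 0" if x: "x \<notin> U" for x
    proof -
      have "apply_bcontfun (blinfun_apply S ?F) x = 0" using SU x by blast
      then show ?thesis unfolding of_real_real_action[OF mk f(1)] by simp
    qed
    have r1: "real_action S f x \<le> 1" for x
      using real_action_mono[OF mk f(1) continuous_on_const f(3), of x]
      by (simp add: real_action_const[OF mk])
    have rle: "real_action S f x \<le> indicator U x" for x
      using r1[of x] r0[of x] by (simp add: indicator_def)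
    note fi = integrable_continuous[OF reg f(1)]
    note ri = integrable_continuous[OF reg real_action_continuous[OF mk, of f]]
    have "L1_dist M (indicator U) (real_action S f) = (\<integral>x. indicator U x - real_action S f x \<partial>M)"
      unfolding L1_dist_def using rle by (intro Bochner_Integration.integral_cong) auto
    also have "\<dots> = (\<integral>x. indicator U x - f x \<partial>M)"
      unfolding Bochner_Integration.integral_diff[OF iU ri] Bochner_Integration.integral_diff[OF iU fi]
        integral_real_action[OF mk reg ergodicD(3)[OF M S] f(1)] ..
    also have "\<dots> = L1_dist M (indicator U) f"
      unfolding L1_dist_def using fle by (intro Bochner_Integration.integral_cong) auto
    finally have "L1_dist M (indicator U) (real_action S f) < e" using f(4) by simp
    then show "\<exists>f. continuous_on UNIV f \<and> L1_dist M (indicator U) f < e \<and> L1_dist M (indicator U) (real_action S f) < e"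
      using f(1,4) by (intro exI[of _ f] conjI)
  qed
  have "(\<lambda>x. complex_of_real (indicator U x)) \<in> L1_fix_space \<S> M"
    by (rule L1_fixed_in_L1_fix_space[OF ergodicD(2)[OF M] iU fixed])
  from ergodic_fixed_const[OF M this]
  have c: "AE x in M. complex_of_real (indicator U x) = (LINT x|M. complex_of_real (indicator U x))" .
  have "measure M U = 0 \<or> measure M U = 1"
  proof (cases "(LINT x|M. complex_of_real (indicator U x)) = 0")
    case True
    have "AE x in M. x \<notin> U" using c
    proof eventually_elim
      case (elim x)
      then show ?case using True by (cases "x \<in> U") auto
    qed
    then show ?thesis using prob_eq_0[OF Us] by simp
  next
    case False
    have "AE x in M. x \<in> U" using c
    proof eventually_elim
      case (elim x)
      then show ?case using False by (cases "x \<in> U") auto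
    qed
    then show ?thesis using prob_eq_1[OF Us] by simp
  qed
  then show ?thesis unfolding U_def .
qed

text \<open>A compact subset of \<open>U \<inter> V\<close> carries a Urysohn function lying in both
  intersections, hence in the null ideal, so \<open>U \<inter> V\<close> is null. By the zero-one
  law \<open>U\<close> and \<open>V\<close> cannot both have positive measure, as each would then
  have measure 1.\<close>

lemma ergodic_null_ideal_prime:
  assumes A: "A \<subseteq> Prim \<S>" and B: "B \<subseteq> Prim \<S>" and M: "M \<in> ergodic_measures \<S>"
    and AB: "\<Inter>A \<inter> \<Inter>B \<subseteq> null_ideal M"
  shows "\<Inter>A \<subseteq> null_ideal M \<or> \<Inter>B \<subseteq> null_ideal M"
proof -
  note reg = ergodicD(1)[OF M]
  interpret prob_space M by (rule regular_prob_prob_space[OF reg])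
  define U V where "U = nonvanishing_set (\<Inter>A)" and "V = nonvanishing_set (\<Inter>B)"
  have o: "open U" "open V" unfolding U_def V_def by (rule open_nonvanishing_set)+
  have s: "U \<in> sets M" "V \<in> sets M" "U \<inter> V \<in> sets M"
    unfolding regular_prob_sets[OF reg] using o by auto
  have "measure M (U \<inter> V) \<le> 0"
  proof (rule field_le_epsilon)
    fix e :: real assume e: "0 < e"
    have oUV: "open (U \<inter> V)" using o by (rule open_Int)
    obtain C where C: "compact C" "C \<subseteq> U \<inter> V" "measure M (U \<inter> V) < measure M C + e"
      by (rule compact_inner_approx[OF reg borel_open[OF oUV] e])
    obtain f :: "'k \<Rightarrow> real" where f: "continuous_on UNIV f" "\<And>x. x \<in> C \<Longrightarrow> f x = 1" "\<And>x. x \<notin> U \<inter> V \<Longrightarrow> f x = 0"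
      by (rule urysohn_compact[OF compact_imp_closed[OF C(1)] oUV C(2)]) (rule that)
    let ?F = "Bcontfun (\<lambda>x. complex_of_real (f x))"
    note F = Bcontfun_of_real_apply[OF f(1)]
    have sub: "{x. apply_bcontfun ?F x \<noteq> 0} \<subseteq> U \<inter> V" unfolding F using f(3) by auto
    have "?F \<in> \<Inter>A"
      by (rule Inter_Prim_of_subset[OF A]) (use sub in \<open>auto simp: U_def\<close>)
    moreover have "?F \<in> \<Inter>B"
      by (rule Inter_Prim_of_subset[OF B]) (use sub in \<open>auto simp: V_def\<close>)
    ultimately have "?F \<in> null_ideal M" using AB by blast
    then have 0: "measure M {x. apply_bcontfun ?F x \<noteq> 0} = 0" by (simp only: null_ideal_iff_measure[OF reg])
    have CF: "C \<subseteq> {x. apply_bcontfun ?F x \<noteq> 0}" unfolding F using f(2) by auto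
    have "{x. apply_bcontfun ?F x \<noteq> 0} \<in> sets M"
      unfolding regular_prob_sets[OF reg] by (rule borel_open[OF open_nonzero])
    from finite_measure_mono[OF CF this] show "measure M (U \<inter> V) \<le> 0 + e" using 0 C(3) by linarith
  qed
  then have UV: "measure M (U \<inter> V) = 0" using measure_nonneg[of M] by (intro antisym)
  have "measure M U = 0 \<or> measure M V = 0"
  proof (rule ccontr)
    assume "\<not> ?thesis"
    then have "measure M U = 1" "measure M V = 1"
      using measure_nonvanishing_set_cases[OF A M] measure_nonvanishing_set_cases[OF B M]
      unfolding U_def V_def by blast+
    then have "AE x in M. x \<in> U" "AE x in M. x \<in> V" using prob_eq_1 s by blast+
    then have "AE x in M. x \<in> U \<inter> V" by eventually_elim simp
    then show False using prob_eq_1[OF s(3)] UV by simp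
  qed
  then show ?thesis
  proof
    assume 0: "measure M U = 0"
    have "f \<in> null_ideal M" if "f \<in> \<Inter>A" for f
    proof (rule null_ideal_of_subset[OF reg _ o(1) 0])
      show "{x. apply_bcontfun f x \<noteq> 0} \<subseteq> U" unfolding U_def nonvanishing_set_def using that by (rule UN_upper)
    qed
    then show ?thesis by blast
  next
    assume 0: "measure M V = 0"
    have "f \<in> null_ideal M" if "f \<in> \<Inter>B" for f
    proof (rule null_ideal_of_subset[OF reg _ o(2) 0])
      show "{x. apply_bcontfun f x \<noteq> 0} \<subseteq> V" unfolding V_def nonvanishing_set_def using that by (rule UN_upper)
    qed
    then show ?thesis by blast
  qed
qed

lemma hull_kernel_closure_Un:
  assumes A: "A \<subseteq> Prim \<S>" and B: "B \<subseteq> Prim \<S>"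
  shows "hull_kernel_closure \<S> (A \<union> B) = hull_kernel_closure \<S> A \<union> hull_kernel_closure \<S> B"
proof
  show "hull_kernel_closure \<S> A \<union> hull_kernel_closure \<S> B \<subseteq> hull_kernel_closure \<S> (A \<union> B)"
    unfolding hull_kernel_closure_def by blast
  show "hull_kernel_closure \<S> (A \<union> B) \<subseteq> hull_kernel_closure \<S> A \<union> hull_kernel_closure \<S> B"
  proof
    fix q assume "q \<in> hull_kernel_closure \<S> (A \<union> B)"
    then have q: "q \<in> Prim \<S>" "\<Inter>A \<inter> \<Inter>B \<subseteq> q" by (auto simp: hull_kernel_closure_def Inter_Un_distrib)
    obtain M where M: "M \<in> ergodic_measures \<S>" "q = null_ideal M" using q(1) by (rule PrimE)
    have "\<Inter>A \<subseteq> q \<or> \<Inter>B \<subseteq> q"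
      using ergodic_null_ideal_prime[OF A B M(1)] q(2) unfolding M(2) by blast
    then show "q \<in> hull_kernel_closure \<S> A \<union> hull_kernel_closure \<S> B"
      using q(1) by (auto simp: hull_kernel_closure_def)
  qed
qed

lemma hull_kernel_closure_increasing: "A \<subseteq> Prim \<S> \<Longrightarrow> A \<subseteq> hull_kernel_closure \<S> A"
  by (auto simp: hull_kernel_closure_def)

text \<open>Binary intersections of open sets use that the closure commutes with finite unions,
  which rests on primeness; arbitrary unions use only monotonicity of the closure.\<close>

lemma istopology_hull_kernel:
  "istopology (\<lambda>U. U \<subseteq> Prim \<S> \<and> hull_kernel_closure \<S> (Prim \<S> - U) = Prim \<S> - U)"
  unfolding istopology_def
proof (intro conjI allI impI)
  fix U V
  assume U: "U \<subseteq> Prim \<S> \<and> hull_kernel_closure \<S> (Prim \<S> - U) = Prim \<S> - U"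
    and V: "V \<subseteq> Prim \<S> \<and> hull_kernel_closure \<S> (Prim \<S> - V) = Prim \<S> - V"
  show "U \<inter> V \<subseteq> Prim \<S>" using U by auto
  show "hull_kernel_closure \<S> (Prim \<S> - U \<inter> V) = Prim \<S> - U \<inter> V"
    unfolding Diff_Int using U V by (subst hull_kernel_closure_Un) auto
next
  fix \<U> assume U: "\<forall>U\<in>\<U>. U \<subseteq> Prim \<S> \<and> hull_kernel_closure \<S> (Prim \<S> - U) = Prim \<S> - U"
  show "\<Union>\<U> \<subseteq> Prim \<S>" using U by blast
  show "hull_kernel_closure \<S> (Prim \<S> - \<Union>\<U>) = Prim \<S> - \<Union>\<U>"
  proof
    show "Prim \<S> - \<Union>\<U> \<subseteq> hull_kernel_closure \<S> (Prim \<S> - \<Union>\<U>)"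
      by (rule hull_kernel_closure_increasing) auto
    show "hull_kernel_closure \<S> (Prim \<S> - \<Union>\<U>) \<subseteq> Prim \<S> - \<Union>\<U>"
    proof
      fix q assume q: "q \<in> hull_kernel_closure \<S> (Prim \<S> - \<Union>\<U>)"
      then have "q \<in> hull_kernel_closure \<S> (Prim \<S> - U)" if "U \<in> \<U>" for U
        using that by (auto simp: hull_kernel_closure_def)
      then have "q \<in> Prim \<S> - U" if "U \<in> \<U>" for U
        using U that by blast
      moreover have "q \<in> Prim \<S>" using q by (simp add: hull_kernel_closure_def)
      ultimately show "q \<in> Prim \<S> - \<Union>\<U>" by blast
    qed
  qed
qed

lemma openin_hull_kernel:
  "openin (hull_kernel_topology \<S>) U \<longleftrightarrow> U \<subseteq> Prim \<S> \<and> hull_kernel_closure \<S> (Prim \<S> - U) = Prim \<S> - U"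
  unfolding hull_kernel_topology_def using istopology_hull_kernel by (simp only: topology_inverse')

lemma topspace_hull_kernel: "topspace (hull_kernel_topology \<S>) = Prim \<S>"
proof -
  \<comment> \<open>The empty intersection is all of \<open>C(K)\<close>, and no null ideal contains
    the constant 1.\<close>
  have "hull_kernel_closure \<S> {} = {}"
  proof -
    have False if q: "q \<in> Prim \<S>" "\<Inter>{} \<subseteq> q" for q
    proof -
      obtain M where M: "M \<in> ergodic_measures \<S>" "q = null_ideal M" using q(1) by (rule PrimE)
      then show False using q(2) one_notin_null_ideal[OF ergodicD(1)[OF M(1)]] by auto
    qed
    then show ?thesis unfolding hull_kernel_closure_def by blast
  qed
  then have "openin (hull_kernel_topology \<S>) (Prim \<S>)" by (simp add: openin_hull_kernel)
  moreover have "U \<subseteq> Prim \<S>" if "openin (hull_kernel_topology \<S>) U" for U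
    using that by (simp add: openin_hull_kernel)
  ultimately show ?thesis by (metis openin_subset openin_topspace subset_antisym)
qed

lemma closedin_hull_kernel:
  "closedin (hull_kernel_topology \<S>) C \<longleftrightarrow> C \<subseteq> Prim \<S> \<and> hull_kernel_closure \<S> C \<subseteq> C"
proof (cases "C \<subseteq> Prim \<S>")
  case True
  then have "Prim \<S> - (Prim \<S> - C) = C" by auto
  then show ?thesis
    unfolding closedin_def topspace_hull_kernel openin_hull_kernel
    using hull_kernel_closure_increasing[OF True] True by auto
qed (simp add: closedin_def topspace_hull_kernel)

subsection \<open>The representation of the fixed space\<close>

lemmas ergodic_reg = ergodicD(1)

lemma ergodic_fix_space:
  assumes M: "M \<in> ergodic_measures \<S>" and f: "f \<in> fix_space \<S>"
  shows "f - const_bcontfun (LINT x|M. apply_bcontfun f x) \<in> null_ideal M"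
  using ergodic_fix_space_const[OF M ergodicD(2)[OF M] f]
  by (simp add: null_ideal_iff_AE[OF ergodic_reg[OF M]])

text \<open>The integral is the only constant \<open>c\<close> with \<open>f - c\<close> in the null
  ideal, so it depends on the ideal alone; this makes the description by \<open>THE\<close> well
  defined.\<close>

lemma hat_null_ideal:
  assumes M: "M \<in> ergodic_measures \<S>" and f: "f \<in> fix_space \<S>"
  shows "hat \<S> f (null_ideal M) = (LINT x|M. apply_bcontfun f x)"
proof -
  have "(LINT x|\<nu>. apply_bcontfun f x) = (LINT x|M. apply_bcontfun f x)"
    if "\<nu> \<in> ergodic_measures \<S>" "null_ideal \<nu> = null_ideal M" for \<nu>
    using ergodic_fix_space[OF M f] unfolding that(2)[symmetric]
    by (rule integral_of_null_ideal_diff[OF ergodic_reg[OF that(1)]])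
  note eq = this
  have "(THE c. \<forall>\<nu>\<in>ergodic_measures \<S>. null_ideal \<nu> = null_ideal M \<longrightarrow> (LINT x|\<nu>. apply_bcontfun f x) = c)
      = (LINT x|M. apply_bcontfun f x)"
  proof (rule the_equality, intro ballI impI)
    show "(LINT x|\<nu>. apply_bcontfun f x) = (LINT x|M. apply_bcontfun f x)"
      if "\<nu> \<in> ergodic_measures \<S>" "null_ideal \<nu> = null_ideal M" for \<nu> by (rule eq[OF that])
    fix c assume "\<forall>\<nu>\<in>ergodic_measures \<S>. null_ideal \<nu> = null_ideal M \<longrightarrow> (LINT x|\<nu>. apply_bcontfun f x) = c"
    from mp[OF bspec[OF this M] refl] show "c = (LINT x|M. apply_bcontfun f x)" by (rule sym)
  qed
  then show ?thesis
    unfolding hat_def using Prim_I[OF M] by simp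
qed

section \<open>Consequences of a vanishing radical\<close>

context
  assumes radical_free: "radical_free \<S>"
begin

lemma radical_free_eq_0:
  assumes "\<And>M. M \<in> ergodic_measures \<S> \<Longrightarrow> f \<in> null_ideal M"
  shows "f = 0"
proof -
  have "f \<in> \<Inter>(Prim \<S>)" unfolding Prim_def using assms by auto
  then have "f \<in> {0}" unfolding radical_free[unfolded radical_free_def] .
  then show ?thesis by simp
qed

lemma ergodic_exists: "ergodic_measures \<S> \<noteq> {}"
proof
  assume "ergodic_measures \<S> = {}"
  then have "(one_CK :: 'k CK) = 0" by (intro radical_free_eq_0) simp
  then have "apply_bcontfun (one_CK :: 'k CK) undefined = 0" by simp
  then show False by simp
qed

text \<open>As \<open>S\<close> fixes the constant \<open>c\<close>, the difference
  \<open>S f - f\<close> equals \<open>S (f - c) - (f - c)\<close> and lies in every null ideal by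
  their invariance, hence in the radical.\<close>

lemma fix_spaceI:
  assumes "\<And>M. M \<in> ergodic_measures \<S> \<Longrightarrow> \<exists>c. f - const_bcontfun c \<in> null_ideal M"
  shows "f \<in> fix_space \<S>"
  unfolding fix_space_def
proof (intro CollectI ballI)
  fix S assume S: "S \<in> \<S>"
  have "blinfun_apply S f - f = 0"
  proof (rule radical_free_eq_0)
    fix M assume M: "M \<in> ergodic_measures \<S>"
    obtain c where c: "f - const_bcontfun c \<in> null_ideal M" using assms[OF M] ..
    note reg = ergodic_reg[OF M]
    have eq: "const_bcontfun c = cscale c one_CK"
      by (rule bcontfun_eqI) (simp add: cscale.rep_eq)
    have Sc: "blinfun_apply S (const_bcontfun c) = const_bcontfun c"
      by (simp only: eq markov_cscale[OF bspec[OF markov S]] markov_one[OF bspec[OF markov S]])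
    have "blinfun_apply S (f - const_bcontfun c) \<in> null_ideal M"
      by (rule null_ideal_markov[OF reg bspec[OF markov S] ergodicD(3)[OF M S] c])
    from null_ideal_diff[OF reg this c]
    show "blinfun_apply S f - f \<in> null_ideal M" by (simp add: blinfun.diff_right Sc)
  qed
  then show "blinfun_apply S f = f" by simp
qed

lemma fix_space_conjugate: "f \<in> fix_space \<S> \<Longrightarrow> conjugate f \<in> fix_space \<S>"
proof (rule fix_spaceI)
  fix M assume f: "f \<in> fix_space \<S>" and M: "M \<in> ergodic_measures \<S>"
  have "conjugate f - const_bcontfun (cnj (LINT x|M. apply_bcontfun f x)) \<in> null_ideal M"
    using ergodic_fix_space[OF M f]
    by (simp add: null_ideal_iff_AE[OF ergodic_reg[OF M]] conjugate.rep_eq)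
  then show "\<exists>c. conjugate f - const_bcontfun c \<in> null_ideal M" ..
qed

lemma modulus_diff_in_null_ideal:
  assumes M: "M \<in> ergodic_measures \<S>" and f: "f \<in> fix_space \<S>"
  shows "modulus f - const_bcontfun (complex_of_real (cmod (LINT x|M. apply_bcontfun f x))) \<in> null_ideal M"
proof -
  note iff = null_ideal_iff_AE[OF ergodic_reg[OF M]]
  have "AE x in M. apply_bcontfun f x = (LINT x|M. apply_bcontfun f x)"
    using ergodic_fix_space[OF M f] by (simp add: iff)
  then have "AE x in M. apply_bcontfun (modulus f) x = complex_of_real (cmod (LINT x|M. apply_bcontfun f x))"
    by eventually_elim (simp add: modulus.rep_eq)
  then show ?thesis by (simp add: iff)
qed

lemma fix_space_modulus: "f \<in> fix_space \<S> \<Longrightarrow> modulus f \<in> fix_space \<S>"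
  by (rule fix_spaceI) (rule exI, rule modulus_diff_in_null_ideal)

lemma fix_space_add: "f \<in> fix_space \<S> \<Longrightarrow> g \<in> fix_space \<S> \<Longrightarrow> f + g \<in> fix_space \<S>"
  by (simp add: fix_space_def blinfun.add_right)

lemma fix_space_cscale: "f \<in> fix_space \<S> \<Longrightarrow> cscale c f \<in> fix_space \<S>"
  using markov_cscale markov by (simp add: fix_space_def)

lemma fix_space_one: "one_CK \<in> fix_space \<S>"
  using markov_one markov by (simp add: fix_space_def)

lemma closed_fix_space: "closed (fix_space \<S>)"
proof -
  have "fix_space \<S> = (\<Inter>S\<in>\<S>. {f. blinfun_apply S f = f})" by (auto simp: fix_space_def)
  moreover have "closed {f. blinfun_apply S f = f}" for S :: "'k opCK"
    by (intro closed_Collect_eq continuous_on_id linear_continuous_on blinfun.bounded_linear_right)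
  ultimately show ?thesis by (simp add: closed_INT)
qed

lemma banach_sublattice_fix_space: "banach_sublattice (fix_space \<S>)"
  unfolding banach_sublattice_def
  by (intro conjI ballI allI fix_space_add fix_space_cscale fix_space_conjugate fix_space_modulus closed_fix_space)
     (simp_all add: fix_space_def blinfun.zero_right)

lemma hat_add:
  assumes f: "f \<in> fix_space \<S>" "g \<in> fix_space \<S>" and p: "p \<in> Prim \<S>"
  shows "hat \<S> (f + g) p = hat \<S> f p + hat \<S> g p"
proof -
  obtain M where M: "M \<in> ergodic_measures \<S>" "p = null_ideal M" by (rule PrimE[OF p])
  note CKi = integrable_CK[OF ergodic_reg[OF M(1)]]
  show ?thesis
    unfolding M(2) hat_null_ideal[OF M(1) f(1)] hat_null_ideal[OF M(1) f(2)]
      hat_null_ideal[OF M(1) fix_space_add[OF f]]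
    by (simp add: Bochner_Integration.integral_add[OF CKi CKi])
qed

lemma hat_cscale:
  assumes f: "f \<in> fix_space \<S>" and p: "p \<in> Prim \<S>"
  shows "hat \<S> (cscale c f) p = c * hat \<S> f p"
proof -
  obtain M where M: "M \<in> ergodic_measures \<S>" "p = null_ideal M" by (rule PrimE[OF p])
  show ?thesis
    unfolding M(2) hat_null_ideal[OF M(1) f] hat_null_ideal[OF M(1) fix_space_cscale[OF f]]
    by (simp add: cscale.rep_eq)
qed

lemma hat_modulus:
  assumes f: "f \<in> fix_space \<S>" and p: "p \<in> Prim \<S>"
  shows "hat \<S> (modulus f) p = complex_of_real (cmod (hat \<S> f p))"
proof -
  obtain M where M: "M \<in> ergodic_measures \<S>" "p = null_ideal M" by (rule PrimE[OF p])
  show ?thesis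
    unfolding M(2) hat_null_ideal[OF M(1) f] hat_null_ideal[OF M(1) fix_space_modulus[OF f]]
    by (rule integral_of_null_ideal_diff[OF ergodic_reg[OF M(1)] modulus_diff_in_null_ideal[OF M(1) f]])
qed

lemma hat_one:
  assumes p: "p \<in> Prim \<S>"
  shows "hat \<S> one_CK p = 1"
proof -
  obtain M where M: "M \<in> ergodic_measures \<S>" "p = null_ideal M" by (rule PrimE[OF p])
  interpret prob_space M by (rule regular_prob_prob_space[OF ergodic_reg[OF M(1)]])
  show ?thesis unfolding M(2) hat_null_ideal[OF M(1) fix_space_one] by (simp add: prob_space)
qed

lemma cmod_hat_le_norm:
  assumes f: "f \<in> fix_space \<S>" and p: "p \<in> Prim \<S>"
  shows "cmod (hat \<S> f p) \<le> norm f"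
proof -
  obtain M where M: "M \<in> ergodic_measures \<S>" "p = null_ideal M" by (rule PrimE[OF p])
  note reg = ergodic_reg[OF M(1)]
  interpret prob_space M by (rule regular_prob_prob_space[OF reg])
  have "cmod (LINT x|M. apply_bcontfun f x) \<le> (\<integral>x. cmod (apply_bcontfun f x) \<partial>M)"
    by (rule integral_norm_bound)
  also have "\<dots> \<le> (\<integral>x. norm f \<partial>M)"
    by (intro integral_mono integrable_norm integrable_CK[OF reg] norm_bounded) simp
  also have "\<dots> = norm f" by (simp add: prob_space)
  finally show ?thesis unfolding M(2) hat_null_ideal[OF M(1) f] .
qed

text \<open>For the nontrivial bound let \<open>s\<close> be the supremum of the modulus of the
  transform. The positive part of the modulus of \<open>f\<close> minus \<open>s\<close> vanishes
  almost everywhere for each ergodic measure, so it is 0.\<close>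

lemma sup_norm_hat:
  assumes f: "f \<in> fix_space \<S>"
  shows "sup_norm (hull_kernel_topology \<S>) (hat \<S> f) = norm f"
  unfolding sup_norm_def topspace_hull_kernel
proof (rule antisym)
  have ne: "Prim \<S> \<noteq> {}" using ergodic_exists by (simp add: Prim_def)
  show "(SUP p\<in>Prim \<S>. cmod (hat \<S> f p)) \<le> norm f"
    by (rule cSUP_least[OF ne]) (rule cmod_hat_le_norm[OF f])
  let ?M = "SUP p\<in>Prim \<S>. cmod (hat \<S> f p)"
  have up: "cmod (hat \<S> f p) \<le> ?M" if "p \<in> Prim \<S>" for p
    using that by (rule cSUP_upper) (rule bdd_aboveI2[OF cmod_hat_le_norm[OF f]])
  let ?g = "\<lambda>x. max 0 (cmod (apply_bcontfun f x) - ?M)"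
  have cg: "continuous_on UNIV ?g"
    by (intro continuous_on_max continuous_on_diff continuous_on_norm continuous_on_const continuous_on_apply_bcontfun)
  note G = Bcontfun_of_real_apply[OF cg]
  have "Bcontfun (\<lambda>x. complex_of_real (?g x)) = 0"
  proof (rule radical_free_eq_0)
    fix M assume M: "M \<in> ergodic_measures \<S>"
    note iff = null_ideal_iff_AE[OF ergodic_reg[OF M]]
    have le: "cmod (LINT x|M. apply_bcontfun f x) \<le> ?M"
      using up[OF Prim_I[OF M]] unfolding hat_null_ideal[OF M f] .
    have "AE x in M. apply_bcontfun f x = (LINT x|M. apply_bcontfun f x)"
      using ergodic_fix_space[OF M f] by (simp add: iff)
    then have "AE x in M. complex_of_real (?g x) = 0"
    proof eventually_elim
      case (elim x)
      then show ?case using le by (simp add: max_absorb1)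
    qed
    then show "Bcontfun (\<lambda>x. complex_of_real (?g x)) \<in> null_ideal M" unfolding iff G .
  qed
  then have "complex_of_real (?g x) = 0" for x using fun_cong[OF G, of x] by simp
  then have "?g x = 0" for x by simp
  then have "cmod (apply_bcontfun f x) \<le> ?M" for x by (metis diff_gt_0_iff_gt less_max_iff_disj linorder_not_le order_less_irrefl)
  then show "norm f \<le> ?M" by (rule norm_bound)
qed

text \<open>For closed \<open>C\<close> the distance from the value of \<open>f\<close> to
  \<open>C\<close> is a continuous function lying in each ideal whose transform value is in
  \<open>C\<close>. It therefore lies in each \<open>q\<close> of their closure, where it equals
  almost everywhere the distance from the transform at \<open>q\<close> to \<open>C\<close>.\<close>

lemma continuous_map_hat:
  assumes f: "f \<in> fix_space \<S>"
  shows "continuous_map (hull_kernel_topology \<S>) euclidean (hat \<S> f)"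
  unfolding continuous_map_closedin topspace_hull_kernel
proof (intro conjI allI impI)
  show "hat \<S> f \<in> Prim \<S> \<rightarrow> topspace euclidean" by simp
  fix C :: "complex set" assume "closedin euclidean C"
  then have C: "closed C" by simp
  show "closedin (hull_kernel_topology \<S>) {p \<in> Prim \<S>. hat \<S> f p \<in> C}"
    unfolding closedin_hull_kernel
  proof (intro conjI subsetI)
    fix q assume q: "q \<in> hull_kernel_closure \<S> {p \<in> Prim \<S>. hat \<S> f p \<in> C}"
    then have qP: "q \<in> Prim \<S>" and sub: "\<Inter>{p \<in> Prim \<S>. hat \<S> f p \<in> C} \<subseteq> q"
      by (simp_all add: hull_kernel_closure_def)
    obtain M where M: "M \<in> ergodic_measures \<S>" "q = null_ideal M" by (rule PrimE[OF qP])
    \<comment> \<open>\<open>infdist\<close> to the empty set is 0 by convention, so the empty set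
      has to be excluded before distance 0 means membership.\<close>
    have C0: "C \<noteq> {}"
    proof
      assume "C = {}"
      then have "one_CK \<in> \<Inter>{p \<in> Prim \<S>. hat \<S> f p \<in> C}" by simp
      then show False using sub one_notin_null_ideal[OF ergodic_reg[OF M(1)]] M(2) by auto
    qed
    let ?g = "\<lambda>x. infdist (apply_bcontfun f x) C"
    have cg: "continuous_on UNIV ?g"
      by (intro continuous_on_infdist continuous_on_apply_bcontfun)
    note G = Bcontfun_of_real_apply[OF cg]
    have AEf: "AE x in \<nu>. apply_bcontfun f x = hat \<S> f (null_ideal \<nu>)" if \<nu>: "\<nu> \<in> ergodic_measures \<S>" for \<nu>
      using ergodic_fix_space[OF \<nu> f] unfolding hat_null_ideal[OF \<nu> f]
      by (simp add: null_ideal_iff_AE[OF ergodic_reg[OF \<nu>]])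
    have "Bcontfun (\<lambda>x. complex_of_real (?g x)) \<in> \<Inter>{p \<in> Prim \<S>. hat \<S> f p \<in> C}"
    proof
      fix p assume "p \<in> {p \<in> Prim \<S>. hat \<S> f p \<in> C}"
      then have p: "p \<in> Prim \<S>" "hat \<S> f p \<in> C" by auto
      obtain \<nu> where \<nu>: "\<nu> \<in> ergodic_measures \<S>" "p = null_ideal \<nu>" by (rule PrimE[OF p(1)])
      have "AE x in \<nu>. complex_of_real (?g x) = 0"
        using AEf[OF \<nu>(1)] unfolding \<nu>(2)[symmetric]
        by eventually_elim (simp add: p(2) infdist_zero)
      then show "Bcontfun (\<lambda>x. complex_of_real (?g x)) \<in> p"
        unfolding \<nu>(2) null_ideal_iff_AE[OF ergodic_reg[OF \<nu>(1)]] G .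
    qed
    then have "Bcontfun (\<lambda>x. complex_of_real (?g x)) \<in> null_ideal M" using sub M(2) by blast
    then have AEg: "AE x in M. complex_of_real (?g x) = 0"
      unfolding null_ideal_iff_AE[OF ergodic_reg[OF M(1)]] G .
    interpret prob_space M by (rule regular_prob_prob_space[OF ergodic_reg[OF M(1)]])
    from AEg AEf[OF M(1)] have "AE x in M. infdist (hat \<S> f q) C = 0"
      unfolding M(2)[symmetric] by eventually_elim simp
    then have "infdist (hat \<S> f q) C = 0" by simp
    then have "hat \<S> f q \<in> C" using in_closed_iff_infdist_zero[OF C C0] by simp
    then show "q \<in> {p \<in> Prim \<S>. hat \<S> f p \<in> C}" using qP by simp
  qed auto
qed

lemma hat_continuous: "f \<in> fix_space \<S> \<Longrightarrow> hat \<S> f \<in> continuous_functions (hull_kernel_topology \<S>)"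
  using continuous_map_hat
  by (simp add: continuous_functions_def topspace_hull_kernel hat_def)

lemma hat_inj: "inj_on (hat \<S>) (fix_space \<S>)"
proof (rule inj_onI)
  fix f g assume f: "f \<in> fix_space \<S>" and g: "g \<in> fix_space \<S>" and eq: "hat \<S> f = hat \<S> g"
  have "f - g = 0"
  proof (rule radical_free_eq_0)
    fix M assume M: "M \<in> ergodic_measures \<S>"
    have eq': "(LINT x|M. apply_bcontfun f x) = (LINT x|M. apply_bcontfun g x)"
      using fun_cong[OF eq, of "null_ideal M"] unfolding hat_null_ideal[OF M f] hat_null_ideal[OF M g] .
    from null_ideal_diff[OF ergodic_reg[OF M] ergodic_fix_space[OF M f] ergodic_fix_space[OF M g]]
    show "f - g \<in> null_ideal M" unfolding eq' by simp
  qed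
  then show "f = g" by simp
qed

section \<open>Surjectivity of the transform\<close>

context
  assumes sg: "op_semigroup \<S>" and ra: "right_amenable \<S>"
begin

context
  fixes g :: "'k CK set \<Rightarrow> complex"
  assumes g: "continuous_map (hull_kernel_topology \<S>) euclidean g"
begin

text \<open>
  The value \<open>c\<close> is \<open>g I\<^sub>\<eta>\<close> for an ergodic \<open>\<eta>\<close> carried by the orbit of \<open>x\<close>, and \<open>{h \<noteq> 0}\<close> is the
  neighbourhood of \<open>x\<close> in which every ergodic measure gives a value of \<open>g\<close> near \<open>c\<close>.
\<close>

lemma orbit_value_exists:
  "\<exists>c. \<forall>e>0. \<exists>h. apply_bcontfun h x \<noteq> 0 \<and> (\<forall>p\<in>Prim \<S>. h \<notin> p \<longrightarrow> dist (g p) c < e)"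
proof -
  obtain \<eta> where \<eta>: "\<eta> \<in> ergodic_measures \<S>"
    "\<And>h. continuous_on UNIV h \<and> (\<forall>y. 0 \<le> h y) \<and> (\<forall>T\<in>\<S>. real_action T h x = 0) \<Longrightarrow> (\<integral>y. h y \<partial>\<eta>) = 0"
    by (rule ergodic_on_orbit_exists[OF sg ra, where x = x]) (rule that)
  let ?c = "g (null_ideal \<eta>)"
  have "\<exists>h. apply_bcontfun h x \<noteq> 0 \<and> (\<forall>p\<in>Prim \<S>. h \<notin> p \<longrightarrow> dist (g p) ?c < e)" if e: "0 < e" for e
  proof -
    let ?B = "{p \<in> Prim \<S>. g p \<in> - ball ?c e}"
    have "closedin (hull_kernel_topology \<S>) {p \<in> topspace (hull_kernel_topology \<S>). g p \<in> - ball ?c e}"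
      by (rule closedin_continuous_map_preimage[OF g]) auto
    then have cl: "hull_kernel_closure \<S> ?B \<subseteq> ?B"
      unfolding topspace_hull_kernel closedin_hull_kernel by (rule conjunct2)
    have "null_ideal \<eta> \<notin> ?B" using e by simp
    then have "null_ideal \<eta> \<notin> hull_kernel_closure \<S> ?B" using cl by blast
    then have "\<not> \<Inter>?B \<subseteq> null_ideal \<eta>"
      using Prim_I[OF \<eta>(1)] by (simp add: hull_kernel_closure_def)
    then obtain f where f: "f \<in> \<Inter>?B" "f \<notin> null_ideal \<eta>" by blast
    let ?a = "\<lambda>y. cmod (apply_bcontfun f y)"
    have ca: "continuous_on UNIV ?a" by (intro continuous_on_norm continuous_on_apply_bcontfun)
    have "(\<integral>y. ?a y \<partial>\<eta>) \<noteq> 0" using f(2) by (simp add: null_ideal_def)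
    then have "\<not> (\<forall>T\<in>\<S>. real_action T ?a x = 0)" using \<eta>(2)[of ?a] ca by auto
    then obtain T where T: "T \<in> \<S>" "real_action T ?a x \<noteq> 0" by blast
    have "modulus f = Bcontfun (\<lambda>y. complex_of_real (?a y))"
      by (rule bcontfun_eqI) (simp add: modulus.rep_eq Bcontfun_of_real_apply[OF ca])
    then have "apply_bcontfun (blinfun_apply T (modulus f)) x \<noteq> 0"
      using T(2) of_real_real_action[OF bspec[OF markov T(1)] ca, of x] by simp
    moreover have "\<forall>p\<in>Prim \<S>. blinfun_apply T (modulus f) \<notin> p \<longrightarrow> dist (g p) ?c < e"
    proof (intro ballI impI)
      fix p assume p: "p \<in> Prim \<S>" "blinfun_apply T (modulus f) \<notin> p"
      obtain \<nu> where \<nu>: "\<nu> \<in> ergodic_measures \<S>" "p = null_ideal \<nu>" by (rule PrimE[OF p(1)])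
      note reg = ergodic_reg[OF \<nu>(1)]
      \<comment> \<open>Null ideals are stable under the modulus and under \<open>T\<close>, so
        \<open>f\<close> in the ideal would force \<open>blinfun_apply T (modulus f)\<close> into
        it.\<close>
      have "f \<notin> null_ideal \<nu>"
      proof
        assume "f \<in> null_ideal \<nu>"
        from null_ideal_markov[OF reg bspec[OF markov T(1)] ergodicD(3)[OF \<nu>(1) T(1)]
            null_ideal_modulus[OF reg this]]
        show False using p(2) \<nu>(2) by simp
      qed
      then have "p \<notin> ?B" using f(1) \<nu>(2) by blast
      then show "dist (g p) ?c < e" using p(1) by (simp add: dist_commute)
    qed
    ultimately show ?thesis by blast
  qed
  then show ?thesis by blast
qed

text \<open>The value is chosen by its neighbourhood property instead of through a chosen measure;
  that property is all the later arguments use.\<close>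

definition orbit_value :: "'k \<Rightarrow> complex" where
  "orbit_value x = (SOME c. \<forall>e>0. \<exists>h. apply_bcontfun h x \<noteq> 0 \<and> (\<forall>p\<in>Prim \<S>. h \<notin> p \<longrightarrow> dist (g p) c < e))"

lemma orbit_valueE:
  assumes "0 < e"
  obtains h where "apply_bcontfun h x \<noteq> 0" "\<And>p. p \<in> Prim \<S> \<Longrightarrow> h \<notin> p \<Longrightarrow> dist (g p) (orbit_value x) < e"
  using someI_ex[OF orbit_value_exists[of x], folded orbit_value_def] assms by blast

text \<open>For \<open>y\<close> in the neighbourhood of \<open>x\<close> given by \<open>h\<close>,
  and \<open>k\<close> its counterpart at \<open>y\<close>, the product of \<open>h\<close> and
  \<open>k\<close> is nonzero at \<open>y\<close>. So some ergodic \<open>M\<close> has neither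
  \<open>h\<close> nor \<open>k\<close> in its null ideal, and the value of \<open>g\<close> there
  is within \<open>e / 2\<close> of both orbit values.\<close>

lemma continuous_orbit_value: "continuous_on UNIV orbit_value"
  unfolding continuous_on_eq_continuous_at[OF open_UNIV] isCont_def
proof (intro ballI tendstoI)
  fix x :: 'k and e :: real assume "0 < e"
  then have e: "0 < e / 2" by simp
  obtain h where h: "apply_bcontfun h x \<noteq> 0" "\<And>p. p \<in> Prim \<S> \<Longrightarrow> h \<notin> p \<Longrightarrow> dist (g p) (orbit_value x) < e / 2"
    by (rule orbit_valueE[OF e]) (rule that)
  have "dist (orbit_value y) (orbit_value x) < e" if y: "apply_bcontfun h y \<noteq> 0" for y
  proof -
    obtain k where k: "apply_bcontfun k y \<noteq> 0" "\<And>p. p \<in> Prim \<S> \<Longrightarrow> k \<notin> p \<Longrightarrow> dist (g p) (orbit_value y) < e / 2"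
      by (rule orbit_valueE[OF e]) (rule that)
    have "continuous_on UNIV (\<lambda>z. apply_bcontfun h z * apply_bcontfun k z)"
      by (intro continuous_on_mult continuous_on_apply_bcontfun)
    note P = Bcontfun_apply[OF this]
    let ?P = "Bcontfun (\<lambda>z. apply_bcontfun h z * apply_bcontfun k z)"
    have "?P \<noteq> 0" using fun_cong[OF P, of y] y k(1) by auto
    then obtain M where M: "M \<in> ergodic_measures \<S>" "?P \<notin> null_ideal M"
      using radical_free_eq_0 by blast
    note iff = null_ideal_iff_AE[OF ergodic_reg[OF M(1)]]
    have nP: "\<not> (AE z in M. apply_bcontfun h z * apply_bcontfun k z = 0)" using M(2) unfolding iff P .
    have "h \<notin> null_ideal M"
    proof
      assume "h \<in> null_ideal M"
      then have "AE z in M. apply_bcontfun h z * apply_bcontfun k z = 0"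
        unfolding iff by eventually_elim simp
      then show False using nP by contradiction
    qed
    moreover have "k \<notin> null_ideal M"
    proof
      assume "k \<in> null_ideal M"
      then have "AE z in M. apply_bcontfun h z * apply_bcontfun k z = 0"
        unfolding iff by eventually_elim simp
      then show False using nP by contradiction
    qed
    ultimately have "dist (g (null_ideal M)) (orbit_value x) < e / 2" "dist (g (null_ideal M)) (orbit_value y) < e / 2"
      using h(2) k(2) Prim_I[OF M(1)] by blast+
    then show ?thesis using dist_triangle2[of "orbit_value y" "orbit_value x" "g (null_ideal M)"]
      by (simp add: dist_commute)
  qed
  then show "\<forall>\<^sub>F y in at x. dist (orbit_value y) (orbit_value x) < e"
    unfolding eventually_at_topological using h(1) open_nonzero[of h] by blast
qed

text \<open>If the orbit value at \<open>x\<close> differs from \<open>g\<close> at the ideal of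
  \<open>M\<close>, take exactly this difference as the tolerance: the resulting \<open>h\<close>
  must lie in the ideal, so \<open>x\<close> lies in its nonvanishing set, which is null.\<close>

lemma orbit_value_null_ideal:
  assumes M: "M \<in> ergodic_measures \<S>"
  shows "Bcontfun orbit_value - const_bcontfun (g (null_ideal M)) \<in> null_ideal M"
proof (rule null_ideal_of_subset[OF ergodic_reg[OF M] _ open_nonvanishing_set
      measure_nonvanishing_set[OF ergodic_reg[OF M] subset_refl]])
  show "{x. apply_bcontfun (Bcontfun orbit_value - const_bcontfun (g (null_ideal M))) x \<noteq> 0}
      \<subseteq> nonvanishing_set (null_ideal M)"
  proof
    fix x assume "x \<in> {x. apply_bcontfun (Bcontfun orbit_value - const_bcontfun (g (null_ideal M))) x \<noteq> 0}"
    then have "0 < dist (g (null_ideal M)) (orbit_value x)"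
      by (simp add: Bcontfun_apply[OF continuous_orbit_value])
    then obtain h where h: "apply_bcontfun h x \<noteq> 0"
        "\<And>p. p \<in> Prim \<S> \<Longrightarrow> h \<notin> p \<Longrightarrow> dist (g p) (orbit_value x) < dist (g (null_ideal M)) (orbit_value x)"
      by (rule orbit_valueE) (rule that)
    have "h \<in> null_ideal M" using h(2)[OF Prim_I[OF M]] by blast
    then show "x \<in> nonvanishing_set (null_ideal M)"
      using h(1) by (auto simp: nonvanishing_set_def)
  qed
qed

lemma orbit_value_in_fix_space: "Bcontfun orbit_value \<in> fix_space \<S>"
  by (rule fix_spaceI) (rule exI, rule orbit_value_null_ideal)

lemma hat_orbit_value:
  assumes p: "p \<in> Prim \<S>"
  shows "hat \<S> (Bcontfun orbit_value) p = g p"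
proof -
  obtain M where M: "M \<in> ergodic_measures \<S>" "p = null_ideal M" by (rule PrimE[OF p])
  show ?thesis
    unfolding M(2) hat_null_ideal[OF M(1) orbit_value_in_fix_space]
    by (rule integral_of_null_ideal_diff[OF ergodic_reg[OF M(1)] orbit_value_null_ideal[OF M(1)]])
qed

end

lemma hat_surj:
  assumes "g \<in> continuous_functions (hull_kernel_topology \<S>)"
  shows "g \<in> hat \<S> ` fix_space \<S>"
proof
  have g: "continuous_map (hull_kernel_topology \<S>) euclidean g" "g \<in> extensional (Prim \<S>)"
    using assms by (simp_all add: continuous_functions_def topspace_hull_kernel)
  show "Bcontfun (orbit_value g) \<in> fix_space \<S>" by (rule orbit_value_in_fix_space[OF g(1)])
  have "hat \<S> (Bcontfun (orbit_value g)) \<in> extensional (Prim \<S>)" by (simp add: hat_def)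
  from extensionalityI[OF g(2) this] show "g = hat \<S> (Bcontfun (orbit_value g))"
    using hat_orbit_value[OF g(1)] by simp
qed

lemma hat_bij: "bij_betw (hat \<S>) (fix_space \<S>) (continuous_functions (hull_kernel_topology \<S>))"
  unfolding bij_betw_def using hat_inj hat_continuous hat_surj by blast

end

end

end

end

theorem theorem6p3:
  fixes \<S> :: "('k::t2_space) opCK set"
  assumes "compact (UNIV :: 'k set)"
    and "op_semigroup \<S>"
    and "\<forall>S\<in>\<S>. markov_op S"
    and "right_amenable \<S>"
    and "radical_free \<S>"
  shows "banach_sublattice (fix_space \<S>) \<and>
    (\<forall>f\<in>fix_space \<S>. \<forall>\<mu>\<in>ergodic_measures \<S>.
       hat \<S> f (null_ideal \<mu>) = (LINT x|\<mu>. apply_bcontfun f x)) \<and>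
    isometric_markov_lattice_isomorphism (fix_space \<S>) (hull_kernel_topology \<S>) (hat \<S>)"
proof -
  note K = assms(1) and markov = assms(3)
  note rad = K markov assms(5)
  have "isometric_markov_lattice_isomorphism (fix_space \<S>) (hull_kernel_topology \<S>) (hat \<S>)"
    unfolding isometric_markov_lattice_isomorphism_def topspace_hull_kernel[OF K markov]
    by (intro conjI ballI allI hat_bij[OF rad assms(2,4)] hat_add[OF rad] hat_cscale[OF rad] hat_modulus[OF rad]
        fix_space_one[OF rad] hat_one[OF rad] sup_norm_hat[OF rad])
  moreover have "\<forall>f\<in>fix_space \<S>. \<forall>\<mu>\<in>ergodic_measures \<S>.
      hat \<S> f (null_ideal \<mu>) = (LINT x|\<mu>. apply_bcontfun f x)"
    by (intro ballI hat_null_ideal[OF K markov])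
  ultimately show ?thesis
    using banach_sublattice_fix_space[OF rad] by blast
qed

end
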